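(* Let $L:\Omega\times\mathbb{R}\times\mathbb{R}^N\to\mathbb{R}$ be a Carathéodory function, let $q\in L^1(\Omega)$ and let $h:\mathbb{R}\to[0,+\infty)$ be a Borel map. Assume that at least one of the two following assumptions is satisfied: (1) For every $s\in\mathbb{R}$, there exist an integer $m_s\geq 1$, vectors $\xi_1^s,\dots,\xi_{m_s}^s\in\mathbb{R}^N$ containing $0$ in their convex hull, and $\delta_s>0$ such that, for a.e. $x\in\Omega$ and every $t\in[s-\delta_s,s+\delta_s]$, $$\sum_{j=1}^{m_s}\overline L(x,t,\xi_j^s)\leq h(s)+q(x).$$ (2) There exists $b\in W^{1,p}(\Omega)\cap L^\infty(\Omega)$ such that for a.e. $x\in\Omega$ and every $s,t\in\mathbb{R}$ satisfying $|s-t|\leq \operatorname{ess\,osc}_{\Omega}b$, one has $$\overline L(x,t,\nabla b(x))\leq h(s)+q(x).$$ Then $\mathcal L$ is $L^\infty(\Omega)$-regular at every $u\in\mathcal A$ such that $h\circ u\in L^1(\Omega)$.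
   Context: Let $N\ge 1$, let $\Omega\subset\mathbb{R}^N$ be a bounded open set, $1\leq p\leq N$, and $\varphi\in W^{1,p}(\mathbb{R}^N)\cap L^\infty(\mathbb{R}^N)$. $W^{1,p}_0(\Omega)$ is the closure in $W^{1,p}(\Omega)$ of the $C^1$ functions with compact support in $\Omega$, and $W^{1,p}_\varphi(\Omega)=\varphi+W^{1,p}_0(\Omega)$. A function $L:\Omega\times\mathbb{R}\times\mathbb{R}^N\to\mathbb{R}$ is Carathéodory if $L(\cdot,t,\xi)$ is measurable for every $(t,\xi)$ and $L(x,\cdot,\cdot)$ is continuous for a.e. $x$. Set $\mathcal L(u)=\int_\Omega L(x,u(x),\nabla u(x))\,dx$, and let $\mathcal A=\{u\in W^{1,p}_\varphi(\Omega): L(x,u,\nabla u)\in L^1(\Omega)\}$. The functional $\mathcal L$ is said to be $L^\infty(\Omega)$-regular at $u\in\mathcal A$ if there exists a sequence $(u_k)_{k\ge1}\subset\mathcal A\cap L^\infty(\Omega)$ such that $u_k\to u$ in $W^{1,p}(\Omega)$ and $L(x,u_k,\nabla u_k)\to L(x,u,\nabla u)$ in $L^1(\Omega)$. Notation: $\overline L(x,t,\xi):=|L(x,t,\xi)|+|\xi|^p$; for $c\in L^\infty(\Omega)$, $\operatorname{ess\,osc}_\Omega c:=\operatorname{ess\,sup}_\Omega c-\operatorname{ess\,inf}_\Omega c$. *)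

theory Defs
  imports "HOL-Analysis.Analysis" "HOL-Probability.Essential_Supremum"
begin

text \<open>
  The ambient space is an arbitrary Euclidean space \<open>'a\<close> of dimension \<open>N = DIM('a)\<close>. Functions
  defined almost everywhere on \<open>\<Omega>\<close> are represented by total functions on \<open>'a\<close>; no notion below
  depends on their values outside \<open>\<Omega>\<close>. Measurability and integrals refer to Lebesgue measure on
  \<open>\<Omega>\<close>.
\<close>

definition Lp :: "real \<Rightarrow> 'a::euclidean_space set \<Rightarrow> ('a \<Rightarrow> 'b::euclidean_space) set" where
  "Lp p \<Omega> = {f \<in> borel_measurable (lebesgue_on \<Omega>).
     integrable (lebesgue_on \<Omega>) (\<lambda>x. norm (f x) powr p)}"

definition Lp_norm :: "real \<Rightarrow> 'a::euclidean_space set \<Rightarrow> ('a \<Rightarrow> 'b::euclidean_space) \<Rightarrow> real" where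
  "Lp_norm p \<Omega> f = (LINT x|lebesgue_on \<Omega>. norm (f x) powr p) powr (1 / p)"

definition Linf :: "'a::euclidean_space set \<Rightarrow> ('a \<Rightarrow> real) set" where
  "Linf \<Omega> = {f \<in> borel_measurable (lebesgue_on \<Omega>). \<exists>C. AE x in lebesgue_on \<Omega>. \<bar>f x\<bar> \<le> C}"

definition ess_inf :: "'a measure \<Rightarrow> ('a \<Rightarrow> ereal) \<Rightarrow> ereal" where
  "ess_inf M f = - esssup M (\<lambda>x. - f x)"

definition ess_osc :: "'a::euclidean_space set \<Rightarrow> ('a \<Rightarrow> real) \<Rightarrow> ereal" where
  "ess_osc \<Omega> c = esssup (lebesgue_on \<Omega>) (\<lambda>x. ereal (c x)) - ess_inf (lebesgue_on \<Omega>) (\<lambda>x. ereal (c x))"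

text \<open>\<open>C1c_with_gradient \<Omega> \<eta> \<eta>'\<close>: \<open>\<eta>\<close>, extended by zero, is \<open>C\<^sup>1\<close> with compact support in \<open>\<Omega>\<close> and
  has gradient \<open>\<eta>'\<close>.\<close>

definition C1c_with_gradient ::
    "'a::euclidean_space set \<Rightarrow> ('a \<Rightarrow> real) \<Rightarrow> ('a \<Rightarrow> 'a) \<Rightarrow> bool" where
  "C1c_with_gradient \<Omega> \<eta> \<eta>' \<longleftrightarrow>
     (\<forall>x. GDERIV \<eta> x :> \<eta>' x) \<and> continuous_on UNIV \<eta>' \<and>
     compact (closure {x. \<eta> x \<noteq> 0}) \<and> closure {x. \<eta> x \<noteq> 0} \<subseteq> \<Omega>"

definition C1c :: "'a::euclidean_space set \<Rightarrow> ('a \<Rightarrow> real) set" where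
  "C1c \<Omega> = {\<eta>. \<exists>\<eta>'. C1c_with_gradient \<Omega> \<eta> \<eta>'}"

definition locally_integrable ::
    "'a::euclidean_space set \<Rightarrow> ('a \<Rightarrow> 'b::euclidean_space) \<Rightarrow> bool" where
  "locally_integrable \<Omega> f \<longleftrightarrow> (\<forall>K. compact K \<and> K \<subseteq> \<Omega> \<longrightarrow> f absolutely_integrable_on K)"

text \<open>The integration by parts formulas for all the partial derivatives are written as one
  vector-valued identity.\<close>

definition has_weak_gradient ::
    "'a::euclidean_space set \<Rightarrow> ('a \<Rightarrow> real) \<Rightarrow> ('a \<Rightarrow> 'a) \<Rightarrow> bool" where
  "has_weak_gradient \<Omega> u g \<longleftrightarrow>
     locally_integrable \<Omega> u \<and> locally_integrable \<Omega> g \<and>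
     (\<forall>\<eta> \<eta>'. C1c_with_gradient \<Omega> \<eta> \<eta>' \<longrightarrow>
        (LINT x|lebesgue_on \<Omega>. u x *\<^sub>R \<eta>' x) = - (LINT x|lebesgue_on \<Omega>. \<eta> x *\<^sub>R g x))"

text \<open>The weak gradient is unique only up to null sets; \<open>weak_grad\<close> picks a representative.\<close>

definition weak_grad :: "'a::euclidean_space set \<Rightarrow> ('a \<Rightarrow> real) \<Rightarrow> 'a \<Rightarrow> 'a" where
  "weak_grad \<Omega> u = (SOME g. has_weak_gradient \<Omega> u g)"

definition W1p :: "real \<Rightarrow> 'a::euclidean_space set \<Rightarrow> ('a \<Rightarrow> real) set" where
  "W1p p \<Omega> = {u \<in> Lp p \<Omega>. \<exists>g \<in> Lp p \<Omega>. has_weak_gradient \<Omega> u g}"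

definition W1p_norm :: "real \<Rightarrow> 'a::euclidean_space set \<Rightarrow> ('a \<Rightarrow> real) \<Rightarrow> real" where
  "W1p_norm p \<Omega> u = Lp_norm p \<Omega> u + Lp_norm p \<Omega> (weak_grad \<Omega> u)"

definition W1p0 :: "real \<Rightarrow> 'a::euclidean_space set \<Rightarrow> ('a \<Rightarrow> real) set" where
  "W1p0 p \<Omega> = {u \<in> W1p p \<Omega>. \<forall>\<epsilon>>0. \<exists>\<eta> \<in> C1c \<Omega>. W1p_norm p \<Omega> (\<lambda>x. u x - \<eta> x) < \<epsilon>}"

definition W1p_bdry ::
    "real \<Rightarrow> 'a::euclidean_space set \<Rightarrow> ('a \<Rightarrow> real) \<Rightarrow> ('a \<Rightarrow> real) set" where
  "W1p_bdry p \<Omega> \<phi> = {u \<in> W1p p \<Omega>. (\<lambda>x. u x - \<phi> x) \<in> W1p0 p \<Omega>}"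

definition caratheodory ::
    "'a::euclidean_space set \<Rightarrow> ('a \<Rightarrow> real \<Rightarrow> 'a \<Rightarrow> real) \<Rightarrow> bool" where
  "caratheodory \<Omega> L \<longleftrightarrow>
     (\<forall>t \<xi>. (\<lambda>x. L x t \<xi>) \<in> borel_measurable (lebesgue_on \<Omega>)) \<and>
     (AE x in lebesgue_on \<Omega>. continuous_on UNIV (\<lambda>(t, \<xi>). L x t \<xi>))"

definition Lbar ::
    "real \<Rightarrow> ('a::euclidean_space \<Rightarrow> real \<Rightarrow> 'a \<Rightarrow> real) \<Rightarrow> 'a \<Rightarrow> real \<Rightarrow> 'a \<Rightarrow> real" where
  "Lbar p L x t \<xi> = \<bar>L x t \<xi>\<bar> + norm \<xi> powr p"

definition along ::
    "'a::euclidean_space set \<Rightarrow> ('a \<Rightarrow> real \<Rightarrow> 'a \<Rightarrow> real) \<Rightarrow> ('a \<Rightarrow> real) \<Rightarrow> 'a \<Rightarrow> real" where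
  "along \<Omega> L u x = L x (u x) (weak_grad \<Omega> u x)"

definition admissible ::
    "real \<Rightarrow> 'a::euclidean_space set \<Rightarrow> ('a \<Rightarrow> real) \<Rightarrow> ('a \<Rightarrow> real \<Rightarrow> 'a \<Rightarrow> real) \<Rightarrow>
      ('a \<Rightarrow> real) set" where
  "admissible p \<Omega> \<phi> L = {u \<in> W1p_bdry p \<Omega> \<phi>. integrable (lebesgue_on \<Omega>) (along \<Omega> L u)}"

text \<open>Regularity at \<open>u\<close> of the functional \<open>u \<mapsto> \<integral>\<^sub>\<Omega> L(x, u, \<nabla>u) dx\<close> on \<open>admissible p \<Omega> \<phi> L\<close>;
  meaningful for \<open>u\<close> in that set.\<close>

definition Linf_regular_at ::
    "real \<Rightarrow> 'a::euclidean_space set \<Rightarrow> ('a \<Rightarrow> real) \<Rightarrow> ('a \<Rightarrow> real \<Rightarrow> 'a \<Rightarrow> real) \<Rightarrow>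
      ('a \<Rightarrow> real) \<Rightarrow> bool" where
  "Linf_regular_at p \<Omega> \<phi> L u \<longleftrightarrow>
     (\<exists>v :: nat \<Rightarrow> 'a \<Rightarrow> real.
        (\<forall>k. v k \<in> admissible p \<Omega> \<phi> L \<inter> Linf \<Omega>) \<and>
        (\<lambda>k. W1p_norm p \<Omega> (\<lambda>x. v k x - u x)) \<longlonglongrightarrow> 0 \<and>
        (\<lambda>k. LINT x|lebesgue_on \<Omega>. \<bar>along \<Omega> L (v k) x - along \<Omega> L u x\<bar>) \<longlonglongrightarrow> 0)"

end

(*
  u is truncated to v = max (min u (s + b)) (-t + b') at high levels s, t, where b >= 0 and b' <= 0 are
  bounded Sobolev barriers along which Lbar is at most h(s) + q, resp. h(-t) + q. Under (2) the barriers
  are translates of the given function. Under (1) they are b = min_z max_j xi_j . (x - z) and b - delta,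
  with z in a fine finite net of Omega: this b is small and its gradient takes values in {xi_j}.
  The error made on {u > s + b} is at most h(s) |{u >= s}| plus the tail of an integrable function,
  and since h o u is integrable, h(s) |{u >= s}| is arbitrarily small for suitable large s.
  v keeps the boundary values because (w - c)^+ belongs to W_0^{1,p} whenever w does and c >= 0;
  this and the chain rule for max rest on mollification.
*)

theory Submission
  imports Defs
begin

section \<open>Test functions and convolution\<close>

text \<open>Cutting u at a constant level s would give gradient 0 on the cut region, and nothing
  bounds L(x, s, 0): only the slopes xi_j, or the gradient of the given function, are controlled. So
  the level itself has to carry such a gradient. The two barriers lie above s and below -t, so that
  u changes only inside {u > s} and {u < -t}. Along a barrier the available bound is h(s), not
  h(u(x)), and h is merely a Borel function, so that the two cannot be compared pointwise. This is
  why the level cannot be an arbitrary large number and has to be selected through the distribution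
  function of u. The boundedness of \<phi> enters when the levels are taken above its essential
  bound: then the barriers enclose \<phi>, and what is cut off is a positive part of the form (w -
  c)^+ with c >= 0. On {w = c} indicators of approximating sets need not converge. There the
  gradient of w - c vanishes almost everywhere, and this fact carries all the limits of gradients of
  positive parts.\<close>

lemma integrable_continuous_compact_support:
  fixes f :: "'a::euclidean_space \<Rightarrow> 'b::euclidean_space"
  assumes "continuous_on UNIV f" "compact K" "\<And>x. x \<notin> K \<Longrightarrow> f x = 0"
  shows "integrable lborel f" "integrable lebesgue f"
proof -
  have "(\<lambda>x. indicator K x *\<^sub>R f x) = f"
    using assms(3) by (auto simp: indicator_def)
  then show *: "integrable lborel f"
    using borel_integrable_compact[OF assms(2) continuous_on_subset[OF assms(1) subset_UNIV]] by simp
  then show "integrable lebesgue f"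
    by (subst integrable_completion) auto
qed

lemma continuous_measurable_lebesgue:
  fixes f :: "'a::euclidean_space \<Rightarrow> 'b::euclidean_space"
  assumes "continuous_on UNIV f"
  shows "f \<in> borel_measurable lebesgue"
  using borel_measurable_continuous_onI[OF assms] by (simp add: measurable_completion)

lemma bounded_continuous_compact_support:
  fixes f :: "'a::euclidean_space \<Rightarrow> 'b::euclidean_space"
  assumes "continuous_on UNIV f" "compact K" "\<And>x. x \<notin> K \<Longrightarrow> f x = 0"
  obtains B where "B > 0" "\<And>x. norm (f x) \<le> B"
proof -
  have "bounded (f ` K)"
    using assms by (meson compact_continuous_image compact_imp_bounded continuous_on_subset subset_UNIV)
  then obtain B where B: "B > 0" "\<And>x. x \<in> K \<Longrightarrow> norm (f x) \<le> B"
    by (auto simp: bounded_pos)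
  have "norm (f x) \<le> B" for x
    using B assms(3)[of x] by (cases "x \<in> K") auto
  with B(1) that show ?thesis by blast
qed

lemma GDERIV_continuous_on:
  assumes "\<And>x. GDERIV f x :> f' x"
  shows "continuous_on S f"
  using assms unfolding gderiv_def
  by (meson has_derivative_continuous continuous_at_imp_continuous_on)

lemma GDERIV_bound:
  assumes "\<And>x. GDERIV f x :> f' x" "\<And>x. norm (f' x) \<le> B"
  shows "\<bar>f x - f y\<bar> \<le> B * norm (x - y)"
proof -
  have "norm (f x - f y) \<le> B * norm (x - y)"
  proof (rule differentiable_bound[where S=UNIV])
    fix x show "(f has_derivative (\<lambda>h. h \<bullet> f' x)) (at x within UNIV)"
      using assms(1)[of x] by (simp add: gderiv_def)
    have "norm (h \<bullet> f' x) \<le> B * norm h" for h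
      using Cauchy_Schwarz_ineq2[of h "f' x"] mult_left_mono[OF assms(2)[of x], of "norm h"]
      by (simp add: mult.commute)
    then show "onorm (\<lambda>h. h \<bullet> f' x) \<le> B" using order_trans[OF norm_ge_zero assms(2)[of x]] by (intro onorm_bound)
  qed auto
  then show ?thesis by simp
qed

lemma GDERIV_unique: "GDERIV f x :> a \<Longrightarrow> GDERIV f x :> b \<Longrightarrow> a = b"
  unfolding gderiv_def using has_derivative_unique[of f] 
  by (metis (no_types) inner_commute vector_eq_ldot)

lemma GDERIV_zero_outside:
  assumes "\<And>x. GDERIV \<eta> x :> \<eta>' x" "closed K" "\<And>x. x \<notin> K \<Longrightarrow> \<eta> x = 0" "x \<notin> K"
  shows "\<eta>' x = 0"
proof (rule GDERIV_unique[OF assms(1)])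
  show "GDERIV \<eta> x :> 0"
    unfolding gderiv_def
  proof (rule has_derivative_transform_within_open)
    show "((\<lambda>x. 0) has_derivative (\<lambda>h. h \<bullet> 0)) (at x)" by simp
    show "open (- K)" using assms(2) by (simp only: open_Compl)
    show "x \<in> - K" using assms(4) by blast
    show "0 = \<eta> y" if "y \<in> - K" for y using assms(3)[of y] that by simp
  qed
qed

lemma C1c_D:
  assumes "C1c_with_gradient \<Omega> \<eta> \<eta>'"
  obtains K where "compact K" "K \<subseteq> \<Omega>" "\<And>x. x \<notin> K \<Longrightarrow> \<eta> x = 0" "\<And>x. x \<notin> K \<Longrightarrow> \<eta>' x = 0"
proof
  let ?K = "closure {x. \<eta> x \<noteq> 0}"
  show "compact ?K" "?K \<subseteq> \<Omega>" using assms by (auto simp: C1c_with_gradient_def)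
  show z: "\<eta> x = 0" if "x \<notin> ?K" for x
    using that closure_subset[of "{x. \<eta> x \<noteq> 0}"] by blast
  show "\<eta>' x = 0" if "x \<notin> ?K" for x
    by (rule GDERIV_zero_outside[OF _ closed_closure z that]) (use assms in \<open>auto simp: C1c_with_gradient_def\<close>)
qed

lemma C1cI:
  assumes "\<And>x. GDERIV \<eta> x :> \<eta>' x" "continuous_on UNIV \<eta>'" "compact K" "K \<subseteq> \<Omega>"
    "\<And>x. x \<notin> K \<Longrightarrow> \<eta> x = 0"
  shows "C1c_with_gradient \<Omega> \<eta> \<eta>'"
proof -
  have "closure {x. \<eta> x \<noteq> 0} \<subseteq> K"
    by (rule closure_minimal) (use assms in \<open>auto intro: compact_imp_closed\<close>)
  moreover from this have "compact (closure {x. \<eta> x \<noteq> 0})"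
    using bounded_subset[OF compact_imp_bounded[OF assms(3)]] by (simp add: compact_eq_bounded_closed)
  ultimately show ?thesis using assms unfolding C1c_with_gradient_def by blast
qed

lemma C1c_continuous:
  assumes "C1c_with_gradient \<Omega> \<eta> \<eta>'"
  shows "continuous_on UNIV \<eta>" "continuous_on UNIV \<eta>'"
  using assms GDERIV_continuous_on[of \<eta> \<eta>'] unfolding C1c_with_gradient_def by auto

lemma C1c_integrable:
  assumes "C1c_with_gradient \<Omega> \<eta> \<eta>'"
  shows "integrable lebesgue \<eta>" "integrable lebesgue \<eta>'"
    "integrable lborel \<eta>" "integrable lborel \<eta>'"
proof -
  obtain K where K: "compact K" "\<And>x. x \<notin> K \<Longrightarrow> \<eta> x = 0" "\<And>x. x \<notin> K \<Longrightarrow> \<eta>' x = 0"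
    using C1c_D[OF assms] by metis
  note c = C1c_continuous[OF assms]
  show "integrable lebesgue \<eta>" "integrable lebesgue \<eta>'" "integrable lborel \<eta>" "integrable lborel \<eta>'"
    using integrable_continuous_compact_support[OF c(1) K(1,2)]
      integrable_continuous_compact_support[OF c(2) K(1,3)] by auto
qed

lemma C1c_bounded:
  assumes "C1c_with_gradient \<Omega> \<eta> \<eta>'"
  obtains B where "B > 0" "\<And>x. \<bar>\<eta> x\<bar> \<le> B" "\<And>x. norm (\<eta>' x) \<le> B"
proof -
  obtain K where K: "compact K" "\<And>x. x \<notin> K \<Longrightarrow> \<eta> x = 0" "\<And>x. x \<notin> K \<Longrightarrow> \<eta>' x = 0"
    using C1c_D[OF assms] by metis
  obtain A where A: "A > 0" "\<And>x. norm (\<eta> x) \<le> A"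
    using bounded_continuous_compact_support[OF C1c_continuous(1)[OF assms] K(1,2)] by metis
  obtain B where B: "B > 0" "\<And>x. norm (\<eta>' x) \<le> B"
    using bounded_continuous_compact_support[OF C1c_continuous(2)[OF assms] K(1,3)] by metis
  show ?thesis
    by (rule that[of "max A B"]) (use A B in \<open>auto simp: le_max_iff_disj\<close>)
qed

section \<open>Translation invariance and convolution with a C^1 kernel\<close>

lemma integral_translation:
  fixes f :: "'a::euclidean_space \<Rightarrow> 'b::euclidean_space"
  assumes "f \<in> borel_measurable borel"
  shows "(LINT x|lborel. f (x + c)) = (LINT x|lborel. f x)"
proof -
  have "(LINT x|lborel. f x) = (LINT x|distr lborel borel ((+) c). f x)"
    by (simp add: lborel_distr_plus)
  also have "\<dots> = (LINT x|lborel. f (c + x))"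
    using assms by (subst integral_distr) auto
  finally show ?thesis by (simp add: add.commute)
qed

lemma uniformly_continuous_compact_support:
  fixes f :: "'a::euclidean_space \<Rightarrow> 'b::real_normed_vector"
  assumes "continuous_on UNIV f" "\<And>x. norm x > R \<Longrightarrow> f x = 0" "e > 0"
  obtains d where "d > 0" "\<And>x y. norm (x - y) < d \<Longrightarrow> norm (f x - f y) < e"
proof -
  have "uniformly_continuous_on (cball 0 (R + 1)) f"
    using assms(1) by (intro compact_uniformly_continuous continuous_on_subset[OF assms(1)]) auto
  then obtain d where d: "d > 0"
    "\<And>x y. x \<in> cball 0 (R+1) \<Longrightarrow> y \<in> cball 0 (R+1) \<Longrightarrow> dist y x < d \<Longrightarrow> dist (f y) (f x) < e"
    using assms(3) unfolding uniformly_continuous_on_def by blast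
  show ?thesis
  \<comment> \<open>Two points at distance below 1 either both lie in the ball of radius R + 1,
    where f is uniformly continuous, or both have norm above R, where f vanishes.\<close>
  proof (rule that[of "min d 1"])
    fix x y :: 'a assume xy: "norm (x - y) < min d 1"
    show "norm (f x - f y) < e"
    proof (cases "norm x \<le> R + 1 \<and> norm y \<le> R + 1")
      case True
      then show ?thesis using d(2)[of y x] xy by (simp add: dist_norm)
    next
      case False
      then have "norm x > R \<and> norm y > R"
        using xy norm_triangle_ineq2[of x y] norm_triangle_ineq3[of x y] by auto
      then show ?thesis using assms(2,3) by simp
    qed
  qed (use d in auto)
qed

text \<open>The kernel is scalar and f may be vector valued, so the same operator smooths a function
  and its weak gradient.\<close>

definition conv :: "('a::euclidean_space \<Rightarrow> real) \<Rightarrow> ('a \<Rightarrow> 'b::euclidean_space) \<Rightarrow> 'a \<Rightarrow> 'b" where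
  "conv \<rho> f x = (LINT y|lebesgue. \<rho> (x - y) *\<^sub>R f y)"

lemma lebesgue_measurable_reflect:
  assumes "f \<in> borel_measurable borel"
  shows "(\<lambda>y. f (x - y)) \<in> borel_measurable (lebesgue :: 'a::euclidean_space measure)"
proof -
  have "(\<lambda>y. f (x - y)) \<in> borel_measurable (lborel :: 'a measure)" using assms by measurable
  then show ?thesis by (rule measurable_completion)
qed

lemma conv_integrable:
  fixes f :: "'a::euclidean_space \<Rightarrow> 'b::euclidean_space"
  assumes "C1c_with_gradient UNIV \<rho> \<rho>'" "integrable lebesgue f"
  shows "integrable lebesgue (\<lambda>y. \<rho> (x - y) *\<^sub>R f y)"
proof -
  obtain B where B: "B > 0" "\<And>x. \<bar>\<rho> x\<bar> \<le> B" using C1c_bounded[OF assms(1)] by metis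
  note [measurable] = lebesgue_measurable_reflect[OF borel_measurable_continuous_onI[OF C1c_continuous(1)[OF assms(1)]]] borel_measurable_integrable[OF assms(2)]
  show ?thesis
    by (rule Bochner_Integration.integrable_bound[of _ "\<lambda>y. B *\<^sub>R f y"])
      (use assms(2) B in \<open>auto intro!: mult_right_mono\<close>)
qed

lemma conv_gradient_integrable:
  fixes f :: "'a::euclidean_space \<Rightarrow> real"
  assumes "C1c_with_gradient UNIV \<rho> \<rho>'" "integrable lebesgue f"
  shows "integrable lebesgue (\<lambda>y. f y *\<^sub>R \<rho>' (x - y))"
proof -
  obtain B where B: "B > 0" "\<And>x. norm (\<rho>' x) \<le> B" using C1c_bounded[OF assms(1)] by metis
  have le: "\<bar>f y\<bar> * norm (\<rho>' z) \<le> B * \<bar>f y\<bar>" for y z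
    using mult_left_mono[OF B(2)[of z] abs_ge_zero[of "f y"]] by (simp add: mult.commute)
  note [measurable] = lebesgue_measurable_reflect[OF borel_measurable_continuous_onI[OF C1c_continuous(2)[OF assms(1)]]] borel_measurable_integrable[OF assms(2)]
  show ?thesis
    by (rule Bochner_Integration.integrable_bound[of _ "\<lambda>y. B *\<^sub>R f y"])
      (use assms(2) le B(1) in \<open>auto simp: abs_mult\<close>)
qed

lemma integral_parameter_continuous:
  fixes F :: "'a::metric_space \<Rightarrow> 'c \<Rightarrow> 'b::euclidean_space"
  assumes "\<And>x. F x \<in> borel_measurable M" "integrable M w" "\<And>x y. norm (F x y) \<le> w y"
    "\<And>y. continuous_on UNIV (\<lambda>x. F x y)"
  shows "continuous_on UNIV (\<lambda>x. LINT y|M. F x y)"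
proof -
  have "isCont (\<lambda>x. LINT y|M. F x y) x" for x
    unfolding continuous_at_sequentially comp_def
  proof (intro allI impI integral_dominated_convergence[where w=w] AE_I2 assms)
    fix X y assume "X \<longlonglongrightarrow> x"
    then show "(\<lambda>n. F (X n) y) \<longlonglongrightarrow> F x y"
      by (rule isCont_tendsto_compose[rotated]) (use assms(4) in \<open>simp add: continuous_on_eq_continuous_at\<close>)
  qed
  then show ?thesis by (simp add: continuous_on_eq_continuous_at)
qed

lemma conv_continuous:
  assumes "C1c_with_gradient UNIV \<rho> \<rho>'" "integrable lebesgue f"
  shows "continuous_on UNIV (conv \<rho> f)"
proof -
  obtain B where B: "B > 0" "\<And>x. \<bar>\<rho> x\<bar> \<le> B" using C1c_bounded[OF assms(1)] by metis
  show ?thesis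
    unfolding conv_def
  proof (rule integral_parameter_continuous[where w="\<lambda>y. B * norm (f y)"])
    show "continuous_on UNIV (\<lambda>x. \<rho> (x - y) *\<^sub>R f y)" for y
      by (intro continuous_intros continuous_on_compose2[OF C1c_continuous(1)[OF assms(1)]]) auto
    show "norm (\<rho> (x - y) *\<^sub>R f y) \<le> B * norm (f y)" for x y
      using B(2)[of "x - y"] by (auto intro!: mult_right_mono)
  qed (use borel_measurable_integrable[OF conv_integrable[OF assms]] assms(2) in auto)
qed

lemma conv_gradient_continuous:
  fixes f :: "'a::euclidean_space \<Rightarrow> real"
  assumes "C1c_with_gradient UNIV \<rho> \<rho>'" "integrable lebesgue f"
  shows "continuous_on UNIV (\<lambda>x. LINT y|lebesgue. f y *\<^sub>R \<rho>' (x - y))"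
proof -
  obtain B where B: "B > 0" "\<And>x. norm (\<rho>' x) \<le> B" using C1c_bounded[OF assms(1)] by metis
  show ?thesis
  proof (rule integral_parameter_continuous[where w="\<lambda>y. \<bar>f y\<bar> * B"])
    show "continuous_on UNIV (\<lambda>x. f y *\<^sub>R \<rho>' (x - y))" for y
      by (intro continuous_intros continuous_on_compose2[OF C1c_continuous(2)[OF assms(1)]]) auto
    show "norm (f y *\<^sub>R \<rho>' (x - y)) \<le> \<bar>f y\<bar> * B" for x y
      using B(2)[of "x - y"] by (auto intro!: mult_left_mono)
  qed (use borel_measurable_integrable[OF conv_gradient_integrable[OF assms]] assms(2) in auto)
qed

text \<open>Uniform continuity of \<rho>' makes the first-order Taylor error of \<rho> at most c *
  norm (b - a) with the same c at every base point. Integrated against f this costs c times the L^1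
  norm A of f, hence c = e / (1 + A).\<close>

lemma conv_GDERIV:
  fixes f :: "'a::euclidean_space \<Rightarrow> real"
  assumes "C1c_with_gradient UNIV \<rho> \<rho>'" "integrable lebesgue f"
  shows "GDERIV (conv \<rho> f) x :> (LINT y|lebesgue. f y *\<^sub>R \<rho>' (x - y))"
  unfolding gderiv_def has_derivative_at_alt
proof (intro conjI allI impI)
  let ?G = "LINT y|lebesgue. f y *\<^sub>R \<rho>' (x - y)"
  show "bounded_linear (\<lambda>h. h \<bullet> ?G)" by (rule bounded_linear_inner_left)
  fix e :: real assume e: "e > 0"
  define A where "A = (LINT y|lebesgue. \<bar>f y\<bar>)"
  have A: "A \<ge> 0" by (simp add: A_def)
  define c where "c = e / (1 + A)"
  have c: "c > 0" using e A by (simp add: c_def)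
  obtain K where "compact K" and K: "\<And>x. x \<notin> K \<Longrightarrow> \<rho>' x = 0" using C1c_D[OF assms(1)] by metis
  then obtain R where "\<And>x. x \<in> K \<Longrightarrow> norm x \<le> R" using compact_imp_bounded bounded_iff by metis
  then have R: "R < norm x \<Longrightarrow> \<rho>' x = 0" for x using K[of x] by force
  obtain d where d: "d > 0" "\<And>x y. norm (x - y) < d \<Longrightarrow> norm (\<rho>' x - \<rho>' y) < c"
    using uniformly_continuous_compact_support[OF C1c_continuous(2)[OF assms(1)] R c] by metis
  \<comment> \<open>The mean value inequality for \<rho> minus its linearization at
    \<open>a\<close>: on the convex set \<open>ball a d\<close> the derivative of this difference
    has norm at most \<open>c\<close>.\<close>
  have lin: "\<bar>\<rho> b - \<rho> a - (b - a) \<bullet> \<rho>' a\<bar> \<le> c * norm (b - a)" if "norm (b - a) < d" for a b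
  proof -
    have "norm ((\<lambda>z. \<rho> z - z \<bullet> \<rho>' a) b - (\<lambda>z. \<rho> z - z \<bullet> \<rho>' a) a) \<le> c * norm (b - a)"
    proof (rule differentiable_bound[where S="ball a d" and f'="\<lambda>z h. h \<bullet> (\<rho>' z - \<rho>' a)"])
      fix z assume z: "z \<in> ball a d"
      have "(\<rho> has_derivative (\<lambda>h. h \<bullet> \<rho>' z)) (at z)"
        using assms(1) by (simp add: gderiv_def C1c_with_gradient_def)
      then have "((\<lambda>z. \<rho> z - z \<bullet> \<rho>' a) has_derivative (\<lambda>h. h \<bullet> (\<rho>' z - \<rho>' a))) (at z)"
        unfolding inner_diff_right
        by (intro has_derivative_diff bounded_linear_imp_has_derivative bounded_linear_inner_left)
      then show "((\<lambda>z. \<rho> z - z \<bullet> \<rho>' a) has_derivative (\<lambda>h. h \<bullet> (\<rho>' z - \<rho>' a))) (at z within ball a d)"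
        by (rule has_derivative_at_withinI)
      show "onorm (\<lambda>h. h \<bullet> (\<rho>' z - \<rho>' a)) \<le> c"
      proof (rule onorm_bound)
        fix h
        have "\<bar>h \<bullet> (\<rho>' z - \<rho>' a)\<bar> \<le> norm h * norm (\<rho>' z - \<rho>' a)" by (rule Cauchy_Schwarz_ineq2)
        also have "\<dots> \<le> norm h * c"
          using d(2)[of z a] z by (intro mult_left_mono) (auto simp: dist_norm norm_minus_commute)
        finally show "norm (h \<bullet> (\<rho>' z - \<rho>' a)) \<le> c * norm h" by (simp add: mult.commute)
      qed (use c in simp)
    qed (use that d in \<open>auto simp: dist_norm norm_minus_commute\<close>)
    then show ?thesis by (simp add: inner_diff_left algebra_simps)
  qed
  show "\<exists>d>0. \<forall>y. norm (y - x) < d \<longrightarrow> norm (conv \<rho> f y - conv \<rho> f x - (y - x) \<bullet> ?G) \<le> e * norm (y - x)"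
  proof (intro exI[of _ d] conjI allI impI)
    show "d > 0" by (fact d(1))
    fix z assume z: "norm (z - x) < d"
    note i = conv_integrable[OF assms] conv_gradient_integrable[OF assms]
    have eq: "conv \<rho> f z - conv \<rho> f x - (z - x) \<bullet> ?G =
       (LINT y|lebesgue. f y * (\<rho> (z - y) - \<rho> (x - y) - (z - x) \<bullet> \<rho>' (x - y)))"
    proof -
      have "conv \<rho> f z - conv \<rho> f x - (z - x) \<bullet> ?G = (LINT y|lebesgue. \<rho> (z - y) *\<^sub>R f y)
         - (LINT y|lebesgue. \<rho> (x - y) *\<^sub>R f y) - (LINT y|lebesgue. (z - x) \<bullet> (f y *\<^sub>R \<rho>' (x - y)))"
        by (simp only: conv_def integral_inner_right[where c="z - x", OF i(2)])
      also have "\<dots> = (LINT y|lebesgue. \<rho> (z - y) *\<^sub>R f y - \<rho> (x - y) *\<^sub>R f y - (z - x) \<bullet> (f y *\<^sub>R \<rho>' (x - y)))"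
        using i(1)[of z] i(1)[of x] integrable_inner_right[where c="z - x", OF i(2)[of x]] by simp
      also have "\<dots> = (LINT y|lebesgue. f y * (\<rho> (z - y) - \<rho> (x - y) - (z - x) \<bullet> \<rho>' (x - y)))"
        by (rule Bochner_Integration.integral_cong) (auto simp: algebra_simps)
      finally show ?thesis .
    qed
    have "norm (conv \<rho> f z - conv \<rho> f x - (z - x) \<bullet> ?G) \<le> (LINT y|lebesgue. \<bar>f y\<bar> * (c * norm (z - x)))"
      unfolding eq
    proof (rule Bochner_Integration.integral_norm_bound_integral)
      have "integrable lebesgue (\<lambda>y. \<rho> (z - y) *\<^sub>R f y - \<rho> (x - y) *\<^sub>R f y - (z - x) \<bullet> (f y *\<^sub>R \<rho>' (x - y)))"
        using i(1)[of z] i(1)[of x] integrable_inner_right[where c="z - x", OF i(2)[of x]] by simp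
      then show "integrable lebesgue (\<lambda>y. f y * (\<rho> (z - y) - \<rho> (x - y) - (z - x) \<bullet> \<rho>' (x - y)))"
        by (rule Bochner_Integration.integrable_cong[THEN iffD1, rotated -1]) (auto simp: algebra_simps)
      show "integrable lebesgue (\<lambda>y. \<bar>f y\<bar> * (c * norm (z - x)))"
        using assms(2) by simp
      fix y
      have "\<bar>\<rho> (z - y) - \<rho> (x - y) - (z - x) \<bullet> \<rho>' (x - y)\<bar> \<le> c * norm (z - x)"
        using lin[of "z - y" "x - y"] z by simp
      then show "norm (f y * (\<rho> (z - y) - \<rho> (x - y) - (z - x) \<bullet> \<rho>' (x - y))) \<le> \<bar>f y\<bar> * (c * norm (z - x))"
        by (simp add: abs_mult mult_left_mono)
    qed
    also have "\<dots> = A * c * norm (z - x)" by (simp add: A_def)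
    also have "\<dots> \<le> e * norm (z - x)"
    proof (intro mult_right_mono)
      have "A * c \<le> (1 + A) * c" using c by (simp add: algebra_simps)
      also have "\<dots> = e" using A by (simp add: c_def)
      finally show "A * c \<le> e" .
    qed simp
    finally show "norm (conv \<rho> f z - conv \<rho> f x - (z - x) \<bullet> ?G) \<le> e * norm (z - x)" .
  qed
qed

text \<open>Translation invariance replaces integration along coordinate lines. Convolving the
  reflected function \<theta> with the indicator of a large set K' gives, for x near 0, the integral
  of a translate of \<eta>, which is constant in x. Its gradient at 0 is therefore 0, and by
  \<open>conv_GDERIV\<close> that gradient is, up to sign, the integral of \<eta>'.\<close>

lemma C1c_integral_gradient:
  assumes "C1c_with_gradient \<Omega> \<eta> (\<eta>' :: 'a::euclidean_space \<Rightarrow> 'a)"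
  shows "(LINT x|lebesgue. \<eta>' x) = 0"
proof -
  obtain K where K: "compact K" "\<And>x. x \<notin> K \<Longrightarrow> \<eta> x = 0" "\<And>x. x \<notin> K \<Longrightarrow> \<eta>' x = 0"
    using C1c_D[OF assms] by metis
  have g: "GDERIV \<eta> x :> \<eta>' x" for x using assms by (simp add: C1c_with_gradient_def)
  define \<theta> where "\<theta> x = \<eta> (- x)" for x
  have \<theta>: "C1c_with_gradient UNIV \<theta> (\<lambda>x. - \<eta>' (- x))"
  proof (rule C1cI[of _ _ "uminus ` K"])
    show "GDERIV \<theta> x :> - \<eta>' (- x)" for x
      unfolding gderiv_def \<theta>_def
      using has_derivative_compose[OF has_derivative_minus[OF has_derivative_ident] g[of "- x", unfolded gderiv_def]]
      by simp
    show "continuous_on UNIV (\<lambda>x. - \<eta>' (- x))"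
      by (intro continuous_intros continuous_on_compose2[OF C1c_continuous(2)[OF assms]]) auto
    show "compact (uminus ` K)" by (rule compact_negations[OF K(1)])
    show "\<theta> x = 0" if "x \<notin> uminus ` K" for x
      using that K(2)[of "- x"] by (force simp: \<theta>_def)
  qed simp
  \<comment> \<open>The enlargement by the unit ball keeps every translate of K by a vector of norm
    below 1 inside K', so the indicator is invisible to the translated \<eta>.\<close>
  define K' where "K' = {x + y |x y. x \<in> K \<and> y \<in> cball 0 1}"
  have "compact K'" unfolding K'_def by (intro compact_sums K compact_cball)
  then have i: "integrable lebesgue (indicator K' :: 'a \<Rightarrow> real)"
    using lmeasurable_compact by (auto simp: integrable_indicator_iff fmeasurable_def)
  have K': "y \<in> K'" if "y - x \<in> K" "norm x < 1" for x y
    unfolding K'_def using that by (intro CollectI exI[of _ "y - x"] exI[of _ x]) auto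
  have [measurable]: "\<eta> \<in> borel_measurable borel"
    using C1c_continuous(1)[OF assms] by (rule borel_measurable_continuous_onI)
  have const: "conv \<theta> (indicator K') x = (LINT y|lborel. \<eta> y)" if "norm x < 1" for x
  proof -
    have "(\<lambda>y. \<theta> (x - y) *\<^sub>R indicator K' y) = (\<lambda>y. \<eta> (y + - x))"
      using K(2) K'[OF _ that] by (auto simp: fun_eq_iff \<theta>_def indicator_def)
    then have "conv \<theta> (indicator K') x = (LINT y|lborel. \<eta> (y + - x))"
      unfolding conv_def by (simp only:) (rule integral_completion, measurable)
    then show ?thesis by (simp only: integral_translation[OF \<open>\<eta> \<in> borel_measurable borel\<close>])
  qed
  have "GDERIV (conv \<theta> (indicator K')) 0 :> 0"
    unfolding gderiv_def
  proof (rule has_derivative_transform_within_open)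
    show "((\<lambda>x. LINT y|lborel. \<eta> y) has_derivative (\<lambda>h. h \<bullet> 0)) (at 0)" by simp
  qed (use const in \<open>auto intro: open_ball[of 0 1]\<close>)
  from GDERIV_unique[OF conv_GDERIV[OF \<theta> i] this]
  have "(LINT y|lebesgue. indicator K' y *\<^sub>R \<eta>' y) = 0" by simp
  moreover have "(\<lambda>y. indicator K' y *\<^sub>R \<eta>' y) = \<eta>'"
    using K(3) K'[of _ 0] by (auto simp: fun_eq_iff indicator_def)
  ultimately show ?thesis by simp
qed

section \<open>Mollification\<close>

text \<open>C^1 is the smoothness of the test functions, so no smoother kernel is asked for.
  Evenness makes the integral of \<open>\<rho> (x - y)\<close> equal to 1 in either
  variable.\<close>

definition mollifier:: "real \<Rightarrow> ('a::euclidean_space \<Rightarrow> real) \<Rightarrow> ('a \<Rightarrow> 'a) \<Rightarrow> bool" where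
  "mollifier \<epsilon> \<rho> \<rho>' \<longleftrightarrow> (\<forall>x. GDERIV \<rho> x :> \<rho>' x) \<and> continuous_on UNIV \<rho>' \<and>
     (\<forall>x. 0 \<le> \<rho> x) \<and> (\<forall>x. \<rho> (- x) = \<rho> x) \<and> (\<forall>x. \<epsilon> \<le> norm x \<longrightarrow> \<rho> x = 0) \<and>
     (LINT x|lborel. \<rho> x) = 1"

text \<open>The simplest C^1 function that vanishes on a half-line. It produces both the kernel in
  \<open>mollifier_exists\<close> and the smoothed positive part in \<open>sob_pos\<close>.\<close>

lemma DERIV_max_0_sq: "DERIV (\<lambda>t::real. (max 0 t)\<^sup>2) t :> 2 * max 0 t"
proof -
  consider "t > 0" | "t < 0" | "t = 0" by linarith
  then show ?thesis
  proof cases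
    case 1
    have "DERIV (\<lambda>t::real. t\<^sup>2) t :> 2 * max 0 t"
      using 1 by (auto intro!: derivative_eq_intros)
    then show ?thesis
      by (rule DERIV_cong_ev[OF refl _ refl, THEN iffD1, rotated])
        (use 1 eventually_nhds_in_open[of "{0<..}" t] in \<open>auto elim!: eventually_mono\<close>)
  next
    case 2
    have "DERIV (\<lambda>t::real. 0) t :> 2 * max 0 t"
      using 2 by (auto intro!: derivative_eq_intros)
    then show ?thesis
      by (rule DERIV_cong_ev[OF refl _ refl, THEN iffD1, rotated])
        (use 2 eventually_nhds_in_open[of "{..<0}" t] in \<open>auto elim!: eventually_mono\<close>)
  next
    case 3
    have "((\<lambda>h::real. (max 0 h)\<^sup>2 / h) \<longlongrightarrow> 0) (at 0)"
    proof (rule Lim_null_comparison)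
      have "norm ((max 0 h)\<^sup>2 / h) \<le> \<bar>h\<bar>" for h :: real
        by (auto simp: max_def power2_eq_square)
      then show "\<forall>\<^sub>F h::real in at 0. norm ((max 0 h)\<^sup>2 / h) \<le> \<bar>h\<bar>"
        by (intro always_eventually allI)
      show "((\<lambda>h::real. \<bar>h\<bar>) \<longlongrightarrow> 0) (at 0)"
        by (rule tendsto_eq_intros refl | simp)+
    qed
    then show ?thesis using 3 by (simp add: has_field_derivative_iff)
  qed
qed

lemma mollifier_exists:
  assumes "\<epsilon> > 0"
  obtains \<rho> and \<rho>' :: "'a::euclidean_space \<Rightarrow> 'a" where "mollifier \<epsilon> \<rho> \<rho>'"
proof -
  \<comment> \<open>The outer square makes the bump C^1 across the sphere of radius
    \<epsilon>.\<close>
  define k :: "'a \<Rightarrow> real" where "k x = (max 0 (\<epsilon>\<^sup>2 - x \<bullet> x))\<^sup>2" for x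
  define k' :: "'a \<Rightarrow> 'a" where "k' x = (2 * max 0 (\<epsilon>\<^sup>2 - x \<bullet> x)) *\<^sub>R (- 2 *\<^sub>R x)" for x
  have k: "GDERIV k x :> k' x" for x
    unfolding k_def k'_def
  proof (rule GDERIV_DERIV_compose[OF _ DERIV_max_0_sq])
    show "GDERIV (\<lambda>x. \<epsilon>\<^sup>2 - x \<bullet> x) x :> - 2 *\<^sub>R x"
      unfolding gderiv_def by (auto intro!: derivative_eq_intros simp: inner_commute)
  qed
  have k0: "k x = 0" if "\<epsilon> \<le> norm x" for x
    using that assms power_mono[of \<epsilon> "norm x" 2] by (simp add: k_def dot_square_norm)
  have ck: "continuous_on UNIV k" using k by (rule GDERIV_continuous_on)
  have ck': "continuous_on UNIV k'" unfolding k'_def by (intro continuous_intros)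
  have i: "integrable lborel k"
    by (rule integrable_continuous_compact_support[OF ck, of "cball 0 \<epsilon>"]) (use k0 in auto)
  have "(LINT x|lborel. k x) \<noteq> 0"
  proof
    assume "(LINT x|lborel. k x) = 0"
    then have "AE x in lborel. k x = 0"
      by (subst (asm) integral_nonneg_eq_0_iff_AE[OF i]) (auto simp: k_def)
    then have "AE x in lborel. x \<in> - ball (0::'a) \<epsilon>"
    proof (rule eventually_mono)
      fix x :: 'a assume 0: "k x = 0"
      have "\<not> norm x < \<epsilon>"
      proof
        assume "norm x < \<epsilon>"
        then have "(norm x)\<^sup>2 < \<epsilon>\<^sup>2" by (intro power_strict_mono) auto
        with 0 show False by (simp add: k_def dot_square_norm max_def split: if_splits)
      qed
      then show "x \<in> - ball 0 \<epsilon>" by simp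
    qed
    then have "AE x in lebesgue. x \<in> - ball (0::'a) \<epsilon>"
      by (simp add: AE_completion)
    \<comment> \<open>A closed set of full measure is the whole space, yet this one misses the
      centre of the ball.\<close>
    then have "(0::'a) \<in> - ball 0 \<epsilon>"
      by (intro mem_closed_if_AE_lebesgue) auto
    with assms show False by simp
  qed
  moreover have "(LINT x|lborel. k x) \<ge> 0" by (simp add: k_def)
  ultimately have I: "(LINT x|lborel. k x) > 0" by linarith
  define I where "I = (LINT x|lborel. k x)"
  have "mollifier \<epsilon> (\<lambda>x. k x / I) (\<lambda>x. (1 / I) *\<^sub>R k' x)"
    unfolding mollifier_def
  proof (intro conjI allI impI)
    show "GDERIV (\<lambda>x. k x / I) x :> (1 / I) *\<^sub>R k' x" for x
      using k[of x] I unfolding gderiv_def inner_scaleR_right I_def[symmetric]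
      by (auto intro!: derivative_eq_intros)
    show "continuous_on UNIV (\<lambda>x. (1 / I) *\<^sub>R k' x)" by (intro continuous_intros ck')
    show "0 \<le> k x / I" for x using I by (simp add: k_def I_def)
    show "k (- x) / I = k x / I" for x by (simp add: k_def)
    show "k x / I = 0" if "\<epsilon> \<le> norm x" for x using k0 that by simp
    show "(LINT x|lborel. k x / I) = 1" using I i by (simp add: I_def)
  qed
  then show ?thesis by (rule that)
qed

lemma mollifier_D:
  assumes "mollifier \<epsilon> \<rho> \<rho>'"
  shows "GDERIV \<rho> x :> \<rho>' x" "continuous_on UNIV \<rho>" "continuous_on UNIV \<rho>'" "0 \<le> \<rho> x" "\<rho> (- x) = \<rho> x"
    "\<epsilon> \<le> norm x \<Longrightarrow> \<rho> x = 0" "(LINT x|lborel. \<rho> x) = 1"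
    "\<rho> \<in> borel_measurable borel"
  using assms GDERIV_continuous_on[of \<rho> \<rho>'] unfolding mollifier_def
  by (auto intro: borel_measurable_continuous_onI)

lemma mollifier_C1c:
  assumes "mollifier \<epsilon> \<rho> \<rho>'" "cball x \<epsilon> \<subseteq> \<Omega>"
  shows "C1c_with_gradient \<Omega> (\<lambda>y. \<rho> (x - y)) (\<lambda>y. - \<rho>' (x - y))"
proof (rule C1cI[OF _ _ compact_cball assms(2)])
  fix y
  have "((\<lambda>y. \<rho> (x - y)) has_derivative (\<lambda>h. (- h) \<bullet> \<rho>' (x - y))) (at y)"
  proof (rule has_derivative_compose[where g=\<rho>])
    show "((\<lambda>y. x - y) has_derivative (\<lambda>h. - h)) (at y)"
      by (auto intro!: derivative_eq_intros)
    show "(\<rho> has_derivative (\<lambda>h. h \<bullet> \<rho>' (x - y))) (at (x - y))"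
      using mollifier_D(1)[OF assms(1)] by (simp add: gderiv_def)
  qed
  then show "GDERIV (\<lambda>y. \<rho> (x - y)) y :> - \<rho>' (x - y)" by (simp add: gderiv_def)
next
  show "continuous_on UNIV (\<lambda>y. - \<rho>' (x - y))"
    by (intro continuous_intros continuous_on_compose2[OF mollifier_D(3)[OF assms(1)]]) auto
  show "\<rho> (x - y) = 0" if "y \<notin> cball x \<epsilon>" for y
    using that mollifier_D(6)[OF assms(1), of "x - y"] by (auto simp: dist_norm)
qed

lemma mollifier_test:
  assumes "mollifier \<epsilon> \<rho> \<rho>'"
  shows "C1c_with_gradient UNIV \<rho> \<rho>'"
  by (rule C1cI[of _ _ "cball 0 \<epsilon>"]) (use mollifier_D[OF assms] in auto)

lemma mollifier_support_gradient:
  assumes "mollifier \<epsilon> \<rho> \<rho>'" "\<epsilon> < norm x"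
  shows "\<rho>' x = 0"
  by (rule GDERIV_zero_outside[of \<rho> \<rho>' "cball 0 \<epsilon>"]) (use mollifier_D[OF assms(1)] assms(2) in auto)

lemma mollifier_integral:
  assumes "mollifier \<epsilon> \<rho> \<rho>'"
  shows "integrable lborel (\<lambda>y. \<rho> (x - y))" "(LINT y|lborel. \<rho> (x - y)) = 1"
    "integrable lebesgue (\<lambda>y. \<rho> (x - y))" "(LINT y|lebesgue. \<rho> (x - y)) = 1"
    "(LINT y|lborel. \<rho> (y - x)) = 1" "integrable lborel (\<lambda>y. \<rho> (y - x))"
proof -
  note C = C1c_integrable[OF mollifier_C1c[OF assms subset_UNIV]]
  have [measurable]: "\<rho> \<in> borel_measurable borel" using mollifier_D[OF assms] by blast
  have s: "\<rho> (x - y) = \<rho> (y - x)" for y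
    using mollifier_D(5)[OF assms, of "x - y"] by simp
  show "integrable lborel (\<lambda>y. \<rho> (x - y))" "integrable lebesgue (\<lambda>y. \<rho> (x - y))"
    using C by auto
  then show "integrable lborel (\<lambda>y. \<rho> (y - x))" by (simp add: s)
  show 1: "(LINT y|lborel. \<rho> (y - x)) = 1"
    using integral_translation[of \<rho> "- x"] mollifier_D(7)[OF assms] by simp
  then show 2: "(LINT y|lborel. \<rho> (x - y)) = 1" by (simp add: s)
  then show "(LINT y|lebesgue. \<rho> (x - y)) = 1" by (subst integral_completion) auto
qed

section \<open>Inequalities for p-th powers, and Jensen's inequality for mollification\<close>

lemma norm_add_powr_le:
  fixes a b :: "'a::real_normed_vector"
  assumes "0 \<le> p"
  shows "norm (a + b) powr p \<le> 2 powr p * (norm a powr p + norm b powr p)"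
proof -
  have "norm (a + b) powr p \<le> (2 * max (norm a) (norm b)) powr p"
    using norm_triangle_ineq[of a b] by (intro powr_mono2 assms) auto
  also have "\<dots> = 2 powr p * max (norm a) (norm b) powr p"
    by (simp add: powr_mult)
  also have "\<dots> \<le> 2 powr p * (norm a powr p + norm b powr p)"
    by (intro mult_left_mono) (auto simp: max_def)
  finally show ?thesis .
qed

lemma le_one_plus_powr:
  fixes t :: real
  assumes "1 \<le> p" "0 \<le> t"
  shows "t \<le> 1 + t powr p"
proof (cases "t \<le> 1")
  case False
  then have "t powr 1 \<le> t powr p" using assms by (intro powr_mono) auto
  then show ?thesis using False by simp
qed (simp add: add_increasing2)

text \<open>The supporting line at m is the form in which convexity enters Jensen's inequality
  below. The point t = 0 is treated apart because convexity is applied on the open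
  half-line.\<close>

lemma powr_above_tangent:
  fixes m t p :: real
  assumes "1 \<le> p" "0 < m" "0 \<le> t"
  shows "m powr p + p * m powr (p - 1) * (t - m) \<le> t powr p"
proof (cases "t = 0")
  case True
  have "m powr (p - 1) * m = m powr p"
    using assms by (simp add: powr_diff)
  then have "m powr p + p * m powr (p - 1) * (t - m) = (1 - p) * m powr p"
    using True by (simp add: algebra_simps)
  also have "\<dots> \<le> 0" using assms by (intro mult_nonpos_nonneg) auto
  finally show ?thesis using True by simp
next
  case False
  have "t powr p - m powr p \<ge> (p * m powr (p - 1)) * (t - m)"
  proof (rule convex_on_imp_above_tangent[OF powr_convex[OF assms(1)]])
    show "((\<lambda>x. x powr p) has_field_derivative p * m powr (p - 1)) (at m within {0<..})"
      by (rule has_field_derivative_at_within, rule has_real_derivative_powr[OF assms(2)])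
  qed (use assms False in \<open>auto simp: interior_open\<close>)
  then show ?thesis by simp
qed

text \<open>Jensen's inequality for the probability density \<open>\<rho> (x - y)\<close>: the
  supporting line of the power function at the mean \<open>m\<close> of \<open>norm (r y)\<close> is
  integrated. If \<open>m\<close> is 0, the convolution itself is 0 at x.\<close>

lemma norm_conv_powr_le:
  fixes r :: "'a::euclidean_space \<Rightarrow> 'b::euclidean_space"
  assumes \<rho>: "mollifier \<epsilon> \<rho> \<rho>'" and p: "1 \<le> p"
    and r: "integrable lebesgue r" and rp: "integrable lebesgue (\<lambda>x. norm (r x) powr p)"
  shows "norm (conv \<rho> r x) powr p \<le> (LINT y|lebesgue. \<rho> (x - y) * norm (r y) powr p)"
proof -
  have i: "integrable lebesgue (\<lambda>y. \<rho> (x - y) * norm (r y))"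
    using conv_integrable[OF mollifier_test[OF \<rho>] integrable_norm[OF r]] by simp
  have ip: "integrable lebesgue (\<lambda>y. \<rho> (x - y) * norm (r y) powr p)"
    using conv_integrable[OF mollifier_test[OF \<rho>] rp] by simp
  define m where "m = (LINT y|lebesgue. \<rho> (x - y) * norm (r y))"
  have \<rho>0: "0 \<le> \<rho> z" for z using mollifier_D[OF \<rho>] by blast
  have "norm (conv \<rho> r x) \<le> (LINT y|lebesgue. norm (\<rho> (x - y) *\<^sub>R r y))"
    unfolding conv_def by (rule integral_norm_bound)
  also have "\<dots> = m" using \<rho>0 by (simp add: m_def)
  finally have 1: "norm (conv \<rho> r x) \<le> m" .
  show ?thesis
  proof (cases "m > 0")
    case True
    \<comment> \<open>The linear term integrates to 0, because the density has integral 1 and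
      \<open>m\<close> is the mean.\<close>
    have "m powr p = (LINT y|lebesgue. \<rho> (x - y) * (m powr p + p * m powr (p - 1) * (norm (r y) - m)))"
    proof -
      have "(LINT y|lebesgue. \<rho> (x - y) * (m powr p + p * m powr (p - 1) * (norm (r y) - m))) =
        (LINT y|lebesgue. (m powr p - p * m powr (p - 1) * m) * \<rho> (x - y) + (p * m powr (p - 1)) * (\<rho> (x - y) * norm (r y)))"
        by (rule Bochner_Integration.integral_cong) (auto simp: algebra_simps)
      also have "\<dots> = (m powr p - p * m powr (p - 1) * m) * 1 + (p * m powr (p - 1)) * m"
        using i mollifier_integral[OF \<rho>, of x] by (simp add: m_def)
      finally show ?thesis by simp
    qed
    also have "\<dots> \<le> (LINT y|lebesgue. \<rho> (x - y) * norm (r y) powr p)"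
    proof (rule integral_mono)
      have "integrable lebesgue (\<lambda>y. (m powr p - p * m powr (p - 1) * m) * \<rho> (x - y) + (p * m powr (p - 1)) * (\<rho> (x - y) * norm (r y)))"
        using i mollifier_integral[OF \<rho>, of x] by simp
      then show "integrable lebesgue (\<lambda>y. \<rho> (x - y) * (m powr p + p * m powr (p - 1) * (norm (r y) - m)))"
        by (rule Bochner_Integration.integrable_cong[THEN iffD1, rotated -1]) (auto simp: algebra_simps)
      show "\<rho> (x - y) * (m powr p + p * m powr (p - 1) * (norm (r y) - m)) \<le> \<rho> (x - y) * norm (r y) powr p" for y
        by (intro mult_left_mono powr_above_tangent p True \<rho>0) auto
    qed (rule ip)
    finally have "m powr p \<le> \<dots>" .
    moreover have "norm (conv \<rho> r x) powr p \<le> m powr p"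
      using 1 p by (intro powr_mono2) auto
    ultimately show ?thesis by linarith
  next
    case False
    with 1 have "norm (conv \<rho> r x) = 0" using norm_ge_zero[of "conv \<rho> r x"] by linarith
    then have "norm (conv \<rho> r x) powr p = 0" by simp
    moreover have "0 \<le> (LINT y|lebesgue. \<rho> (x - y) * norm (r y) powr p)"
      using \<rho>0 by (intro integral_nonneg_AE) auto
    ultimately show ?thesis by linarith
  qed
qed

text \<open>Jensen's inequality is integrated in x and the order of integration is exchanged; the
  kernel then integrates to 1 in x. So mollification does not increase the L^p norm.\<close>

lemma nn_integral_conv_powr_le:
  fixes r :: "'a::euclidean_space \<Rightarrow> 'b::euclidean_space"
  assumes \<rho>: "mollifier \<epsilon> \<rho> \<rho>'" and p: "1 \<le> p"
    and r: "integrable lebesgue r" and rp: "integrable lebesgue (\<lambda>x. norm (r x) powr p)"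
  shows "(\<integral>\<^sup>+x. ennreal (norm (conv \<rho> r x) powr p) \<partial>lebesgue) \<le> ennreal (LINT x|lebesgue. norm (r x) powr p)"
proof -
  have [measurable]: "\<rho> \<in> borel_measurable borel" and \<rho>0: "\<And>z. 0 \<le> \<rho> z"
    using mollifier_D[OF \<rho>] by blast+
  obtain s0 where s0: "s0 \<in> borel_measurable lborel" "AE x in lborel. norm (r x) powr p = s0 x"
    using completion_ex_borel_measurable_real[OF borel_measurable_integrable[OF rp]] by auto
  \<comment> \<open>A nonnegative Borel version of the Lebesgue measurable function |r|^p, so that
    Tonelli's theorem applies on the product of two copies of \<open>lborel\<close>.\<close>
  define s where "s x = max 0 (s0 x)" for x
  have [measurable]: "s \<in> borel_measurable borel" using s0(1) unfolding s_def by simp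
  have s: "AE x in lborel. norm (r x) powr p = s x" "\<And>x. s x \<ge> 0"
  proof -
    show "AE x in lborel. norm (r x) powr p = s x"
      using s0(2)
    proof (rule eventually_mono)
      fix x assume "norm (r x) powr p = s0 x"
      moreover from this have "0 \<le> s0 x" by (metis powr_ge_zero)
      ultimately show "norm (r x) powr p = s x" by (simp add: s_def)
    qed
  qed (simp add: s_def)
  have "(\<integral>\<^sup>+x. ennreal (norm (conv \<rho> r x) powr p) \<partial>lebesgue) = (\<integral>\<^sup>+x. ennreal (norm (conv \<rho> r x) powr p) \<partial>lborel)"
    by (rule nn_integral_completion)
  also have "\<dots> \<le> (\<integral>\<^sup>+x. (\<integral>\<^sup>+y. ennreal (\<rho> (x - y) * s y) \<partial>lborel) \<partial>lborel)"
  proof (rule nn_integral_mono)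
    fix x
    have ip: "integrable lebesgue (\<lambda>y. \<rho> (x - y) * norm (r y) powr p)"
      using conv_integrable[OF mollifier_test[OF \<rho>] rp] by simp
    have "ennreal (norm (conv \<rho> r x) powr p) \<le> ennreal (LINT y|lebesgue. \<rho> (x - y) * norm (r y) powr p)"
      by (intro ennreal_leI norm_conv_powr_le[OF assms])
    also have "\<dots> = (\<integral>\<^sup>+y. ennreal (\<rho> (x - y) * norm (r y) powr p) \<partial>lebesgue)"
      using \<rho>0 by (intro nn_integral_eq_integral[symmetric] ip) auto
    also have "\<dots> = (\<integral>\<^sup>+y. ennreal (\<rho> (x - y) * norm (r y) powr p) \<partial>lborel)"
      by (rule nn_integral_completion)
    also have "\<dots> = (\<integral>\<^sup>+y. ennreal (\<rho> (x - y) * s y) \<partial>lborel)"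
      using s(1) by (intro nn_integral_cong_AE) (auto elim!: eventually_mono)
    finally show "ennreal (norm (conv \<rho> r x) powr p) \<le> (\<integral>\<^sup>+y. ennreal (\<rho> (x - y) * s y) \<partial>lborel)" .
  qed
  also have "\<dots> = (\<integral>\<^sup>+y. (\<integral>\<^sup>+x. ennreal (\<rho> (x - y) * s y) \<partial>lborel) \<partial>lborel)"
    by (rule lborel_pair.Fubini') measurable
  also have "\<dots> = (\<integral>\<^sup>+y. ennreal (s y) \<partial>lborel)"
  proof (rule nn_integral_cong)
    fix y
    have "(\<integral>\<^sup>+x. ennreal (\<rho> (x - y) * s y) \<partial>lborel) = (\<integral>\<^sup>+x. ennreal (s y) * ennreal (\<rho> (x - y)) \<partial>lborel)"
      by (simp add: ennreal_mult'[symmetric] s(2) \<rho>0 mult.commute)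
    also have "\<dots> = ennreal (s y) * (\<integral>\<^sup>+x. ennreal (\<rho> (x - y)) \<partial>lborel)"
      by (rule nn_integral_cmult) measurable
    also have "(\<integral>\<^sup>+x. ennreal (\<rho> (x - y)) \<partial>lborel) = ennreal (LINT x|lborel. \<rho> (x - y))"
      using \<rho>0 by (intro nn_integral_eq_integral mollifier_integral(6)[OF \<rho>]) auto
    finally show "(\<integral>\<^sup>+x. ennreal (\<rho> (x - y) * s y) \<partial>lborel) = ennreal (s y)"
      by (simp add: mollifier_integral(5)[OF \<rho>])
  qed
  also have "\<dots> = (\<integral>\<^sup>+y. ennreal (norm (r y) powr p) \<partial>lborel)"
    using s(1) by (intro nn_integral_cong_AE) (auto elim!: eventually_mono)
  also have "\<dots> = (\<integral>\<^sup>+y. ennreal (norm (r y) powr p) \<partial>lebesgue)"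
    by (rule nn_integral_completion[symmetric])
  also have "\<dots> = ennreal (LINT x|lebesgue. norm (r x) powr p)"
    by (intro nn_integral_eq_integral rp) auto
  finally show ?thesis .
qed

section \<open>Approximation in L^p by continuous functions and by mollification\<close>

lemma conv_support:
  assumes "mollifier \<epsilon> \<rho> \<rho>'" "\<And>x. R < norm x \<Longrightarrow> f x = 0" "R + \<epsilon> < norm x"
  shows "conv \<rho> f x = 0"
proof -
  have "\<rho> (x - y) *\<^sub>R f y = 0" for y
  proof (cases "R < norm y")
    case False
    then have "\<epsilon> \<le> norm (x - y)" using assms(3) norm_triangle_ineq2[of x y] by linarith
    then show ?thesis using mollifier_D(6)[OF assms(1)] by simp
  qed (simp add: assms(2))
  then have "(\<lambda>y. \<rho> (x - y) *\<^sub>R f y) = (\<lambda>_. 0)" by (simp add: fun_eq_iff)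
  then show ?thesis by (simp add: conv_def)
qed

lemma integrable_bounded_support:
  fixes f :: "'a::euclidean_space \<Rightarrow> 'b::euclidean_space"
  assumes "1 \<le> p" "f \<in> borel_measurable lebesgue" "\<And>x. R < norm x \<Longrightarrow> f x = 0"
    "integrable lebesgue (\<lambda>x. norm (f x) powr p)"
  shows "integrable lebesgue f"
proof (rule Bochner_Integration.integrable_bound)
  show "integrable lebesgue (\<lambda>x. indicator (cball 0 R) x + norm (f x) powr p)"
    using assms(4) lmeasurable_cball[of 0 R]
    by (intro Bochner_Integration.integrable_add) (auto simp: integrable_indicator_iff fmeasurable_def)
  show "AE x in lebesgue. norm (f x) \<le> norm (indicator (cball 0 R) x + norm (f x) powr p)"
  proof (intro AE_I2)
    fix x
    show "norm (f x) \<le> norm (indicator (cball 0 R) x + norm (f x) powr p)"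
      using le_one_plus_powr[OF assms(1), of "norm (f x)"] assms(3)[of x]
      by (cases "x \<in> cball 0 R") auto
  qed
qed (fact assms(2))

lemma integrable_powr_continuous:
  fixes f :: "'a::euclidean_space \<Rightarrow> 'b::euclidean_space"
  assumes "0 < p" "continuous_on UNIV f" "\<And>x. R < norm x \<Longrightarrow> f x = 0"
  shows "integrable lebesgue (\<lambda>x. norm (f x) powr p)"
proof (rule integrable_continuous_compact_support(2)[of _ "cball 0 R"])
  show "continuous_on UNIV (\<lambda>x. norm (f x) powr p)"
    using assms by (intro continuous_on_powr' continuous_intros) auto
qed (use assms in auto)

lemma integrable_powr_add:
  fixes f g :: "'a \<Rightarrow> 'b::euclidean_space"
  assumes "0 \<le> p" "f \<in> borel_measurable M" "g \<in> borel_measurable M"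
    "integrable M (\<lambda>x. norm (f x) powr p)" "integrable M (\<lambda>x. norm (g x) powr p)"
  shows "integrable M (\<lambda>x. norm (f x + g x) powr p)"
    "(LINT x|M. norm (f x + g x) powr p) \<le> 2 powr p * ((LINT x|M. norm (f x) powr p) + (LINT x|M. norm (g x) powr p))"
proof -
  note [measurable] = assms(2,3)
  have i: "integrable M (\<lambda>x. 2 powr p * (norm (f x) powr p + norm (g x) powr p))"
    using assms(4,5) by simp
  show 1: "integrable M (\<lambda>x. norm (f x + g x) powr p)"
    by (rule Bochner_Integration.integrable_bound[OF i]) (use norm_add_powr_le[OF assms(1)] in auto)
  have "(LINT x|M. norm (f x + g x) powr p) \<le> (LINT x|M. 2 powr p * (norm (f x) powr p + norm (g x) powr p))"
    by (intro integral_mono 1 i norm_add_powr_le assms(1))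
  also have "\<dots> = 2 powr p * ((LINT x|M. norm (f x) powr p) + (LINT x|M. norm (g x) powr p))"
    using assms(4,5) by simp
  finally show "(LINT x|M. norm (f x + g x) powr p) \<le> 2 powr p * ((LINT x|M. norm (f x) powr p) + (LINT x|M. norm (g x) powr p))" .
qed

lemma integrable_powr_diff:
  fixes f g :: "'a \<Rightarrow> 'b::euclidean_space"
  assumes "0 \<le> p" "f \<in> borel_measurable M" "g \<in> borel_measurable M"
    "integrable M (\<lambda>x. norm (f x) powr p)" "integrable M (\<lambda>x. norm (g x) powr p)"
  shows "integrable M (\<lambda>x. norm (f x - g x) powr p)"
    "(LINT x|M. norm (f x - g x) powr p) \<le> 2 powr p * ((LINT x|M. norm (f x) powr p) + (LINT x|M. norm (g x) powr p))"
  using integrable_powr_add[OF assms(1,2), of "\<lambda>x. - g x"] assms by auto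

text \<open>A Lebesgue measurable function is a limit almost everywhere of continuous functions.
  Projecting these to the ball of radius M and cutting them off outside the support makes them
  dominated, and dominated convergence turns the pointwise limit into a limit in L^p.\<close>

lemma approx_continuous_bounded:
  fixes f :: "'a::euclidean_space \<Rightarrow> 'b::euclidean_space"
  assumes p: "1 \<le> p" and f: "f \<in> borel_measurable lebesgue" "\<And>x. R < norm x \<Longrightarrow> f x = 0" "\<And>x. norm (f x) \<le> M"
    and e: "e > 0"
  obtains g where "continuous_on UNIV g" "\<And>x. R + 1 < norm x \<Longrightarrow> g x = 0"
    "(LINT x|lebesgue. norm (f x - g x) powr p) < e"
proof -
  note [measurable] = f(1)
  have M: "M \<ge> 0" using f(3)[of 0] norm_ge_zero order_trans by blast
  have "f measurable_on UNIV" using f(1) by (simp add: lebesgue_measurable_imp_measurable_on)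
  then obtain N g where N: "negligible N" and g: "\<And>n. continuous_on UNIV (g n)"
    "\<And>x. x \<notin> N \<Longrightarrow> (\<lambda>n. g n x) \<longlonglongrightarrow> f x"
    unfolding measurable_on_def by auto
  \<comment> \<open>The cutoff factor is 1 for norm x <= R and 0 for norm x >= R + 1. Like the
    projection, it leaves f unchanged, so G n still converges to f.\<close>
  define G where "G n x = max 0 (min 1 (R + 1 - norm x)) *\<^sub>R closest_point (cball 0 M) (g n x)" for n x
  have cont: "continuous_on UNIV (closest_point (cball (0::'b) M))"
    using M by (intro continuous_on_closest_point) auto
  have Gc: "continuous_on UNIV (G n)" for n
    unfolding G_def by (intro continuous_intros continuous_on_compose2[OF cont g(1)]) auto
  have G0: "G n x = 0" if "R + 1 < norm x" for n x using that by (simp add: G_def)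
  have Gm[measurable]: "G n \<in> borel_measurable lebesgue" for n
    by (rule continuous_measurable_lebesgue[OF Gc])
  have GM: "norm (G n x) \<le> M" for n x
  proof -
    have "closest_point (cball 0 M) (g n x) \<in> cball 0 M"
      using M by (intro closest_point_in_set) auto
    then have "norm (closest_point (cball 0 M) (g n x)) \<le> M" by simp
    then have "\<bar>max 0 (min 1 (R + 1 - norm x))\<bar> * norm (closest_point (cball 0 M) (g n x)) \<le> 1 * M"
      by (intro mult_mono) auto
    then show ?thesis by (simp add: G_def)
  qed
  have "(\<lambda>n. LINT x|lebesgue. norm (f x - G n x) powr p) \<longlonglongrightarrow> (LINT x|(lebesgue :: 'a measure). (0::real))"
  proof (rule integral_dominated_convergence[where w="\<lambda>x. (2 * M) powr p * indicator (cball 0 (R + 1)) x"])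
    show "integrable lebesgue (\<lambda>x. (2 * M) powr p * indicator (cball 0 (R + 1)) (x::'a))"
      using lmeasurable_cball[of "0::'a" "R + 1"]
      by (intro integrable_mult_right) (auto simp: integrable_indicator_iff fmeasurable_def)
    have "AE x in lebesgue. x \<notin> N"
      using N AE_not_in by (auto simp: negligible_iff_null_sets)
    then show "AE x in lebesgue. (\<lambda>n. norm (f x - G n x) powr p) \<longlonglongrightarrow> 0"
    proof (rule eventually_mono)
      fix x assume x: "x \<notin> N"
      have "(\<lambda>n. G n x) \<longlonglongrightarrow> max 0 (min 1 (R + 1 - norm x)) *\<^sub>R closest_point (cball 0 M) (f x)"
        unfolding G_def
        by (intro tendsto_intros isCont_tendsto_compose[OF _ g(2)[OF x]])
          (use cont in \<open>simp add: continuous_on_eq_continuous_at\<close>)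
      also have "closest_point (cball 0 M) (f x) = f x"
        using f(3) by (intro closest_point_self) simp
      also have "max 0 (min 1 (R + 1 - norm x)) *\<^sub>R f x = f x"
        using f(2)[of x] by (cases "R < norm x") auto
      finally have "(\<lambda>n. norm (f x - G n x)) \<longlonglongrightarrow> 0"
        using tendsto_norm[OF tendsto_diff[OF tendsto_const[of "f x"]]] by fastforce
      then show "(\<lambda>n. norm (f x - G n x) powr p) \<longlonglongrightarrow> 0"
        using p by (intro tendsto_zero_powrI[where b=p]) auto
    qed
    show "AE x in lebesgue. norm (norm (f x - G n x) powr p) \<le> (2 * M) powr p * indicator (cball 0 (R + 1)) x" for n
    proof (rule AE_I2)
      fix x
      have "norm (f x - G n x) \<le> 2 * M"
        using norm_triangle_ineq4[of "f x" "G n x"] f(3)[of x] GM[of n x] by linarith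
      then have "norm (f x - G n x) powr p \<le> (2 * M) powr p"
        using p by (intro powr_mono2) auto
      then show "norm (norm (f x - G n x) powr p) \<le> (2 * M) powr p * indicator (cball 0 (R + 1)) x"
        using f(2)[of x] G0[of x n] by (cases "x \<in> cball 0 (R + 1)") auto
    qed
  qed simp_all
  then have "\<forall>\<^sub>F n in sequentially. (LINT x|lebesgue. norm (f x - G n x) powr p) < e"
    using e by (intro order_tendstoD(2)) auto
  then obtain n where "(LINT x|lebesgue. norm (f x - G n x) powr p) < e"
    by (auto simp: eventually_sequentially)
  then show ?thesis using that Gc G0 by blast
qed

text \<open>Values of norm above n are replaced by 0, which reduces the claim to bounded f. The
  discarded part tends to 0 in L^p by dominated convergence.\<close>

lemma approx_continuous:
  fixes f :: "'a::euclidean_space \<Rightarrow> 'b::euclidean_space"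
  assumes p: "1 \<le> p" and f: "f \<in> borel_measurable lebesgue" "\<And>x. R < norm x \<Longrightarrow> f x = 0"
    and fp: "integrable lebesgue (\<lambda>x. norm (f x) powr p)" and e: "e > 0"
  obtains g where "continuous_on UNIV g" "\<And>x. R + 1 < norm x \<Longrightarrow> g x = 0"
    "(LINT x|lebesgue. norm (f x - g x) powr p) < e"
proof -
  note [measurable] = f(1)
  define F where "F n x = (if norm (f x) \<le> real n then f x else 0)" for n x
  have Fm[measurable]: "F n \<in> borel_measurable lebesgue" for n
    unfolding F_def by measurable
  have "(\<lambda>n. LINT x|lebesgue. norm (f x - F n x) powr p) \<longlonglongrightarrow> (LINT x|(lebesgue :: 'a measure). (0::real))"
  proof (rule integral_dominated_convergence[where w="\<lambda>x. norm (f x) powr p"])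
    show "AE x in lebesgue. (\<lambda>n. norm (f x - F n x) powr p) \<longlonglongrightarrow> 0"
    proof (intro AE_I2 tendsto_eventually)
      fix x
      obtain m :: nat where "norm (f x) \<le> real m" using real_arch_simple by blast
      then show "\<forall>\<^sub>F n in sequentially. norm (f x - F n x) powr p = 0"
        by (intro eventually_sequentiallyI[of m]) (auto simp: F_def)
    qed
    show "AE x in lebesgue. norm (norm (f x - F n x) powr p) \<le> norm (f x) powr p" for n
      by (intro AE_I2) (auto simp: F_def)
  qed (use fp in simp_all)
  \<comment> \<open>The factor 2^p of \<open>integrable_powr_add\<close> is paid in advance: each of
    the two errors then contributes less than e / 2.\<close>
  then have "\<forall>\<^sub>F n in sequentially. (LINT x|lebesgue. norm (f x - F n x) powr p) < e / (2 * 2 powr p)"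
    using e by (intro order_tendstoD(2)) auto
  then obtain n where n: "(LINT x|lebesgue. norm (f x - F n x) powr p) < e / (2 * 2 powr p)"
    by (auto simp: eventually_sequentially)
  obtain g where g: "continuous_on UNIV g" "\<And>x. R + 1 < norm x \<Longrightarrow> g x = 0"
    "(LINT x|lebesgue. norm (F n x - g x) powr p) < e / (2 * 2 powr p)"
  proof (rule approx_continuous_bounded[OF p Fm, of R n "real n" "e / (2 * 2 powr p)"])
    show "F n x = 0" if "R < norm x" for x using f(2)[OF that] by (simp add: F_def)
    show "norm (F n x) \<le> real n" for x by (simp add: F_def)
  qed (use e in auto)
  have [measurable]: "g \<in> borel_measurable lebesgue"
    by (rule continuous_measurable_lebesgue[OF g(1)])
  have p0: "0 \<le> p" "0 < p" using p by auto
  have iF: "integrable lebesgue (\<lambda>x. norm (F n x) powr p)"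
    by (rule Bochner_Integration.integrable_bound[OF fp]) (auto simp: F_def)
  have ig: "integrable lebesgue (\<lambda>x. norm (g x) powr p)"
    by (rule integrable_powr_continuous[OF p0(2) g(1,2)])
  have "(LINT x|lebesgue. norm (f x - g x) powr p) = (LINT x|lebesgue. norm ((f x - F n x) + (F n x - g x)) powr p)"
    by simp
  also have "\<dots> \<le> 2 powr p * ((LINT x|lebesgue. norm (f x - F n x) powr p) + (LINT x|lebesgue. norm (F n x - g x) powr p))"
    by (intro integrable_powr_add integrable_powr_diff p0 fp iF ig) measurable
  also have "\<dots> < 2 powr p * (e / (2 * 2 powr p) + e / (2 * 2 powr p))"
    using n g(3) by (intro mult_strict_left_mono add_strict_mono) auto
  also have "\<dots> = e" by simp
  finally show ?thesis using that g(1,2) by blast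
qed

lemma conv_minus_continuous_le:
  fixes g :: "'a::euclidean_space \<Rightarrow> 'b::euclidean_space"
  assumes \<rho>: "mollifier \<epsilon> \<rho> \<rho>'" and g: "integrable lebesgue g"
    and c: "\<And>y. norm (x - y) < \<epsilon> \<Longrightarrow> norm (g y - g x) \<le> c"
  shows "norm (conv \<rho> g x - g x) \<le> c"
proof -
  have \<rho>0: "0 \<le> \<rho> z" for z using mollifier_D[OF \<rho>] by blast
  note i = conv_integrable[OF mollifier_test[OF \<rho>] g] mollifier_integral[OF \<rho>]
  have i1: "integrable lebesgue (\<lambda>y. \<rho> (x - y) *\<^sub>R g x)" using i(4)[of x] by simp
  have "conv \<rho> g x - g x = (LINT y|lebesgue. \<rho> (x - y) *\<^sub>R g y) - (LINT y|lebesgue. \<rho> (x - y) *\<^sub>R g x)"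
    using i(4,5)[of x] by (simp add: conv_def)
  also have "\<dots> = (LINT y|lebesgue. \<rho> (x - y) *\<^sub>R g y - \<rho> (x - y) *\<^sub>R g x)"
    by (rule Bochner_Integration.integral_diff[OF i(1) i1, symmetric])
  finally have "norm (conv \<rho> g x - g x) = norm (LINT y|lebesgue. \<rho> (x - y) *\<^sub>R g y - \<rho> (x - y) *\<^sub>R g x)"
    by simp
  also have "\<dots> \<le> (LINT y|lebesgue. \<rho> (x - y) * c)"
  proof (rule Bochner_Integration.integral_norm_bound_integral)
    show "integrable lebesgue (\<lambda>y. \<rho> (x - y) *\<^sub>R g y - \<rho> (x - y) *\<^sub>R g x)"
      by (rule Bochner_Integration.integrable_diff[OF i(1) i1])
    show "integrable lebesgue (\<lambda>y. \<rho> (x - y) * c)" using i(4)[of x] by simp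
    fix y
    show "norm (\<rho> (x - y) *\<^sub>R g y - \<rho> (x - y) *\<^sub>R g x) \<le> \<rho> (x - y) * c"
    proof (cases "norm (x - y) < \<epsilon>")
      case True
      have "norm (\<rho> (x - y) *\<^sub>R g y - \<rho> (x - y) *\<^sub>R g x) = \<rho> (x - y) * norm (g y - g x)"
        using \<rho>0[of "x - y"] by (simp add: scaleR_diff_right[symmetric])
      then show ?thesis using c[OF True] \<rho>0[of "x - y"] by (simp add: mult_left_mono)
    next
      case False
      then show ?thesis using mollifier_D(6)[OF \<rho>, of "x - y"] by simp
    qed
  qed
  also have "\<dots> = c" using i(4,5)[of x] by simp
  finally show ?thesis .
qed

text \<open>Split f = g + r with g continuous of bounded support and r small in L^p. On g the
  mollification converges uniformly; on r it stays small for every n by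
  \<open>nn_integral_conv_powr_le\<close>.\<close>

lemma mollify_Lp_tendsto:
  fixes f :: "'a::euclidean_space \<Rightarrow> 'b::euclidean_space"
  assumes p: "1 \<le> p" and f: "f \<in> borel_measurable lebesgue" "\<And>x. R < norm x \<Longrightarrow> f x = 0"
    and fp: "integrable lebesgue (\<lambda>x. norm (f x) powr p)"
    and \<rho>: "\<And>n. mollifier (\<epsilon> n) (\<rho> n) (\<rho>' n)" and \<epsilon>: "\<epsilon> \<longlonglongrightarrow> 0"
  shows "(\<lambda>n. LINT x|lebesgue. norm (conv (\<rho> n) f x - f x) powr p) \<longlonglongrightarrow> 0"
proof (rule LIMSEQ_I)
  fix e :: real assume e: "e > 0"
  note [measurable] = f(1)
  have p0: "0 \<le> p" "0 < p" using p by auto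
  \<comment> \<open>The remainder passes through the factor 2^p twice and counts twice, as
    \<open>r\<close> and as its mollification: in total at most e / 2.\<close>
  define e1 where "e1 = e / (4 * (2 powr p * 2 powr p))"
  have e1: "e1 > 0" using e by (simp add: e1_def)
  obtain g where g: "continuous_on UNIV g" "\<And>x. R + 1 < norm x \<Longrightarrow> g x = 0"
    "(LINT x|lebesgue. norm (f x - g x) powr p) < e1"
    using approx_continuous[OF p f fp e1] by metis
  have gm[measurable]: "g \<in> borel_measurable lebesgue"
    by (rule continuous_measurable_lebesgue[OF g(1)])
  have gp: "integrable lebesgue (\<lambda>x. norm (g x) powr p)"
    by (rule integrable_powr_continuous[OF p0(2) g(1,2)])
  have gi: "integrable lebesgue g" by (rule integrable_bounded_support[OF p gm g(2) gp])
  define r where "r x = f x - g x" for x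
  have rm[measurable]: "r \<in> borel_measurable lebesgue" unfolding r_def by measurable
  have r0: "r x = 0" if "R + 1 < norm x" for x using that f(2)[of x] g(2)[of x] by (simp add: r_def)
  have rp: "integrable lebesgue (\<lambda>x. norm (r x) powr p)"
    unfolding r_def by (intro integrable_powr_diff p0 fp gp) measurable
  have ri: "integrable lebesgue r" by (rule integrable_bounded_support[OF p rm r0 rp])
  \<comment> \<open>g vanishes beyond R + 1 and only kernels of radius below 1 will be used, so the
    mollified g vanishes beyond R + 2.\<close>
  define V where "V = measure lebesgue (cball (0::'a) (R + 2))"
  have V: "V \<ge> 0" by (simp add: V_def)
  \<comment> \<open>A uniform error \<open>c\<close> on a ball of volume V costs 2^p * c^p * V,
    which this choice keeps at most e / 4; V + 1 makes the denominator positive.\<close>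
  define c where "c = (e / (4 * 2 powr p * (V + 1))) powr (1 / p)"
  have c: "c > 0" using e V by (simp add: c_def)
  have cp: "c powr p = e / (4 * 2 powr p * (V + 1))"
    using e V p by (simp add: c_def powr_powr)
  obtain d where d: "d > 0" "\<And>x y. norm (x - y) < d \<Longrightarrow> norm (g x - g y) < c"
    using uniformly_continuous_compact_support[OF g(1,2) c] by metis
  have "\<forall>\<^sub>F n in sequentially. \<epsilon> n < min d 1"
    using d(1) by (intro order_tendstoD(2)[OF \<epsilon>]) auto
  then obtain n0 where n0: "\<And>n. n \<ge> n0 \<Longrightarrow> \<epsilon> n < min d 1"
    by (auto simp: eventually_sequentially)
  show "\<exists>n0. \<forall>n\<ge>n0. norm ((LINT x|lebesgue. norm (conv (\<rho> n) f x - f x) powr p) - 0) < e"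
  proof (intro exI[of _ n0] allI impI)
    fix n assume "n \<ge> n0"
    then have en: "\<epsilon> n < d" "\<epsilon> n < 1" using n0 by auto
    let ?cg = "conv (\<rho> n) g" and ?cr = "conv (\<rho> n) r"
    have cgc: "continuous_on UNIV ?cg" and crc: "continuous_on UNIV ?cr"
      using conv_continuous[OF mollifier_test[OF \<rho>]] gi ri by blast+
    have [measurable]: "?cg \<in> borel_measurable lebesgue" "?cr \<in> borel_measurable lebesgue"
      by (rule continuous_measurable_lebesgue, rule cgc crc)+
    have s: "?cg x = 0" "?cr x = 0" if "R + 2 < norm x" for x
      by (rule conv_support[OF \<rho>[of n], of "R + 1"]; use g(2) r0 en that in auto)+
    have icr: "integrable lebesgue (\<lambda>x. norm (?cr x) powr p)"
      by (rule integrable_powr_continuous[OF p0(2) crc s(2)])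
    have icg: "integrable lebesgue (\<lambda>x. norm (?cg x) powr p)"
      by (rule integrable_powr_continuous[OF p0(2) cgc s(1)])
    have icg': "integrable lebesgue (\<lambda>x. norm (?cg x - g x) powr p)"
      by (intro integrable_powr_diff p0 gp icg) measurable
    have ind: "integrable lebesgue (\<lambda>x. c powr p * indicator (cball 0 (R + 2)) (x::'a))"
      using lmeasurable_cball[of "0::'a" "R + 2"]
      by (intro integrable_mult_right) (auto simp: integrable_indicator_iff fmeasurable_def)
    have eq: "conv (\<rho> n) f x - f x = (?cg x - g x) + (?cr x - r x)" for x
    proof -
      have "conv (\<rho> n) f x = (LINT y|lebesgue. \<rho> n (x - y) *\<^sub>R g y + \<rho> n (x - y) *\<^sub>R r y)"
        unfolding conv_def r_def
        by (rule Bochner_Integration.integral_cong) (auto simp: scaleR_diff_right)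
      also have "\<dots> = ?cg x + ?cr x"
        unfolding conv_def by (intro Bochner_Integration.integral_add conv_integrable[OF mollifier_test[OF \<rho>]] gi ri)
      finally show ?thesis by (simp add: r_def)
    qed
    have 1: "(LINT x|lebesgue. norm (?cr x) powr p) \<le> (LINT x|lebesgue. norm (r x) powr p)"
    proof -
      have "ennreal (LINT x|lebesgue. norm (?cr x) powr p) = (\<integral>\<^sup>+x. ennreal (norm (?cr x) powr p) \<partial>lebesgue)"
        by (intro nn_integral_eq_integral[symmetric] icr) auto
      also have "\<dots> \<le> ennreal (LINT x|lebesgue. norm (r x) powr p)"
        by (rule nn_integral_conv_powr_le[OF \<rho> p ri rp])
      finally show ?thesis by (subst (asm) ennreal_le_iff) (auto intro: integral_nonneg_AE)
    qed
    have 2: "(LINT x|lebesgue. norm (?cg x - g x) powr p) \<le> c powr p * V"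
    proof -
      have "(LINT x|lebesgue. norm (?cg x - g x) powr p) \<le> (LINT x|lebesgue. c powr p * indicator (cball 0 (R + 2)) (x::'a))"
      proof (rule integral_mono[OF icg' ind])
        fix x
        have "norm (?cg x - g x) \<le> c"
        proof (rule conv_minus_continuous_le[OF \<rho> gi])
          fix y assume "norm (x - y) < \<epsilon> n"
          then show "norm (g y - g x) \<le> c"
            using d(2)[of y x] en by (simp add: norm_minus_commute less_imp_le)
        qed
        then have "norm (?cg x - g x) powr p \<le> c powr p" using p0 by (intro powr_mono2) auto
        then show "norm (?cg x - g x) powr p \<le> c powr p * indicator (cball 0 (R + 2)) x"
          using s(1)[of x] g(2)[of x] by (cases "x \<in> cball 0 (R + 2)") auto
      qed
      also have "\<dots> = c powr p * V" by (simp add: V_def)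
      finally show ?thesis .
    qed
    have "(LINT x|lebesgue. norm (conv (\<rho> n) f x - f x) powr p) \<le>
       2 powr p * ((LINT x|lebesgue. norm (?cg x - g x) powr p) + (LINT x|lebesgue. norm (?cr x - r x) powr p))"
      unfolding eq by (intro integrable_powr_add integrable_powr_diff p0 icg icr gp rp) measurable
    also have "\<dots> \<le> 2 powr p * (c powr p * V + 2 powr p * ((LINT x|lebesgue. norm (?cr x) powr p) + (LINT x|lebesgue. norm (r x) powr p)))"
      by (intro mult_left_mono add_mono 2 integrable_powr_diff p0 icr rp) auto
    also have "\<dots> \<le> 2 powr p * (c powr p * V + 2 powr p * (e1 + e1))"
      using 1 g(3) by (intro mult_left_mono add_mono) (auto simp: r_def)
    also have "\<dots> = 2 powr p * (c powr p * V) + e / 2"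
      by (simp add: e1_def field_simps)
    also have "\<dots> < e"
    proof -
      have "2 powr p * (c powr p * V) = e / 4 * (V / (V + 1))"
        using V by (simp add: cp)
      also have "\<dots> \<le> e / 4 * 1" using e V by (intro mult_left_mono) auto
      finally show ?thesis using e by simp
    qed
    finally have "(LINT x|lebesgue. norm (conv (\<rho> n) f x - f x) powr p) < e" .
    moreover have "0 \<le> (LINT x|lebesgue. norm (conv (\<rho> n) f x - f x) powr p)"
      by (intro integral_nonneg_AE) auto
    ultimately show "norm ((LINT x|lebesgue. norm (conv (\<rho> n) f x - f x) powr p) - 0) < e" by simp
  qed
qed

lemma mollifier_sequence:
  obtains \<epsilon> \<rho> and \<rho>' :: "nat \<Rightarrow> 'a::euclidean_space \<Rightarrow> 'a"
  where "\<And>n. mollifier (\<epsilon> n) (\<rho> n) (\<rho>' n)" "\<epsilon> \<longlonglongrightarrow> 0"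
proof -
  have "\<exists>\<rho> (\<rho>' :: 'a \<Rightarrow> 'a). mollifier (1 / real (Suc n)) \<rho> \<rho>'" for n
    using mollifier_exists[of "1 / real (Suc n)"] by (metis of_nat_0_less_iff zero_less_Suc zero_less_divide_1_iff)
  then obtain \<rho> and \<rho>' :: "nat \<Rightarrow> 'a \<Rightarrow> 'a" where "\<And>n. mollifier (1 / real (Suc n)) (\<rho> n) (\<rho>' n)"
    by metis
  then show ?thesis
    using LIMSEQ_inverse_real_of_nat by (intro that[of "\<lambda>n. 1 / real (Suc n)" \<rho> \<rho>']) (auto simp: inverse_eq_divide)
qed

section \<open>Convergence and measurability lemmas\<close>

lemma squeeze_zero:
  fixes f g :: "nat \<Rightarrow> real"
  assumes "\<And>n. 0 \<le> f n" "\<And>n. f n \<le> g n" "g \<longlonglongrightarrow> 0"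
  shows "f \<longlonglongrightarrow> 0"
  by (rule tendsto_sandwich[OF _ _ tendsto_const assms(3)]) (use assms in auto)

lemma dominated_convergence_zero:
  fixes f :: "nat \<Rightarrow> 'a \<Rightarrow> real"
  assumes "\<And>n. f n \<in> borel_measurable M" "integrable M w"
    "AE x in M. (\<lambda>n. f n x) \<longlonglongrightarrow> 0" "\<And>n. AE x in M. \<bar>f n x\<bar> \<le> w x"
  shows "(\<lambda>n. LINT x|M. f n x) \<longlonglongrightarrow> 0"
  using integral_dominated_convergence[where f="\<lambda>_. 0" and s=f and w=w and M=M] assms by simp

text \<open>Write a_n w_n - \<alpha> v = a_n (w_n - v) + (a_n - \<alpha>) v. The first part is small
  because a_n is bounded, the second by dominated convergence. Convergence of a_n is asked for only
  where v is nonzero: in \<open>sob0_pos_diff\<close> the a_n are indicators that may oscillate on a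
  level set where the limit gradient v vanishes.\<close>

lemma Lp_bounded_mult_tendsto:
  fixes w :: "nat \<Rightarrow> 'a \<Rightarrow> 'b::euclidean_space"
  assumes p: "1 \<le> p"
    and am: "\<And>n. a n \<in> borel_measurable M" "\<alpha> \<in> borel_measurable M"
    and ab: "\<And>n x. \<bar>a n x\<bar> \<le> C" "\<And>x. \<bar>\<alpha> x\<bar> \<le> C"
    and lim: "AE x in M. v x \<noteq> 0 \<longrightarrow> (\<lambda>n. a n x) \<longlonglongrightarrow> \<alpha> x"
    and wm: "\<And>n. w n \<in> borel_measurable M" "v \<in> borel_measurable M"
    and wp: "\<And>n. integrable M (\<lambda>x. norm (w n x) powr p)" "integrable M (\<lambda>x. norm (v x) powr p)"
    and conv: "(\<lambda>n. LINT x|M. norm (w n x - v x) powr p) \<longlonglongrightarrow> 0"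
  shows "(\<lambda>n. LINT x|M. norm (a n x *\<^sub>R w n x - \<alpha> x *\<^sub>R v x) powr p) \<longlonglongrightarrow> 0"
proof -
  note [measurable] = am wm
  have p0: "0 \<le> p" "0 < p" using p by auto
  have bd: "norm (c *\<^sub>R z) powr p \<le> D powr p * norm z powr p" if "\<bar>c\<bar> \<le> D" for c D and z :: 'b
  proof -
    have "norm (c *\<^sub>R z) powr p = \<bar>c\<bar> powr p * norm z powr p" by (simp add: powr_mult)
    also have "\<dots> \<le> D powr p * norm z powr p"
      using that p0 by (intro mult_right_mono powr_mono2) auto
    finally show ?thesis .
  qed
  have dp: "integrable M (\<lambda>x. norm (w n x - v x) powr p)" for n
    by (intro integrable_powr_diff p0 wp wm)
  have i1: "integrable M (\<lambda>x. norm (a n x *\<^sub>R (w n x - v x)) powr p)" for n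
    by (rule Bochner_Integration.integrable_bound[OF integrable_mult_right[OF dp[of n], of "C powr p"]])
      (use bd[OF ab(1)] in auto)
  have i2: "integrable M (\<lambda>x. norm ((a n x - \<alpha> x) *\<^sub>R v x) powr p)" for n
  proof (rule Bochner_Integration.integrable_bound[OF integrable_mult_right[OF wp(2), of "(2 * C) powr p"]])
    have "\<bar>a n x - \<alpha> x\<bar> \<le> 2 * C" for x using ab(1)[of n x] ab(2)[of x] by linarith
    from bd[OF this] show "AE x in M. norm (norm ((a n x - \<alpha> x) *\<^sub>R v x) powr p) \<le> norm ((2 * C) powr p * norm (v x) powr p)"
      by auto
  qed measurable
  have l1: "(\<lambda>n. C powr p * (LINT x|M. norm (w n x - v x) powr p)) \<longlonglongrightarrow> 0"
    using tendsto_mult_left[OF conv, of "C powr p"] by simp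
  have l2: "(\<lambda>n. LINT x|M. norm ((a n x - \<alpha> x) *\<^sub>R v x) powr p) \<longlonglongrightarrow> 0"
  proof (rule dominated_convergence_zero[where w="\<lambda>x. (2 * C) powr p * norm (v x) powr p"])
    show "integrable M (\<lambda>x. (2 * C) powr p * norm (v x) powr p)" using wp(2) by simp
    show "AE x in M. (\<lambda>n. norm ((a n x - \<alpha> x) *\<^sub>R v x) powr p) \<longlonglongrightarrow> 0"
      using lim
    proof (rule eventually_mono)
      fix x assume l: "v x \<noteq> 0 \<longrightarrow> (\<lambda>n. a n x) \<longlonglongrightarrow> \<alpha> x"
      have "(\<lambda>n. (a n x - \<alpha> x) *\<^sub>R v x) \<longlonglongrightarrow> 0"
      proof (cases "v x = 0")
        case False
        then have "(\<lambda>n. a n x - \<alpha> x) \<longlonglongrightarrow> 0" using l LIM_zero by blast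
        then show ?thesis using tendsto_scaleR[OF _ tendsto_const[of "v x"]] by fastforce
      qed simp
      then have "(\<lambda>n. norm ((a n x - \<alpha> x) *\<^sub>R v x)) \<longlonglongrightarrow> 0" by (rule tendsto_norm_zero)
      then show "(\<lambda>n. norm ((a n x - \<alpha> x) *\<^sub>R v x) powr p) \<longlonglongrightarrow> 0"
        using p0 by (intro tendsto_zero_powrI[where b=p]) auto
    qed
    fix n
    have "\<bar>a n x - \<alpha> x\<bar> \<le> 2 * C" for x using ab(1)[of n x] ab(2)[of x] by linarith
    from bd[OF this] show "AE x in M. \<bar>norm ((a n x - \<alpha> x) *\<^sub>R v x) powr p\<bar> \<le> (2 * C) powr p * norm (v x) powr p"
      by auto
  qed measurable
  show ?thesis
  proof (rule squeeze_zero)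
    show "0 \<le> (LINT x|M. norm (a n x *\<^sub>R w n x - \<alpha> x *\<^sub>R v x) powr p)" for n
      by (intro integral_nonneg_AE) auto
    show "(\<lambda>n. 2 powr p * (C powr p * (LINT x|M. norm (w n x - v x) powr p) + (LINT x|M. norm ((a n x - \<alpha> x) *\<^sub>R v x) powr p))) \<longlonglongrightarrow> 0"
      using tendsto_mult_left[OF tendsto_add[OF l1 l2], of "2 powr p"] by simp
    fix n
      have "(LINT x|M. norm (a n x *\<^sub>R w n x - \<alpha> x *\<^sub>R v x) powr p) =
        (LINT x|M. norm (a n x *\<^sub>R (w n x - v x) + (a n x - \<alpha> x) *\<^sub>R v x) powr p)"
        by (simp add: scaleR_diff_right scaleR_diff_left)
      also have "\<dots> \<le> 2 powr p * ((LINT x|M. norm (a n x *\<^sub>R (w n x - v x)) powr p) + (LINT x|M. norm ((a n x - \<alpha> x) *\<^sub>R v x) powr p))"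
        by (intro integrable_powr_add p0 i1 i2) measurable
      also have "(LINT x|M. norm (a n x *\<^sub>R (w n x - v x)) powr p) \<le> (LINT x|M. C powr p * norm (w n x - v x) powr p)"
        by (intro integral_mono i1 bd ab integrable_mult_right dp)
      finally show "(LINT x|M. norm (a n x *\<^sub>R w n x - \<alpha> x *\<^sub>R v x) powr p) \<le>
        2 powr p * (C powr p * (LINT x|M. norm (w n x - v x) powr p) + (LINT x|M. norm ((a n x - \<alpha> x) *\<^sub>R v x) powr p))"
        by simp
  qed
qed

lemma tendsto_integral_L1:
  fixes f :: "nat \<Rightarrow> 'a \<Rightarrow> 'b::euclidean_space"
  assumes "\<And>n. integrable M (f n)" "integrable M g" "(\<lambda>n. LINT x|M. norm (f n x - g x)) \<longlonglongrightarrow> 0"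
  shows "(\<lambda>n. LINT x|M. f n x) \<longlonglongrightarrow> (LINT x|M. g x)"
proof -
  have "(\<lambda>n. (LINT x|M. f n x) - (LINT x|M. g x)) \<longlonglongrightarrow> 0"
  proof (rule Lim_null_comparison[OF _ assms(3)], intro always_eventually allI)
    fix n
    have "(LINT x|M. f n x) - (LINT x|M. g x) = (LINT x|M. f n x - g x)"
      using assms(1)[of n] assms(2) by simp
    then show "norm ((LINT x|M. f n x) - (LINT x|M. g x)) \<le> (LINT x|M. norm (f n x - g x))"
      by simp
  qed
  then show ?thesis by (simp add: LIM_zero_iff)
qed

lemma integral_lebesgue_on_eq:
  fixes f :: "'a::euclidean_space \<Rightarrow> 'b::euclidean_space"
  assumes "S \<in> sets lebesgue" "\<And>x. x \<in> S \<Longrightarrow> f x = g x" "\<And>x. x \<notin> S \<Longrightarrow> g x = 0"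
  shows "(LINT x|lebesgue_on S. f x) = (LINT x|lebesgue. g x)"
proof -
  have "(\<lambda>x. if x \<in> S then f x else 0) = g" using assms by auto
  then show ?thesis using Lebesgue_Measure.integral_restrict_UNIV[OF assms(1), of f] by simp
qed

text \<open>Completeness of Lebesgue measure, brought to a subset through extension by zero.\<close>

lemma measurable_lebesgue_on_AE:
  fixes f g :: "'a::euclidean_space \<Rightarrow> 'b::euclidean_space"
  assumes S: "S \<in> sets lebesgue" and f: "f \<in> borel_measurable (lebesgue_on S)"
    and ae: "AE x in lebesgue_on S. f x = g x"
  shows "g \<in> borel_measurable (lebesgue_on S)"
proof -
  have "(\<lambda>x. if x \<in> S then f x else 0) \<in> borel_measurable lebesgue"
    using S f by (simp add: borel_measurable_if)
  moreover have "AE x in lebesgue. (if x \<in> S then f x else 0) = (if x \<in> S then g x else 0)"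
    using ae S by (subst (asm) AE_restrict_space_iff) (auto elim!: eventually_mono)
  ultimately have "(\<lambda>x. if x \<in> S then g x else 0) \<in> borel_measurable lebesgue"
    by (rule borel_measurable_AE)
  then show ?thesis using S by (simp add: borel_measurable_if)
qed

lemma C1c_mult:
  assumes "C1c_with_gradient \<Omega> \<eta> \<eta>'" "\<And>x. GDERIV f x :> f' x" "continuous_on UNIV f'"
  shows "C1c_with_gradient \<Omega> (\<lambda>x. f x * \<eta> x) (\<lambda>x. f x *\<^sub>R \<eta>' x + \<eta> x *\<^sub>R f' x)"
proof -
  obtain K where K: "compact K" "K \<subseteq> \<Omega>" "\<And>x. x \<notin> K \<Longrightarrow> \<eta> x = 0"
    using C1c_D[OF assms(1)] by metis
  show ?thesis
  proof (rule C1cI[OF _ _ K(1,2)])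
    show "GDERIV (\<lambda>x. f x * \<eta> x) x :> f x *\<^sub>R \<eta>' x + \<eta> x *\<^sub>R f' x" for x
      using assms by (intro GDERIV_mult) (auto simp: C1c_with_gradient_def)
    show "continuous_on UNIV (\<lambda>x. f x *\<^sub>R \<eta>' x + \<eta> x *\<^sub>R f' x)"
      by (intro continuous_intros C1c_continuous[OF assms(1)] assms(3) GDERIV_continuous_on[OF assms(2)])
  qed (simp add: K(3))
qed

text \<open>The product of f and \<eta> is again a test function, so the integral of its gradient
  vanishes by \<open>C1c_integral_gradient\<close>; the product rule splits that gradient into the
  two terms.\<close>

lemma C1_integration_by_parts:
  fixes f :: "'a::euclidean_space \<Rightarrow> real"
  assumes \<eta>: "C1c_with_gradient \<Omega> \<eta> \<eta>'" and f: "\<And>x. GDERIV f x :> f' x" "continuous_on UNIV f'"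
  shows "(LINT x|lebesgue. f x *\<^sub>R \<eta>' x) = - (LINT x|lebesgue. \<eta> x *\<^sub>R f' x)"
    "integrable lebesgue (\<lambda>x. f x *\<^sub>R \<eta>' x)" "integrable lebesgue (\<lambda>x. \<eta> x *\<^sub>R f' x)"
proof -
  obtain K where K: "compact K" "\<And>x. x \<notin> K \<Longrightarrow> \<eta> x = 0" "\<And>x. x \<notin> K \<Longrightarrow> \<eta>' x = 0"
    using C1c_D[OF \<eta>] by metis
  have fc: "continuous_on UNIV f" by (rule GDERIV_continuous_on[OF f(1)])
  show 1: "integrable lebesgue (\<lambda>x. f x *\<^sub>R \<eta>' x)"
    by (rule integrable_continuous_compact_support(2)[OF _ K(1)])
      (use K in \<open>auto intro!: continuous_intros C1c_continuous[OF \<eta>] fc\<close>)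
  show 2: "integrable lebesgue (\<lambda>x. \<eta> x *\<^sub>R f' x)"
    by (rule integrable_continuous_compact_support(2)[OF _ K(1)])
      (use K in \<open>auto intro!: continuous_intros C1c_continuous[OF \<eta>] f(2)\<close>)
  have "(LINT x|lebesgue. f x *\<^sub>R \<eta>' x + \<eta> x *\<^sub>R f' x) = 0"
    by (rule C1c_integral_gradient[OF C1c_mult[OF \<eta> f]])
  then show "(LINT x|lebesgue. f x *\<^sub>R \<eta>' x) = - (LINT x|lebesgue. \<eta> x *\<^sub>R f' x)"
    using 1 2 by (simp add: eq_neg_iff_add_eq_0)
qed

text \<open>Approximate the pair (u, g) by simple functions. Along a simple function L is glued from
  finitely many measurable pieces, and continuity in the last two arguments passes to the limit for
  almost every x. Completeness takes care of the exceptional null set.\<close>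

lemma caratheodory_measurable:
  fixes L :: "'a::euclidean_space \<Rightarrow> real \<Rightarrow> 'a \<Rightarrow> real"
  assumes L: "caratheodory \<Omega> L" and \<Omega>: "\<Omega> \<in> sets lebesgue"
    and u: "u \<in> borel_measurable (lebesgue_on \<Omega>)" and g: "g \<in> borel_measurable (lebesgue_on \<Omega>)"
  shows "(\<lambda>x. L x (u x) (g x)) \<in> borel_measurable (lebesgue_on \<Omega>)"
proof -
  let ?M = "lebesgue_on \<Omega>"
  have "(\<lambda>x. (u x, g x)) \<in> borel_measurable ?M"
    using u g by (rule borel_measurable_Pair)
  then obtain F where F: "\<And>i. simple_function ?M (F i)"
    "\<And>x. x \<in> space ?M \<Longrightarrow> (\<lambda>i. F i x) \<longlonglongrightarrow> (u x, g x)"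
    using borel_measurable_implies_sequence_metric[of "\<lambda>x. (u x, g x)" ?M undefined] by metis
  define S where "S i x = L x (fst (F i x)) (snd (F i x))" for i x
  have [measurable]: "S i \<in> borel_measurable ?M" for i
    unfolding S_def
  proof (rule measurable_compose_countable'[where I="F i ` space ?M" and g="F i"])
    show "(\<lambda>x. L x (fst a) (snd a)) \<in> borel_measurable ?M" for a
      using L by (simp add: caratheodory_def)
    show "countable (F i ` space ?M)"
      using F(1)[of i] by (simp add: simple_function_def countable_finite)
    show "F i \<in> measurable ?M (count_space (F i ` space ?M))"
      using F(1)[of i] by (subst measurable_count_space_eq2) (auto simp: simple_function_def)
  qed
  have "(\<lambda>x. lim (\<lambda>i. S i x)) \<in> borel_measurable ?M" by measurable
  moreover have "AE x in ?M. continuous_on UNIV (\<lambda>(t, \<xi>). L x t \<xi>)"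
    using L by (simp add: caratheodory_def)
  then have "AE x in ?M. lim (\<lambda>i. S i x) = L x (u x) (g x)"
  proof (rule AE_mp, intro AE_I2 impI)
    fix x assume x: "x \<in> space ?M" and c: "continuous_on UNIV (\<lambda>(t, \<xi>). L x t \<xi>)"
    have "isCont (\<lambda>(t, \<xi>). L x t \<xi>) (u x, g x)" using c by (simp add: continuous_on_eq_continuous_at)
    from isCont_tendsto_compose[OF this F(2)[OF x]]
    have "(\<lambda>i. S i x) \<longlonglongrightarrow> L x (u x) (g x)" by (simp add: S_def case_prod_beta)
    then show "lim (\<lambda>i. S i x) = L x (u x) (g x)" by (rule limI)
  qed
  ultimately show ?thesis by (rule measurable_lebesgue_on_AE[OF \<Omega>])
qed

section \<open>Tails of integrable functions and the choice of a level\<close>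

lemma integral_tail_tendsto_0:
  fixes f :: "'a \<Rightarrow> real"
  assumes "u \<in> borel_measurable M" "integrable M f"
  shows "(\<lambda>n. LINT x|M. indicator {real n..} (u x) * f x) \<longlonglongrightarrow> 0"
proof (rule dominated_convergence_zero[where w="\<lambda>x. \<bar>f x\<bar>"])
  note [measurable] = assms(1) borel_measurable_integrable[OF assms(2)]
  show "(\<lambda>x. indicator {real n..} (u x) * f x) \<in> borel_measurable M" for n by measurable
  show "AE x in M. (\<lambda>n. indicator {real n..} (u x) * f x) \<longlonglongrightarrow> 0"
  proof (intro AE_I2 tendsto_eventually)
    fix x
    obtain m :: nat where "u x < real m" using reals_Archimedean2 by blast
    then show "\<forall>\<^sub>F n in sequentially. indicator {real n..} (u x) * f x = 0"
      by (intro eventually_sequentiallyI[of m]) auto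
  qed
  show "AE x in M. \<bar>indicator {real n..} (u x) * f x\<bar> \<le> \<bar>f x\<bar>" for n
    by (intro AE_I2) (auto simp: indicator_def)
qed (use assms in simp)

text \<open>If \<open>h s * G s \<ge> e\<close> for all large \<open>s\<close>, where \<open>G s\<close> is the measure of \<open>{s \<le> u}\<close>, then between the
  levels \<open>T0 < T\<close> with \<open>G T \<le> G T0 / 2\<close> the integral of \<open>h \<circ> u\<close> is at least \<open>e / 2\<close>.\<close>

lemma exists_small_level:
  fixes u :: "'a \<Rightarrow> real" and h :: "real \<Rightarrow> real"
  assumes M: "finite_measure M" and u: "u \<in> borel_measurable M"
    and h: "\<And>s. 0 \<le> h s" "integrable M (\<lambda>x. h (u x))" and e: "0 < e"
  obtains s where "S \<le> s" "h s * (LINT x|M. indicator {s..} (u x)) < e"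
proof (rule ccontr)
  note [measurable] = u
  interpret finite_measure M by (rule M)
  define G where "G s = (LINT x|M. indicator {s..} (u x) :: real)" for s
  note level = that
  assume no: "\<not> thesis"
  have ge: "e \<le> h s * G s" if "S \<le> s" for s
    using no level[OF that] unfolding G_def by linarith
  have Gi: "integrable M (\<lambda>x. indicator {s..} (u x) :: real)" for s
    by (rule integrable_const_bound[of _ 1]) (auto simp: indicator_def)
  have G0: "0 \<le> G s" for s unfolding G_def by (intro integral_nonneg_AE) auto
  have Gpos: "0 < G s" if "S \<le> s" for s
  proof -
    have "G s \<noteq> 0" using ge[OF that] e by auto
    then show ?thesis using G0[of s] by linarith
  qed
  have Gmono: "G t \<le> G s" if "s \<le> t" for s t
    unfolding G_def by (intro integral_mono Gi) (use that in \<open>auto simp: indicator_def\<close>)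
  have Glim: "(\<lambda>n. G (real n)) \<longlonglongrightarrow> 0"
    using integral_tail_tendsto_0[OF u, of "\<lambda>_. 1"] by (simp add: G_def)
  have "\<forall>\<^sub>F n in sequentially. (LINT x|M. indicator {real n..} (u x) * h (u x)) < e / 2 \<and> S \<le> real n"
    using e by (intro eventually_conj order_tendstoD(2)[OF integral_tail_tendsto_0[OF u h(2)]])
      (auto intro: eventually_sequentiallyI[of "nat \<lceil>S\<rceil>"] simp: nat_le_iff ceiling_le_iff)
  then obtain n :: nat where n: "(LINT x|M. indicator {real n..} (u x) * h (u x)) < e / 2" "S \<le> real n"
    by (auto simp: eventually_sequentially)
  \<comment> \<open>\<open>T\<close> is the lower of the two levels, \<open>real m\<close> will be
    the upper one. Above \<open>T\<close> the integral of h o u is already below e / 2, which the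
    layer between the levels is going to contradict.\<close>
  define T where "T = real n"
  have "\<forall>\<^sub>F m in sequentially. G (real m) < G T / 2"
    using Gpos[of T] n(2) by (intro order_tendstoD(2)[OF Glim]) (simp add: T_def)
  then obtain m :: nat where m: "G (real m) < G T / 2" by (auto simp: eventually_sequentially)
  have hi: "integrable M (\<lambda>x. indicator {T..} (u x) * h (u x))"
    by (rule Bochner_Integration.integrable_bound[OF h(2)])
      (use borel_measurable_integrable[OF h(2)] h(1) in \<open>auto simp: indicator_def\<close>)
  \<comment> \<open>On the layer between the levels h (u x) >= e / G (u x) >= e / G T, because G
    decreases; the layer has measure G T - G (real m), more than half of G T.\<close>
  have "e / G T * (G T - G (real m)) = (LINT x|M. e / G T * (indicator {T..} (u x) - indicator {real m..} (u x)))"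
    using Gi by (simp add: G_def)
  also have "\<dots> \<le> (LINT x|M. indicator {T..} (u x) * h (u x))"
  proof (rule integral_mono[OF _ hi])
    show "integrable M (\<lambda>x. e / G T * (indicator {T..} (u x) - indicator {real m..} (u x)))"
      using Gi by simp
    fix x
    show "e / G T * (indicator {T..} (u x) - indicator {real m..} (u x)) \<le> indicator {T..} (u x) * h (u x)"
    proof (cases "T \<le> u x")
      case True
      have "S \<le> u x" using True n(2) by (simp add: T_def)
      have "e \<le> h (u x) * G (u x)" by (rule ge[OF \<open>S \<le> u x\<close>])
      also have "\<dots> \<le> h (u x) * G T" using Gmono[OF True] h(1) by (rule mult_left_mono)
      finally have "e / G T \<le> h (u x)" using Gpos[of T] n(2) by (simp add: T_def pos_divide_le_eq)
      moreover have "0 \<le> e / G T" using e G0 by simp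
      ultimately show ?thesis using True h(1)[of "u x"] by (auto simp: indicator_def)
    next
      case False
      then show ?thesis using e G0[of T] by (auto simp: indicator_def)
    qed
  qed
  also have "\<dots> < e / 2" using n(1) by (simp add: T_def)
  finally have "e / G T * (G T - G (real m)) < e / 2" .
  moreover have "e / 2 = e / G T * (G T / 2)" using Gpos[of T] n(2) by (simp add: T_def)
  moreover have "e / G T * (G T / 2) \<le> e / G T * (G T - G (real m))"
    using m e G0[of T] by (intro mult_left_mono) auto
  ultimately show False by linarith
qed

lemma Lbar_nonneg: "0 \<le> Lbar p L x t \<xi>"
  by (simp add: Lbar_def)

section \<open>Sobolev functions on a bounded open set\<close>

locale sobolev_domain =
  fixes \<Omega> :: "'a::euclidean_space set" and p :: real
  assumes open_\<Omega>: "open \<Omega>" and bounded_\<Omega>: "bounded \<Omega>" and p1: "1 \<le> p"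
begin

abbreviation "\<mu> \<equiv> lebesgue_on \<Omega>"

abbreviation "test \<equiv> C1c_with_gradient \<Omega>"

lemma p0: "0 \<le> p" "0 < p" using p1 by auto

lemma \<Omega>_sets[measurable, simp]: "\<Omega> \<in> sets lebesgue" using open_\<Omega> by (simp add: borel_open)

lemma \<Omega>_lmeasurable: "\<Omega> \<in> lmeasurable" using open_\<Omega> bounded_\<Omega> by (simp add: lmeasurable_open)

lemma finite_measure_\<Omega>: "finite_measure \<mu>"
  by (rule finite_measure_lebesgue_on[OF \<Omega>_lmeasurable])

lemma integrable_const_\<Omega>: "integrable \<mu> (\<lambda>x. c :: 'b::euclidean_space)"
  by (intro finite_measure.integrable_const finite_measure_\<Omega>)

definition zero_ext :: "('a \<Rightarrow> 'b::euclidean_space) \<Rightarrow> 'a \<Rightarrow> 'b" where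
  "zero_ext f x = (if x \<in> \<Omega> then f x else 0)"

lemma zero_ext_radius: obtains R where "\<And>(f :: 'a \<Rightarrow> 'b::euclidean_space) x. R < norm x \<Longrightarrow> zero_ext f x = 0"
proof -
  obtain R where "\<And>x. x \<in> \<Omega> \<Longrightarrow> norm x \<le> R" using bounded_\<Omega> by (auto simp: bounded_iff)
  then show ?thesis by (intro that[of R]) (force simp: zero_ext_def)
qed

lemma integrable_ext: "integrable lebesgue (zero_ext f) \<longleftrightarrow> integrable \<mu> f"
  unfolding zero_ext_def by (rule Lebesgue_Measure.integrable_restrict_UNIV) simp

lemma measurable_ext: "zero_ext f \<in> borel_measurable lebesgue \<longleftrightarrow> f \<in> borel_measurable \<mu>"
  unfolding zero_ext_def by (rule borel_measurable_if) simp

lemma AE_\<Omega>: "(AE x in \<mu>. P x) \<longleftrightarrow> (AE x in lebesgue. x \<in> \<Omega> \<longrightarrow> P x)"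
  by (rule AE_restrict_space_iff) simp

lemma Lp_ext:
  assumes "f \<in> Lp p \<Omega>"
  shows "zero_ext f \<in> borel_measurable lebesgue" "integrable lebesgue (\<lambda>x. norm (zero_ext f x) powr p)"
    "integrable lebesgue (zero_ext f)" "integrable \<mu> f"
proof -
  show m: "zero_ext f \<in> borel_measurable lebesgue" using assms by (simp add: measurable_ext Lp_def)
  have eq: "(\<lambda>x. norm (zero_ext f x) powr p) = zero_ext (\<lambda>x. norm (f x) powr p)"
    by (auto simp: zero_ext_def)
  show i: "integrable lebesgue (\<lambda>x. norm (zero_ext f x) powr p)"
    unfolding eq integrable_ext using assms by (simp add: Lp_def)
  obtain R where R: "\<And>(f :: 'a \<Rightarrow> 'b) x. R < norm x \<Longrightarrow> zero_ext f x = 0" by (rule zero_ext_radius) blast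
  show "integrable lebesgue (zero_ext f)" by (rule integrable_bounded_support[OF p1 m R i])
  then show "integrable \<mu> f" by (simp add: integrable_ext)
qed

lemma Lp_measurable: "f \<in> Lp p \<Omega> \<Longrightarrow> f \<in> borel_measurable \<mu>"
  and Lp_powr: "f \<in> Lp p \<Omega> \<Longrightarrow> integrable \<mu> (\<lambda>x. norm (f x) powr p)"
  by (auto simp: Lp_def)

lemma Lp_add: "f \<in> Lp p \<Omega> \<Longrightarrow> g \<in> Lp p \<Omega> \<Longrightarrow> (\<lambda>x. f x + g x) \<in> Lp p \<Omega>"
  unfolding Lp_def using p0 by (auto intro!: integrable_powr_add)

lemma Lp_diff: "f \<in> Lp p \<Omega> \<Longrightarrow> g \<in> Lp p \<Omega> \<Longrightarrow> (\<lambda>x. f x - g x) \<in> Lp p \<Omega>"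
  unfolding Lp_def using p0 by (auto intro!: integrable_powr_diff)

lemma Lp_cmult: "f \<in> Lp p \<Omega> \<Longrightarrow> (\<lambda>x. c *\<^sub>R f x) \<in> Lp p \<Omega>"
  unfolding Lp_def by (auto simp: powr_mult)

lemma Lp_dominated:
  assumes "f \<in> borel_measurable \<mu>" "g \<in> Lp p \<Omega>" "\<And>x. norm (f x) \<le> norm (g x)"
  shows "f \<in> Lp p \<Omega>"
  unfolding Lp_def
proof (intro CollectI conjI)
  note [measurable] = assms(1)
  show "integrable \<mu> (\<lambda>x. norm (f x) powr p)"
    by (rule Bochner_Integration.integrable_bound[OF Lp_powr[OF assms(2)]])
      (use assms(3) p0 in \<open>auto intro!: powr_mono2\<close>)
qed (fact assms(1))

lemma Lp_AE:
  assumes "f \<in> Lp p \<Omega>" "AE x in \<mu>. f x = g x"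
  shows "g \<in> Lp p \<Omega>"
proof -
  have m: "g \<in> borel_measurable \<mu>"
    using measurable_lebesgue_on_AE[OF _ Lp_measurable[OF assms(1)] assms(2)] by simp
  note [measurable] = m Lp_measurable[OF assms(1)]
  have "integrable \<mu> (\<lambda>x. norm (g x) powr p)"
    by (rule integrable_cong_AE[THEN iffD1, OF _ _ _ Lp_powr[OF assms(1)]])
      (use assms(2) in \<open>auto elim!: eventually_mono\<close>)
  with m show ?thesis by (simp add: Lp_def)
qed

lemma Lp_bounded:
  assumes "f \<in> borel_measurable \<mu>" "\<And>x. x \<in> \<Omega> \<Longrightarrow> norm (f x) \<le> C"
  shows "f \<in> Lp p \<Omega>"
  unfolding Lp_def
proof (intro CollectI conjI)
  note [measurable] = assms(1)
  show "integrable \<mu> (\<lambda>x. norm (f x) powr p)"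
    by (rule Bochner_Integration.integrable_bound[OF integrable_const_\<Omega>[of "C powr p"]])
      (use assms(2) p0 in \<open>auto intro!: powr_mono2\<close>)
qed (fact assms(1))

section \<open>Local integrability, weak gradients and their uniqueness\<close>

lemma locally_integrable_\<Omega>:
  assumes "integrable \<mu> f"
  shows "locally_integrable \<Omega> f"
  unfolding locally_integrable_def
proof (intro allI impI)
  fix K assume K: "compact K \<and> K \<subseteq> \<Omega>"
  have "f absolutely_integrable_on \<Omega>"
    using assms by (simp add: set_integrable_def integrable_restrict_space)
  then show "f absolutely_integrable_on K"
    by (rule set_integrable_subset) (use K in \<open>auto simp: compact_imp_closed borel_closed\<close>)
qed

text \<open>The defining identity of the weak gradient, tested with y -> \<rho> (x - y); this test
  function is admissible because its support lies in the ball around x. Together with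
  \<open>conv_GDERIV\<close> it says that the gradient of the mollified u is the mollified g at such
  points.\<close>

lemma conv_weak_gradient:
  assumes wg: "has_weak_gradient \<Omega> u g" and \<rho>: "mollifier \<epsilon> \<rho> \<rho>'" and x: "cball x \<epsilon> \<subseteq> \<Omega>"
  shows "(LINT y|lebesgue. zero_ext u y *\<^sub>R \<rho>' (x - y)) = conv \<rho> (zero_ext g) x"
proof -
  have "(LINT y|\<mu>. u y *\<^sub>R (- \<rho>' (x - y))) = - (LINT y|\<mu>. \<rho> (x - y) *\<^sub>R g y)"
    using wg mollifier_C1c[OF \<rho> x] unfolding has_weak_gradient_def by blast
  moreover have "(LINT y|\<mu>. u y *\<^sub>R (- \<rho>' (x - y))) = (LINT y|lebesgue. - (zero_ext u y *\<^sub>R \<rho>' (x - y)))"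
    by (rule integral_lebesgue_on_eq) (auto simp: zero_ext_def)
  moreover have "(LINT y|\<mu>. \<rho> (x - y) *\<^sub>R g y) = conv \<rho> (zero_ext g) x"
    unfolding conv_def by (rule integral_lebesgue_on_eq) (auto simp: zero_ext_def)
  ultimately show ?thesis by simp
qed

text \<open>The fundamental lemma of the calculus of variations. On a ball whose double lies in
  \<Omega> the mollifications of g vanish as soon as the kernel radius is below r, since they are
  integrals of g against test functions; but they converge to g in L^1.\<close>

lemma locally_integrable_zero:
  fixes g :: "'a \<Rightarrow> 'b::euclidean_space"
  assumes g: "locally_integrable \<Omega> g"
    and 0: "\<And>\<eta> \<eta>'. test \<eta> \<eta>' \<Longrightarrow> (LINT x|\<mu>. \<eta> x *\<^sub>R g x) = 0"
  shows "AE x in \<mu>. g x = 0"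
proof -
  obtain \<epsilon> \<rho> and \<rho>' :: "nat \<Rightarrow> 'a \<Rightarrow> 'a" where \<rho>: "\<And>n. mollifier (\<epsilon> n) (\<rho> n) (\<rho>' n)" and \<epsilon>: "\<epsilon> \<longlonglongrightarrow> 0"
    using mollifier_sequence by metis
  have loc: "AE x in lebesgue. x \<in> ball a r \<longrightarrow> g x = 0" if r: "r > 0" "cball a (2 * r) \<subseteq> \<Omega>" for a r
  proof -
    \<comment> \<open>Cutting g off outside the doubled ball makes it integrable on the whole space
      without changing its mollifications on the smaller ball.\<close>
    define F where "F x = (if x \<in> cball a (2 * r) then g x else 0)" for x
    have "g absolutely_integrable_on cball a (2 * r)"
      using g r unfolding locally_integrable_def by auto
    moreover have "(\<lambda>x. indicator (cball a (2 * r)) x *\<^sub>R g x) = F" by (auto simp: F_def)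
    ultimately have Fi: "integrable lebesgue F" by (simp add: set_integrable_def)
    have F0: "F x = 0" if "norm a + 2 * r < norm x" for x
      using that norm_triangle_ineq2[of x a] by (auto simp: F_def dist_norm norm_minus_commute)
    have lim: "(\<lambda>n. LINT x|lebesgue. norm (conv (\<rho> n) F x - F x) powr 1) \<longlonglongrightarrow> 0"
      by (rule mollify_Lp_tendsto[OF _ _ F0 _ \<rho> \<epsilon>]) (use Fi in auto)
    have ci: "integrable lebesgue (conv (\<rho> n) F)" for n
      using conv_continuous[OF mollifier_test[OF \<rho>] Fi] conv_support[OF \<rho> F0]
      by (intro integrable_continuous_compact_support(2)[of _ "cball 0 (norm a + 2 * r + \<epsilon> n)"]) auto
    have Fb: "integrable lebesgue (\<lambda>x. indicator (ball a r) x *\<^sub>R norm (F x))"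
    proof (rule Bochner_Integration.integrable_bound[OF integrable_norm[OF Fi]])
      show "(\<lambda>x. indicator (ball a r) x *\<^sub>R norm (F x)) \<in> borel_measurable lebesgue"
        by (intro borel_measurable_scaleR borel_measurable_indicator borel_measurable_integrable[OF integrable_norm[OF Fi]]) simp
    qed (auto simp: indicator_def)
    have "(LINT x|lebesgue. indicator (ball a r) x *\<^sub>R norm (F x)) \<le> 0"
    proof (rule LIMSEQ_le_const[OF lim])
      have "\<forall>\<^sub>F n in sequentially. \<epsilon> n < r" using order_tendstoD(2)[OF \<epsilon> r(1)] .
      then obtain n0 where n0: "\<And>n. n \<ge> n0 \<Longrightarrow> \<epsilon> n < r" by (auto simp: eventually_sequentially)
      show "\<exists>N. \<forall>n\<ge>N. (LINT x|lebesgue. indicator (ball a r) x *\<^sub>R norm (F x)) \<le> (LINT x|lebesgue. norm (conv (\<rho> n) F x - F x) powr 1)"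
      proof (intro exI[of _ n0] allI impI integral_mono Fb)
        fix n assume n: "n0 \<le> n"
        show "integrable lebesgue (\<lambda>x. norm (conv (\<rho> n) F x - F x) powr 1)" using ci[of n] Fi by simp
        fix x
        show "indicator (ball a r) x *\<^sub>R norm (F x) \<le> norm (conv (\<rho> n) F x - F x) powr 1"
        proof (cases "x \<in> ball a r")
          case True
          have sub: "cball x (\<epsilon> n) \<subseteq> cball a (2 * r)"
          proof
            fix y assume "y \<in> cball x (\<epsilon> n)"
            then show "y \<in> cball a (2 * r)"
              using True dist_triangle[of a y x] n0[OF n] by simp
          qed
          have "conv (\<rho> n) F x = (LINT y|\<mu>. \<rho> n (x - y) *\<^sub>R g y)"
            unfolding conv_def
          proof (rule integral_lebesgue_on_eq[symmetric])
            fix y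
            show "\<rho> n (x - y) *\<^sub>R g y = \<rho> n (x - y) *\<^sub>R F y"
            proof (cases "y \<in> cball a (2 * r)")
              case False
              then have "y \<notin> cball x (\<epsilon> n)" using sub by blast
              then show ?thesis using mollifier_D(6)[OF \<rho>[of n], of "x - y"] by (simp add: dist_norm)
            qed (simp add: F_def)
            show "\<rho> n (x - y) *\<^sub>R F y = 0" if "y \<notin> \<Omega>" using that r by (auto simp: F_def)
          qed simp
          also have "\<dots> = 0"
            by (rule 0[OF mollifier_C1c[OF \<rho>[of n]]]) (use sub r in blast)
          finally show ?thesis using True by simp
        qed simp
      qed
    qed
    moreover have "0 \<le> (LINT x|lebesgue. indicator (ball a r) x *\<^sub>R norm (F x))"
      by (intro integral_nonneg_AE) auto
    ultimately have "(LINT x|lebesgue. indicator (ball a r) x *\<^sub>R norm (F x)) = 0" by linarith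
    then have "AE x in lebesgue. indicator (ball a r) x *\<^sub>R norm (F x) = 0"
      by (subst (asm) integral_nonneg_eq_0_iff_AE[OF Fb]) auto
    then show ?thesis
    proof (rule eventually_mono, intro impI)
      fix x assume "indicator (ball a r) x *\<^sub>R norm (F x) = 0" and x: "x \<in> ball a r"
      moreover have "x \<in> cball a (2 * r)" using x r by auto
      ultimately show "g x = 0" by (simp add: F_def)
    qed
  qed
  define \<F> where "\<F> = {ball a r |a r. r > 0 \<and> cball a (2 * r) \<subseteq> \<Omega>}"
  \<comment> \<open>Statements almost everywhere combine only countably often, so Lindelof's theorem
    thins out the cover by balls.\<close>
  obtain \<F>' where F': "\<F>' \<subseteq> \<F>" "countable \<F>'" "\<Union>\<F>' = \<Union>\<F>"
    by (rule Lindelof[of \<F>]) (auto simp: \<F>_def)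
  have cover: "\<Omega> \<subseteq> \<Union>\<F>"
  proof
    fix x assume "x \<in> \<Omega>"
    then obtain e where "e > 0" "cball x e \<subseteq> \<Omega>" using open_\<Omega> open_contains_cball by blast
    then have "ball x (e / 2) \<in> \<F>" "x \<in> ball x (e / 2)" unfolding \<F>_def by force+
    then show "x \<in> \<Union>\<F>" by blast
  qed
  have "AE x in lebesgue. \<forall>B\<in>\<F>'. x \<in> B \<longrightarrow> g x = 0"
    using F' loc by (subst AE_ball_countable) (auto simp: \<F>_def)
  then have "AE x in lebesgue. x \<in> \<Omega> \<longrightarrow> g x = 0"
    by (rule eventually_mono) (use cover F'(3) in blast)
  then show ?thesis by (simp add: AE_\<Omega>)
qed

text \<open>The gradient is an explicit second component: \<open>weak_grad\<close> selects a
  representative by choice, and that choice commutes with sums or maxima only up to null sets.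
  Computations are made with pairs and transferred to \<open>weak_grad\<close> by
  uniqueness.\<close>

definition sob :: "('a \<Rightarrow> real) \<Rightarrow> ('a \<Rightarrow> 'a) \<Rightarrow> bool" where
  "sob u g \<longleftrightarrow> u \<in> Lp p \<Omega> \<and> g \<in> Lp p \<Omega> \<and> has_weak_gradient \<Omega> u g"

lemma measurable_\<Omega>: "f \<in> borel_measurable borel \<Longrightarrow> f \<in> borel_measurable \<mu>"
  by (intro measurable_restrict_space1 measurable_completion) simp

lemma C1c_measurable_\<Omega>:
  assumes "test \<eta> \<eta>'"
  shows "\<eta> \<in> borel_measurable \<mu>" "\<eta>' \<in> borel_measurable \<mu>"
  using C1c_continuous[OF assms] by (auto intro!: measurable_\<Omega> borel_measurable_continuous_onI)

lemma C1c_scaleR_integrable: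
  fixes f :: "'a \<Rightarrow> real" and g :: "'a \<Rightarrow> 'b::euclidean_space"
  assumes \<eta>: "test \<eta> \<eta>'"
  shows "integrable \<mu> f \<Longrightarrow> integrable \<mu> (\<lambda>x. f x *\<^sub>R \<eta>' x)"
    "integrable \<mu> g \<Longrightarrow> integrable \<mu> (\<lambda>x. \<eta> x *\<^sub>R g x)"
proof -
  obtain B where B: "B > 0" "\<And>x. \<bar>\<eta> x\<bar> \<le> B" "\<And>x. norm (\<eta>' x) \<le> B"
    using C1c_bounded[OF \<eta>] by metis
  note [measurable] = C1c_measurable_\<Omega>[OF \<eta>]
  show "integrable \<mu> (\<lambda>x. f x *\<^sub>R \<eta>' x)" if f: "integrable \<mu> f"
  proof (rule Bochner_Integration.integrable_bound[OF integrable_mult_right[OF f, of B]])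
    show "(\<lambda>x. f x *\<^sub>R \<eta>' x) \<in> borel_measurable \<mu>"
      using borel_measurable_integrable[OF f] by measurable
    have "\<bar>f x\<bar> * norm (\<eta>' x) \<le> \<bar>f x\<bar> * B" for x using B by (intro mult_left_mono) auto
    then show "AE x in \<mu>. norm (f x *\<^sub>R \<eta>' x) \<le> norm (B * f x)"
      using B(1) by (simp add: abs_mult mult.commute)
  qed
  show "integrable \<mu> (\<lambda>x. \<eta> x *\<^sub>R g x)" if g: "integrable \<mu> g"
  proof (rule Bochner_Integration.integrable_bound[OF integrable_scaleR_right[OF g, of B]])
    show "(\<lambda>x. \<eta> x *\<^sub>R g x) \<in> borel_measurable \<mu>"
      using borel_measurable_integrable[OF g] by measurable
    have "\<bar>\<eta> x\<bar> * norm (g x) \<le> B * norm (g x)" for x using B by (intro mult_right_mono) auto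
    then show "AE x in \<mu>. norm (\<eta> x *\<^sub>R g x) \<le> norm (B *\<^sub>R g x)"
      using B(1) by simp
  qed
qed

lemma C1c_scaleR_locally_integrable:
  fixes g :: "'a \<Rightarrow> 'b::euclidean_space"
  assumes \<eta>: "test \<eta> \<eta>'" and g: "locally_integrable \<Omega> g"
  shows "integrable \<mu> (\<lambda>x. \<eta> x *\<^sub>R g x)"
proof -
  obtain K where K: "compact K" "K \<subseteq> \<Omega>" "\<And>x. x \<notin> K \<Longrightarrow> \<eta> x = 0"
    using C1c_D[OF \<eta>] by metis
  have "integrable lebesgue (\<lambda>x. indicator K x *\<^sub>R g x)"
    using g K unfolding locally_integrable_def set_integrable_def by blast
  moreover have "zero_ext (\<lambda>x. indicator K x *\<^sub>R g x) = (\<lambda>x. indicator K x *\<^sub>R g x)"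
    using K by (auto simp: zero_ext_def fun_eq_iff indicator_def)
  ultimately have "integrable \<mu> (\<lambda>x. indicator K x *\<^sub>R g x)"
    using integrable_ext[of "\<lambda>x. indicator K x *\<^sub>R g x"] by simp
  then have "integrable \<mu> (\<lambda>x. \<eta> x *\<^sub>R (indicator K x *\<^sub>R g x))"
    by (rule C1c_scaleR_integrable(2)[OF \<eta>])
  moreover have "(\<lambda>x. \<eta> x *\<^sub>R (indicator K x *\<^sub>R g x)) = (\<lambda>x. \<eta> x *\<^sub>R g x)"
    using K(3) by (auto simp: fun_eq_iff indicator_def)
  ultimately show ?thesis by simp
qed

lemma weak_gradient_unique:
  assumes "has_weak_gradient \<Omega> u g" "has_weak_gradient \<Omega> u k"
  shows "AE x in \<mu>. g x = k x"
proof -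
  have l: "locally_integrable \<Omega> g" "locally_integrable \<Omega> k"
    using assms by (auto simp: has_weak_gradient_def)
  have "AE x in \<mu>. g x - k x = 0"
  proof (rule locally_integrable_zero)
    show "locally_integrable \<Omega> (\<lambda>x. g x - k x)"
      using l unfolding locally_integrable_def by (auto intro!: set_integral_diff)
    fix \<eta> \<eta>' assume \<eta>: "test \<eta> \<eta>'"
    have "(LINT x|\<mu>. \<eta> x *\<^sub>R (g x - k x)) = (LINT x|\<mu>. \<eta> x *\<^sub>R g x) - (LINT x|\<mu>. \<eta> x *\<^sub>R k x)"
      using Bochner_Integration.integral_diff[OF C1c_scaleR_locally_integrable[OF \<eta> l(1)] C1c_scaleR_locally_integrable[OF \<eta> l(2)]]
      by (simp add: scaleR_diff_right)
    also have "\<dots> = 0"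
    proof -
      have "(LINT x|\<mu>. u x *\<^sub>R \<eta>' x) = - (LINT x|\<mu>. \<eta> x *\<^sub>R g x)"
        "(LINT x|\<mu>. u x *\<^sub>R \<eta>' x) = - (LINT x|\<mu>. \<eta> x *\<^sub>R k x)"
        using assms \<eta> unfolding has_weak_gradient_def by blast+
      then show ?thesis by simp
    qed
    finally show "(LINT x|\<mu>. \<eta> x *\<^sub>R (g x - k x)) = 0" .
  qed
  then show ?thesis by simp
qed

section \<open>Algebra of Sobolev pairs and the C^1 chain rule\<close>

lemma sobI:
  assumes "u \<in> Lp p \<Omega>" "g \<in> Lp p \<Omega>"
    "\<And>\<eta> \<eta>'. test \<eta> \<eta>' \<Longrightarrow>
      (LINT x|\<mu>. u x *\<^sub>R \<eta>' x) = - (LINT x|\<mu>. \<eta> x *\<^sub>R g x)"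
  shows "sob u g"
  using assms Lp_ext(4)[OF assms(1)] Lp_ext(4)[OF assms(2)]
  by (auto simp: sob_def has_weak_gradient_def intro!: locally_integrable_\<Omega>)

lemma sobD:
  assumes "sob u g"
  shows "u \<in> Lp p \<Omega>" "g \<in> Lp p \<Omega>" "has_weak_gradient \<Omega> u g"
    "integrable \<mu> u" "integrable \<mu> g"
    "u \<in> borel_measurable \<mu>" "g \<in> borel_measurable \<mu>"
  using assms Lp_ext(4)[of u] Lp_ext(4)[of g] Lp_measurable by (auto simp: sob_def)

lemma sob_parts:
  assumes "sob u g" "test \<eta> \<eta>'"
  shows "(LINT x|\<mu>. u x *\<^sub>R \<eta>' x) = - (LINT x|\<mu>. \<eta> x *\<^sub>R g x)"
  using assms by (auto simp: sob_def has_weak_gradient_def)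

lemma W1p_iff: "u \<in> W1p p \<Omega> \<longleftrightarrow> (\<exists>g. sob u g)"
  by (auto simp: W1p_def sob_def)

lemma sob_unique: "sob u g \<Longrightarrow> sob u k \<Longrightarrow> AE x in \<mu>. g x = k x"
  using weak_gradient_unique by (auto simp: sob_def)

lemma sob_weak_grad:
  assumes "sob u g"
  shows "AE x in \<mu>. weak_grad \<Omega> u x = g x"
proof -
  have "has_weak_gradient \<Omega> u (weak_grad \<Omega> u)"
    unfolding weak_grad_def by (rule someI[where P="has_weak_gradient \<Omega> u"]) (rule sobD(3)[OF assms])
  then show ?thesis using weak_gradient_unique sobD(3)[OF assms] by blast
qed

lemma sob_AE:
  assumes s: "sob u g" and uv: "AE x in \<mu>. u x = v x" and gk: "AE x in \<mu>. g x = k x"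
  shows "sob v k"
proof (rule sobI)
  show v: "v \<in> Lp p \<Omega>" by (rule Lp_AE[OF sobD(1)[OF s] uv])
  show k: "k \<in> Lp p \<Omega>" by (rule Lp_AE[OF sobD(2)[OF s] gk])
  fix \<eta> \<eta>' assume \<eta>: "test \<eta> \<eta>'"
  note [measurable] = sobD(6,7)[OF s] Lp_measurable[OF v] Lp_measurable[OF k] C1c_measurable_\<Omega>[OF \<eta>]
  have "(LINT x|\<mu>. v x *\<^sub>R \<eta>' x) = (LINT x|\<mu>. u x *\<^sub>R \<eta>' x)"
    using uv by (intro integral_cong_AE) (auto elim!: eventually_mono)
  also have "\<dots> = - (LINT x|\<mu>. \<eta> x *\<^sub>R g x)" by (rule sob_parts[OF s \<eta>])
  also have "(LINT x|\<mu>. \<eta> x *\<^sub>R g x) = (LINT x|\<mu>. \<eta> x *\<^sub>R k x)"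
    using gk by (intro integral_cong_AE) (auto elim!: eventually_mono)
  finally show "(LINT x|\<mu>. v x *\<^sub>R \<eta>' x) = - (LINT x|\<mu>. \<eta> x *\<^sub>R k x)" .
qed

lemma sob_weak_grad_sob: "sob u g \<Longrightarrow> sob u (weak_grad \<Omega> u)"
  using sob_AE[of u g u "weak_grad \<Omega> u"] sob_weak_grad[of u g] by (auto simp: eq_commute)

lemma sob_add:
  assumes "sob u g" "sob v k"
  shows "sob (\<lambda>x. u x + v x) (\<lambda>x. g x + k x)"
proof (rule sobI)
  fix \<eta> \<eta>' assume \<eta>: "test \<eta> \<eta>'"
  note i = C1c_scaleR_integrable[OF \<eta>]
  show "(LINT x|\<mu>. (u x + v x) *\<^sub>R \<eta>' x) = - (LINT x|\<mu>. \<eta> x *\<^sub>R (g x + k x))"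
    using i(1)[OF sobD(4)[OF assms(1)]] i(1)[OF sobD(4)[OF assms(2)]]
      i(2)[OF sobD(5)[OF assms(1)]] i(2)[OF sobD(5)[OF assms(2)]]
      sob_parts[OF assms(1) \<eta>] sob_parts[OF assms(2) \<eta>]
    by (simp add: scaleR_add_left scaleR_add_right)
qed (intro Lp_add sobD[OF assms(1)] sobD[OF assms(2)])+

lemma sob_cmult:
  assumes "sob u g"
  shows "sob (\<lambda>x. c * u x) (\<lambda>x. c *\<^sub>R g x)"
proof (rule sobI)
  fix \<eta> \<eta>' assume \<eta>: "test \<eta> \<eta>'"
  have "(LINT x|\<mu>. (c * u x) *\<^sub>R \<eta>' x) = c *\<^sub>R (LINT x|\<mu>. u x *\<^sub>R \<eta>' x)"
    by (subst integral_scaleR_right[symmetric]) (rule Bochner_Integration.integral_cong; simp)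
  also have "\<dots> = - (c *\<^sub>R (LINT x|\<mu>. \<eta> x *\<^sub>R g x))"
    by (simp add: sob_parts[OF assms \<eta>])
  also have "c *\<^sub>R (LINT x|\<mu>. \<eta> x *\<^sub>R g x) = (LINT x|\<mu>. \<eta> x *\<^sub>R (c *\<^sub>R g x))"
    by (subst integral_scaleR_right[symmetric]) (rule Bochner_Integration.integral_cong; simp)
  finally show "(LINT x|\<mu>. (c * u x) *\<^sub>R \<eta>' x) = - (LINT x|\<mu>. \<eta> x *\<^sub>R (c *\<^sub>R g x))" .
next
  show "(\<lambda>x. c * u x) \<in> Lp p \<Omega>" using Lp_cmult[OF sobD(1)[OF assms], of c] by simp
qed (intro Lp_cmult sobD[OF assms])

lemma sob_uminus: "sob u g \<Longrightarrow> sob (\<lambda>x. - u x) (\<lambda>x. - g x)"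
  using sob_cmult[of u g "-1"] by simp

lemma sob_diff: "sob u g \<Longrightarrow> sob v k \<Longrightarrow> sob (\<lambda>x. u x - v x) (\<lambda>x. g x - k x)"
  using sob_add[of u g "\<lambda>x. - v x" "\<lambda>x. - k x"] sob_uminus[of v k] by simp

lemma continuous_Lp:
  fixes f :: "'a \<Rightarrow> 'b::euclidean_space"
  assumes "continuous_on UNIV f"
  shows "f \<in> Lp p \<Omega>"
proof -
  have "compact (f ` closure \<Omega>)"
    using assms bounded_\<Omega> by (intro compact_continuous_image) (auto intro: continuous_on_subset)
  then obtain C where "\<And>x. x \<in> closure \<Omega> \<Longrightarrow> norm (f x) \<le> C"
    using compact_imp_bounded bounded_iff by (metis imageI)
  then have "\<And>x. x \<in> \<Omega> \<Longrightarrow> norm (f x) \<le> C" using closure_subset by blast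
  then show ?thesis
    using Lp_bounded[OF measurable_\<Omega>[OF borel_measurable_continuous_onI[OF assms]]] by blast
qed

lemma sob_C1:
  assumes f: "\<And>x. GDERIV f x :> f' x" "continuous_on UNIV f'"
  shows "sob f f'"
proof (rule sobI)
  fix \<eta> \<eta>' assume \<eta>: "test \<eta> \<eta>'"
  obtain K where K: "K \<subseteq> \<Omega>" "\<And>x. x \<notin> K \<Longrightarrow> \<eta> x = 0" "\<And>x. x \<notin> K \<Longrightarrow> \<eta>' x = 0"
    using C1c_D[OF \<eta>] by metis
  have 1: "(LINT x|\<mu>. f x *\<^sub>R \<eta>' x) = (LINT x|lebesgue. f x *\<^sub>R \<eta>' x)"
    "(LINT x|\<mu>. \<eta> x *\<^sub>R f' x) = (LINT x|lebesgue. \<eta> x *\<^sub>R f' x)"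
    using K by (intro integral_lebesgue_on_eq; auto)+
  show "(LINT x|\<mu>. f x *\<^sub>R \<eta>' x) = - (LINT x|\<mu>. \<eta> x *\<^sub>R f' x)"
    unfolding 1 by (rule C1_integration_by_parts[OF \<eta> f])
qed (intro continuous_Lp f(2) GDERIV_continuous_on[OF f(1)])+

lemma sob_const: "sob (\<lambda>x. c) (\<lambda>x. 0)"
  by (rule sob_C1) (simp_all add: GDERIV_const)

lemma sob_affine: "sob (\<lambda>x. \<xi> \<bullet> (x - z)) (\<lambda>x. \<xi>)"
proof (rule sob_C1)
  show "GDERIV (\<lambda>x. \<xi> \<bullet> (x - z)) x :> \<xi>" for x
    unfolding gderiv_def by (auto intro!: derivative_eq_intros simp: inner_commute)
qed simp

lemma lipschitz_le:
  assumes "\<And>t. DERIV H t :> H' t" "\<And>t::real. \<bar>H' t\<bar> \<le> C"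
  shows "\<bar>H a - H b\<bar> \<le> C * \<bar>a - b\<bar>"
  using GDERIV_bound[of H H' C a b] assms by simp

text \<open>The classical chain rule holds for the mollifications f_n of the extended u, and
  integration by parts against \<eta> applies to H o f_n. In the limit the left side converges
  because H is Lipschitz. On the right the mollified gradients converge in L^1, and the factors
  H'(f_n) are bounded and converge almost everywhere along a subsequence.\<close>

lemma sob_chain_rule:
  assumes s: "sob u g" and H: "\<And>t. DERIV H t :> H' t" "continuous_on UNIV H'" "\<And>t. \<bar>H' t\<bar> \<le> C"
  shows "sob (\<lambda>x. H (u x)) (\<lambda>x. H' (u x) *\<^sub>R g x)"
proof (rule sobI)
  have Hc: "continuous_on UNIV H"
    using H(1) by (meson DERIV_isCont continuous_at_imp_continuous_on)
  have [measurable]: "H \<in> borel_measurable borel" "H' \<in> borel_measurable borel"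
    using Hc H(2) by (auto intro: borel_measurable_continuous_onI)
  note [measurable] = sobD(6,7)[OF s]
  have C: "C \<ge> 0" using H(3)[of 0] by linarith
  have Hb: "\<bar>H t\<bar> \<le> \<bar>H 0\<bar> + C * \<bar>t\<bar>" for t
    using lipschitz_le[of H H' C t 0] H by fastforce
  show "(\<lambda>x. H (u x)) \<in> Lp p \<Omega>"
  proof (rule Lp_dominated)
    show "(\<lambda>x. H (u x)) \<in> borel_measurable \<mu>" by measurable
    have "(\<lambda>x. \<bar>u x\<bar>) \<in> Lp p \<Omega>" using sobD(1)[OF s] by (auto simp: Lp_def)
    then have "(\<lambda>x. C *\<^sub>R \<bar>u x\<bar>) \<in> Lp p \<Omega>" by (rule Lp_cmult)
    then show "(\<lambda>x. \<bar>H 0\<bar> + C *\<^sub>R \<bar>u x\<bar>) \<in> Lp p \<Omega>"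
      by (rule Lp_add[OF continuous_Lp[OF continuous_on_const]])
    show "norm (H (u x)) \<le> norm (\<bar>H 0\<bar> + C *\<^sub>R \<bar>u x\<bar>)" for x
      using Hb[of "u x"] C by simp
  qed
  show "(\<lambda>x. H' (u x) *\<^sub>R g x) \<in> Lp p \<Omega>"
  proof (rule Lp_dominated)
    show "(\<lambda>x. H' (u x) *\<^sub>R g x) \<in> borel_measurable \<mu>" by measurable
    show "(\<lambda>x. C *\<^sub>R g x) \<in> Lp p \<Omega>" by (rule Lp_cmult[OF sobD(2)[OF s]])
    show "norm (H' (u x) *\<^sub>R g x) \<le> norm (C *\<^sub>R g x)" for x
      using H(3)[of "u x"] C by (auto intro!: mult_right_mono)
  qed
  fix \<eta> \<eta>' assume \<eta>: "test \<eta> \<eta>'"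
  obtain K where K: "compact K" "K \<subseteq> \<Omega>" "\<And>x. x \<notin> K \<Longrightarrow> \<eta> x = 0" "\<And>x. x \<notin> K \<Longrightarrow> \<eta>' x = 0"
    using C1c_D[OF \<eta>] by metis
  obtain B where B: "B > 0" "\<And>x. \<bar>\<eta> x\<bar> \<le> B" "\<And>x. norm (\<eta>' x) \<le> B"
    using C1c_bounded[OF \<eta>] by metis
  obtain r where r: "r > 0" "(\<Union>x\<in>K. cball x r) \<subseteq> \<Omega>"
    using compact_subset_open_imp_cball_epsilon_subset[OF K(1) open_\<Omega> K(2)] by metis
  obtain \<epsilon> \<rho> and \<rho>' :: "nat \<Rightarrow> 'a \<Rightarrow> 'a" where \<rho>: "\<And>n. mollifier (\<epsilon> n) (\<rho> n) (\<rho>' n)" and \<epsilon>: "\<epsilon> \<longlonglongrightarrow> 0"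
    using mollifier_sequence by metis
  let ?U = "zero_ext u" and ?G = "zero_ext g"
  have Ui: "integrable lebesgue ?U" and Gi: "integrable lebesgue ?G"
    using sobD[OF s] by (auto simp: integrable_ext)
  note [measurable] = borel_measurable_integrable[OF Ui] borel_measurable_integrable[OF Gi]
  obtain R1 where R1: "\<And>(f :: 'a \<Rightarrow> real) x. R1 < norm x \<Longrightarrow> zero_ext f x = 0" by (rule zero_ext_radius) blast
  obtain R2 where R2: "\<And>(f :: 'a \<Rightarrow> 'a) x. R2 < norm x \<Longrightarrow> zero_ext f x = 0" by (rule zero_ext_radius) blast
  define f where "f n = conv (\<rho> n) ?U" for n
  define f' where "f' n x = (LINT y|lebesgue. ?U y *\<^sub>R \<rho>' n (x - y))" for n x
  define k where "k n = conv (\<rho> n) ?G" for n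
  have fd: "GDERIV (f n) x :> f' n x" for n x
    unfolding f_def f'_def by (rule conv_GDERIV[OF mollifier_test[OF \<rho>] Ui])
  have fc': "continuous_on UNIV (f' n)" for n
    unfolding f'_def by (rule conv_gradient_continuous[OF mollifier_test[OF \<rho>] Ui])
  have fc: "continuous_on UNIV (f n)" for n by (rule GDERIV_continuous_on[OF fd])
  have kc: "continuous_on UNIV (k n)" for n unfolding k_def by (rule conv_continuous[OF mollifier_test[OF \<rho>] Gi])
  have [measurable]: "f n \<in> borel_measurable lebesgue" "k n \<in> borel_measurable lebesgue"
    "\<eta> \<in> borel_measurable lebesgue" "\<eta>' \<in> borel_measurable lebesgue" for n
    by (rule continuous_measurable_lebesgue, rule fc kc C1c_continuous[OF \<eta>])+
  have fint: "integrable lebesgue (f n)" for n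
    by (rule integrable_continuous_compact_support(2)[OF fc, of "cball 0 (R1 + \<epsilon> n)"])
      (auto simp: f_def intro!: conv_support[OF \<rho> R1])
  have kint: "integrable lebesgue (k n)" for n
    by (rule integrable_continuous_compact_support(2)[OF kc, of "cball 0 (R2 + \<epsilon> n)"])
      (auto simp: k_def intro!: conv_support[OF \<rho> R2])
  have fL: "(\<lambda>n. LINT x|lebesgue. norm (f n x - ?U x)) \<longlonglongrightarrow> 0"
    using mollify_Lp_tendsto[of 1 ?U R1, OF _ _ R1 _ \<rho> \<epsilon>] Ui by (simp add: f_def)
  have kL: "(\<lambda>n. LINT x|lebesgue. norm (k n x - ?G x) powr 1) \<longlonglongrightarrow> 0"
    using mollify_Lp_tendsto[of 1 ?G R2, OF _ _ R2 _ \<rho> \<epsilon>] Gi by (simp add: k_def)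
  \<comment> \<open>H' is only continuous and bounded, so L^1 convergence of f n does not control H'
    (f n); a subsequence converging almost everywhere does.\<close>
  obtain \<sigma> where \<sigma>: "strict_mono \<sigma>" "AE x in lebesgue. (\<lambda>n. f (\<sigma> n) x - ?U x) \<longlonglongrightarrow> 0"
    using tendsto_L1_AE_subseq[of lebesgue "\<lambda>n x. f n x - ?U x"] fL fint Ui by auto
  have parts: "(LINT x|lebesgue. H (f n x) *\<^sub>R \<eta>' x) = - (LINT x|lebesgue. \<eta> x *\<^sub>R (H' (f n x) *\<^sub>R f' n x))"
    and pint: "integrable lebesgue (\<lambda>x. H (f n x) *\<^sub>R \<eta>' x)" for n
  proof -
    have d: "GDERIV (\<lambda>x. H (f n x)) x :> H' (f n x) *\<^sub>R f' n x" for x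
      by (rule GDERIV_DERIV_compose[OF fd H(1)])
    have c: "continuous_on UNIV (\<lambda>x. H' (f n x) *\<^sub>R f' n x)"
      by (intro continuous_intros fc' continuous_on_compose2[OF H(2) fc]) auto
    show "(LINT x|lebesgue. H (f n x) *\<^sub>R \<eta>' x) = - (LINT x|lebesgue. \<eta> x *\<^sub>R (H' (f n x) *\<^sub>R f' n x))"
      "integrable lebesgue (\<lambda>x. H (f n x) *\<^sub>R \<eta>' x)"
      by (rule C1_integration_by_parts[OF \<eta> d c])+
  qed
  have "\<forall>\<^sub>F n in sequentially. \<epsilon> n < r" using order_tendstoD(2)[OF \<epsilon> r(1)] .
  then have "\<forall>\<^sub>F n in sequentially. (LINT x|lebesgue. \<eta> x *\<^sub>R (H' (f n x) *\<^sub>R f' n x)) = (LINT x|lebesgue. (\<eta> x * H' (f n x)) *\<^sub>R k n x)"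
  proof (rule eventually_mono)
    fix n assume n: "\<epsilon> n < r"
    show "(LINT x|lebesgue. \<eta> x *\<^sub>R (H' (f n x) *\<^sub>R f' n x)) = (LINT x|lebesgue. (\<eta> x * H' (f n x)) *\<^sub>R k n x)"
    proof (rule Bochner_Integration.integral_cong[OF refl])
      fix x
      show "\<eta> x *\<^sub>R (H' (f n x) *\<^sub>R f' n x) = (\<eta> x * H' (f n x)) *\<^sub>R k n x"
      \<comment> \<open>Once \<epsilon> n < r, the ball around each point of K lies in \<Omega> and
        the gradient of the mollification is the mollified \<open>g\<close> there; off K the factor
        \<eta> is 0. Near the boundary of \<Omega>, where the extension by zero may jump, nothing is
        claimed.\<close>
      proof (cases "x \<in> K")
        case True
        then have "cball x (\<epsilon> n) \<subseteq> \<Omega>" using r n by force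
        then show ?thesis
          unfolding f'_def k_def by (simp add: conv_weak_gradient[OF sobD(3)[OF s] \<rho>])
      qed (simp add: K)
    qed
  qed
  then have eq: "\<forall>\<^sub>F n in sequentially. (LINT x|lebesgue. (\<eta> x * H' (f n x)) *\<^sub>R k n x) = - (LINT x|lebesgue. H (f n x) *\<^sub>R \<eta>' x)"
    by (rule eventually_mono) (simp add: parts)
  have HUi: "integrable lebesgue (\<lambda>x. H (?U x) *\<^sub>R \<eta>' x)"
  proof (rule Bochner_Integration.integrable_bound)
    show "integrable lebesgue (\<lambda>x. \<bar>H 0\<bar> * norm (\<eta>' x) + C * B * \<bar>?U x\<bar>)"
      using C1c_integrable[OF \<eta>] Ui by simp
    show "AE x in lebesgue. norm (H (?U x) *\<^sub>R \<eta>' x) \<le> norm (\<bar>H 0\<bar> * norm (\<eta>' x) + C * B * \<bar>?U x\<bar>)"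
    proof (rule AE_I2)
      fix x
      have "norm (H (?U x) *\<^sub>R \<eta>' x) \<le> (\<bar>H 0\<bar> + C * \<bar>?U x\<bar>) * norm (\<eta>' x)"
        using Hb[of "?U x"] by (simp add: mult_right_mono)
      also have "\<dots> \<le> \<bar>H 0\<bar> * norm (\<eta>' x) + C * \<bar>?U x\<bar> * B"
        using B(3)[of x] C by (simp add: distrib_right mult_left_mono)
      finally show "norm (H (?U x) *\<^sub>R \<eta>' x) \<le> norm (\<bar>H 0\<bar> * norm (\<eta>' x) + C * B * \<bar>?U x\<bar>)"
        using C B(1) by (simp add: mult_ac)
    qed
  qed measurable
  have L: "(\<lambda>n. LINT x|lebesgue. H (f n x) *\<^sub>R \<eta>' x) \<longlonglongrightarrow> (LINT x|lebesgue. H (?U x) *\<^sub>R \<eta>' x)"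
  proof (rule tendsto_integral_L1[OF pint HUi], rule Lim_null_comparison)
    show "(\<lambda>n. C * B * (LINT x|lebesgue. norm (f n x - ?U x))) \<longlonglongrightarrow> 0"
      using tendsto_mult_left[OF fL, of "C * B"] by simp
    show "\<forall>\<^sub>F n in sequentially. norm (LINT x|lebesgue. norm (H (f n x) *\<^sub>R \<eta>' x - H (?U x) *\<^sub>R \<eta>' x)) \<le> C * B * (LINT x|lebesgue. norm (f n x - ?U x))"
    proof (intro always_eventually allI)
      fix n
      have "(LINT x|lebesgue. norm (H (f n x) *\<^sub>R \<eta>' x - H (?U x) *\<^sub>R \<eta>' x)) \<le> (LINT x|lebesgue. C * B * norm (f n x - ?U x))"
      proof (rule integral_mono)
        show "integrable lebesgue (\<lambda>x. norm (H (f n x) *\<^sub>R \<eta>' x - H (?U x) *\<^sub>R \<eta>' x))"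
          using pint[of n] HUi by simp
        show "integrable lebesgue (\<lambda>x. C * B * norm (f n x - ?U x))" using fint[of n] Ui by simp
        fix x
        have "norm (H (f n x) *\<^sub>R \<eta>' x - H (?U x) *\<^sub>R \<eta>' x) = \<bar>H (f n x) - H (?U x)\<bar> * norm (\<eta>' x)"
          by (simp add: scaleR_diff_left[symmetric])
        also have "\<dots> \<le> (C * \<bar>f n x - ?U x\<bar>) * B"
          using lipschitz_le[of H H' C "f n x" "?U x"] H B(3)[of x] C by (intro mult_mono) auto
        finally show "norm (H (f n x) *\<^sub>R \<eta>' x - H (?U x) *\<^sub>R \<eta>' x) \<le> C * B * norm (f n x - ?U x)"
          by (simp add: mult_ac)
      qed
      then show "norm (LINT x|lebesgue. norm (H (f n x) *\<^sub>R \<eta>' x - H (?U x) *\<^sub>R \<eta>' x)) \<le> C * B * (LINT x|lebesgue. norm (f n x - ?U x))"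
        by simp
    qed
  qed
  have ab: "\<bar>\<eta> x * H' t\<bar> \<le> B * C" for x t
    using B(2)[of x] H(3)[of t] B(1) unfolding abs_mult by (intro mult_mono) auto
  have HGi: "integrable lebesgue (\<lambda>x. (\<eta> x * H' (?U x)) *\<^sub>R ?G x)"
    by (rule Bochner_Integration.integrable_bound[OF integrable_scaleR_right[OF Gi, of "B * C"]])
      (use ab B(1) C in \<open>auto intro!: mult_right_mono\<close>)
  have Hki: "integrable lebesgue (\<lambda>x. (\<eta> x * H' (f n x)) *\<^sub>R k n x)" for n
    by (rule Bochner_Integration.integrable_bound[OF integrable_scaleR_right[OF kint[of n], of "B * C"]])
      (use ab B(1) C in \<open>auto intro!: mult_right_mono\<close>)
  have "(\<lambda>n. LINT x|lebesgue. norm ((\<eta> x * H' (f (\<sigma> n) x)) *\<^sub>R k (\<sigma> n) x - (\<eta> x * H' (?U x)) *\<^sub>R ?G x) powr 1) \<longlonglongrightarrow> 0"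
  proof (rule Lp_bounded_mult_tendsto[where C="B * C"])
    show "AE x in lebesgue. ?G x \<noteq> 0 \<longrightarrow> (\<lambda>n. \<eta> x * H' (f (\<sigma> n) x)) \<longlonglongrightarrow> \<eta> x * H' (?U x)"
      using \<sigma>(2)
    proof (rule eventually_mono, intro impI tendsto_mult tendsto_const)
      fix x assume "(\<lambda>n. f (\<sigma> n) x - ?U x) \<longlonglongrightarrow> 0"
      then have "(\<lambda>n. f (\<sigma> n) x) \<longlonglongrightarrow> ?U x" by (simp add: LIM_zero_iff)
      then show "(\<lambda>n. H' (f (\<sigma> n) x)) \<longlonglongrightarrow> H' (?U x)"
        by (rule isCont_tendsto_compose[rotated]) (use H(2) in \<open>simp add: continuous_on_eq_continuous_at\<close>)
    qed
    show "(\<lambda>n. LINT x|lebesgue. norm (k (\<sigma> n) x - ?G x) powr 1) \<longlonglongrightarrow> 0"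
      using LIMSEQ_subseq_LIMSEQ[OF kL \<sigma>(1)] by (simp add: comp_def)
  qed (use ab kint Gi in auto)
  then have "(\<lambda>n. LINT x|lebesgue. (\<eta> x * H' (f (\<sigma> n) x)) *\<^sub>R k (\<sigma> n) x) \<longlonglongrightarrow> (LINT x|lebesgue. (\<eta> x * H' (?U x)) *\<^sub>R ?G x)"
    by (intro tendsto_integral_L1 Hki HGi) simp
  moreover have "(\<lambda>n. LINT x|lebesgue. (\<eta> x * H' (f (\<sigma> n) x)) *\<^sub>R k (\<sigma> n) x) \<longlonglongrightarrow> - (LINT x|lebesgue. H (?U x) *\<^sub>R \<eta>' x)"
  proof -
    have "(\<lambda>n. LINT x|lebesgue. (\<eta> x * H' (f n x)) *\<^sub>R k n x) \<longlonglongrightarrow> - (LINT x|lebesgue. H (?U x) *\<^sub>R \<eta>' x)"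
      using tendsto_minus[OF L] eq by (subst tendsto_cong[OF eq])
    from LIMSEQ_subseq_LIMSEQ[OF this \<sigma>(1)] show ?thesis by (simp add: comp_def)
  qed
  ultimately have fin: "(LINT x|lebesgue. (\<eta> x * H' (?U x)) *\<^sub>R ?G x) = - (LINT x|lebesgue. H (?U x) *\<^sub>R \<eta>' x)"
    by (rule LIMSEQ_unique)
  have "(LINT x|\<mu>. H (u x) *\<^sub>R \<eta>' x) = (LINT x|lebesgue. H (?U x) *\<^sub>R \<eta>' x)"
    by (rule integral_lebesgue_on_eq) (use K in \<open>auto simp: zero_ext_def\<close>)
  moreover have "(LINT x|\<mu>. \<eta> x *\<^sub>R (H' (u x) *\<^sub>R g x)) = (LINT x|lebesgue. (\<eta> x * H' (?U x)) *\<^sub>R ?G x)"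
    by (rule integral_lebesgue_on_eq) (use K in \<open>auto simp: zero_ext_def\<close>)
  ultimately show "(LINT x|\<mu>. H (u x) *\<^sub>R \<eta>' x) = - (LINT x|\<mu>. \<eta> x *\<^sub>R (H' (u x) *\<^sub>R g x))"
    using fin by simp
qed

section \<open>Positive parts, maxima and minima\<close>

text \<open>The positive part is approximated by the C^1 functions H d, to which the chain rule
  applies. Their derivatives vanish at 0 for every d, so the limit gradient is 0 on {u = 0} without
  prior knowledge of that set.\<close>

lemma sob_pos:
  assumes s: "sob u g"
  shows "sob (\<lambda>x. max 0 (u x)) (\<lambda>x. if 0 < u x then g x else 0)"
proof (rule sobI)
  note [measurable] = sobD(6,7)[OF s]
  show "(\<lambda>x. max 0 (u x)) \<in> Lp p \<Omega>"
    by (rule Lp_dominated[OF _ sobD(1)[OF s]]) auto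
  show "(\<lambda>x. if 0 < u x then g x else 0) \<in> Lp p \<Omega>"
    by (rule Lp_dominated[OF _ sobD(2)[OF s]]) auto
  fix \<eta> \<eta>' assume \<eta>: "test \<eta> \<eta>'"
  note [measurable] = C1c_measurable_\<Omega>[OF \<eta>]
  \<comment> \<open>For d > 0 this is 0 for t <= 0, t^2 / (2 d) up to t = d, and t - d / 2 beyond:
    the positive part with its corner rounded on [0, d].\<close>
  define H where "H d t = ((max 0 t)\<^sup>2 - (max 0 (t - d))\<^sup>2) / (2 * d)" for d t :: real
  define H' where "H' d t = (max 0 t - max 0 (t - d)) / d" for d t :: real
  have dH: "DERIV (H d) t :> H' d t" if "d > 0" for d t
  proof -
    have "DERIV (\<lambda>t. t - d) t :> 1" by (auto intro!: derivative_eq_intros)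
    from DERIV_chain2[OF DERIV_max_0_sq this]
    have "DERIV (\<lambda>t. (max 0 (t - d))\<^sup>2) t :> 2 * max 0 (t - d)" by simp
    from DERIV_cdivide[OF DERIV_diff[OF DERIV_max_0_sq this], of "2 * d"] show ?thesis
      unfolding H_def H'_def by (rule DERIV_cong) (use that in \<open>simp add: field_simps\<close>)
  qed
  have cH': "continuous_on UNIV (H' d)" if "d > 0" for d
    unfolding H'_def using that by (intro continuous_intros) auto
  have bH': "\<bar>H' d t\<bar> \<le> 1" if "d > 0" for d t
    unfolding H'_def using that by (auto simp: max_def)
  define d where "d n = 1 / real (Suc n)" for n
  have d: "d n > 0" for n by (simp add: d_def)
  have d0: "d \<longlonglongrightarrow> 0"
    using LIMSEQ_inverse_real_of_nat by (simp add: d_def[abs_def] inverse_eq_divide)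
  have bH: "\<bar>H (d n) t\<bar> \<le> \<bar>t\<bar>" for n t
    using lipschitz_le[OF dH[OF d] bH'[OF d], of n t 0] d[of n] by (simp add: H_def)
  have small: "\<forall>\<^sub>F n in sequentially. d n < t" if "0 < t" for t
    by (rule order_tendstoD(2)[OF d0 that])
  have limH: "(\<lambda>n. H (d n) t) \<longlonglongrightarrow> max 0 t" for t
  proof (cases "0 < t")
    case True
    have "(\<lambda>n. t - d n / 2) \<longlonglongrightarrow> t - 0 / 2" by (intro tendsto_intros d0) auto
    moreover have "\<forall>\<^sub>F n in sequentially. t - d n / 2 = H (d n) t"
      using small[OF True]
    proof (rule eventually_mono)
      fix n assume "d n < t"
      then have "H (d n) t = (t\<^sup>2 - (t - d n)\<^sup>2) / (2 * d n)" using True by (simp add: H_def)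
      also have "\<dots> = t - d n / 2" using d[of n] by (simp add: power2_eq_square field_simps)
      finally show "t - d n / 2 = H (d n) t" by simp
    qed
    ultimately show ?thesis using True by (simp add: Lim_transform_eventually)
  next
    case False
    then have "H (d n) t = max 0 t" for n using d[of n] by (simp add: H_def)
    then show ?thesis by simp
  qed
  have limH': "(\<lambda>n. H' (d n) t) \<longlonglongrightarrow> (if 0 < t then 1 else 0)" for t
  proof (cases "0 < t")
    case True
    have "\<forall>\<^sub>F n in sequentially. H' (d n) t = 1"
      using small[OF True]
    proof (rule eventually_mono)
      fix n assume "d n < t"
      then show "H' (d n) t = 1" using True d[of n] by (simp add: H'_def)
    qed
    then show ?thesis using True by (simp add: tendsto_eventually)
  next
    case False
    then have "H' (d n) t = 0" for n using d[of n] by (simp add: H'_def)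
    then show ?thesis using False by simp
  qed
  have sn: "sob (\<lambda>x. H (d n) (u x)) (\<lambda>x. H' (d n) (u x) *\<^sub>R g x)" for n
    by (rule sob_chain_rule[OF s dH[OF d] cH'[OF d] bH'[OF d]])
  note i = C1c_scaleR_integrable[OF \<eta>]
  have L: "(\<lambda>n. LINT x|\<mu>. H (d n) (u x) *\<^sub>R \<eta>' x) \<longlonglongrightarrow> (LINT x|\<mu>. max 0 (u x) *\<^sub>R \<eta>' x)"
  proof (rule integral_dominated_convergence[where w="\<lambda>x. norm (u x *\<^sub>R \<eta>' x)"])
    show "integrable \<mu> (\<lambda>x. norm (u x *\<^sub>R \<eta>' x))"
      by (intro integrable_norm i(1) sobD(4)[OF s])
    show "(\<lambda>x. H (d n) (u x) *\<^sub>R \<eta>' x) \<in> borel_measurable \<mu>" for n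
      using borel_measurable_integrable[OF i(1)[OF sobD(4)[OF sn[of n]]]] .
    show "AE x in \<mu>. (\<lambda>n. H (d n) (u x) *\<^sub>R \<eta>' x) \<longlonglongrightarrow> max 0 (u x) *\<^sub>R \<eta>' x"
      by (intro AE_I2 tendsto_intros limH)
    show "AE x in \<mu>. norm (H (d n) (u x) *\<^sub>R \<eta>' x) \<le> norm (u x *\<^sub>R \<eta>' x)" for n
      using bH[of n] by (intro AE_I2) (simp add: mult_right_mono)
  qed measurable
  have R: "(\<lambda>n. LINT x|\<mu>. \<eta> x *\<^sub>R (H' (d n) (u x) *\<^sub>R g x)) \<longlonglongrightarrow>
     (LINT x|\<mu>. \<eta> x *\<^sub>R (if 0 < u x then g x else 0))"
  proof (rule integral_dominated_convergence[where w="\<lambda>x. norm (\<eta> x *\<^sub>R g x)"])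
    show "integrable \<mu> (\<lambda>x. norm (\<eta> x *\<^sub>R g x))"
      by (intro integrable_norm i(2) sobD(5)[OF s])
    show "(\<lambda>x. \<eta> x *\<^sub>R (H' (d n) (u x) *\<^sub>R g x)) \<in> borel_measurable \<mu>" for n
      using borel_measurable_integrable[OF i(2)[OF sobD(5)[OF sn[of n]]]] .
    show "AE x in \<mu>. (\<lambda>n. \<eta> x *\<^sub>R (H' (d n) (u x) *\<^sub>R g x)) \<longlonglongrightarrow> \<eta> x *\<^sub>R (if 0 < u x then g x else 0)"
    proof (intro AE_I2)
      fix x
      have "(\<lambda>n. \<eta> x *\<^sub>R (H' (d n) (u x) *\<^sub>R g x)) \<longlonglongrightarrow> \<eta> x *\<^sub>R ((if 0 < u x then 1 else 0) *\<^sub>R g x)"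
        by (intro tendsto_scaleR tendsto_const limH')
      then show "(\<lambda>n. \<eta> x *\<^sub>R (H' (d n) (u x) *\<^sub>R g x)) \<longlonglongrightarrow> \<eta> x *\<^sub>R (if 0 < u x then g x else 0)"
        by (simp split: if_splits)
    qed
    fix n
    have "\<bar>H' (d n) (u x)\<bar> * norm (g x) \<le> norm (g x)" for x
      using mult_right_mono[OF bH'[OF d, of n "u x"] norm_ge_zero[of "g x"]] by simp
    then show "AE x in \<mu>. norm (\<eta> x *\<^sub>R (H' (d n) (u x) *\<^sub>R g x)) \<le> norm (\<eta> x *\<^sub>R g x)"
      by (intro AE_I2) (simp add: abs_mult mult.assoc mult_left_mono)
  qed measurable
  have "(\<lambda>n. - (LINT x|\<mu>. \<eta> x *\<^sub>R (H' (d n) (u x) *\<^sub>R g x))) \<longlonglongrightarrow> (LINT x|\<mu>. max 0 (u x) *\<^sub>R \<eta>' x)"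
    using L unfolding sob_parts[OF sn \<eta>] .
  then show "(LINT x|\<mu>. max 0 (u x) *\<^sub>R \<eta>' x) = - (LINT x|\<mu>. \<eta> x *\<^sub>R (if 0 < u x then g x else 0))"
    by (rule LIMSEQ_unique[OF _ tendsto_minus[OF R]])
qed

text \<open>u is the difference of its positive and negative parts, which gives it a second weak
  gradient that is 0 on {u = 0}. Uniqueness identifies it with g.\<close>

lemma sob_zero_set:
  assumes s: "sob u g"
  shows "AE x in \<mu>. u x = 0 \<longrightarrow> g x = 0"
proof -
  have "sob (\<lambda>x. max 0 (u x) - max 0 (- u x)) (\<lambda>x. (if 0 < u x then g x else 0) - (if 0 < - u x then - g x else 0))"
    by (rule sob_diff[OF sob_pos[OF s] sob_pos[OF sob_uminus[OF s]]])
  moreover have "(\<lambda>x. max 0 (u x) - max 0 (- u x)) = u" by (auto simp: fun_eq_iff max_def)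
  ultimately have "sob u (\<lambda>x. (if 0 < u x then g x else 0) - (if 0 < - u x then - g x else 0))" by simp
  from sob_unique[OF s this] show ?thesis by (rule eventually_mono) auto
qed

text \<open>From max u v = v + (u - v)^+. On {u = v} either gradient could be chosen, as they agree
  there almost everywhere by \<open>sob_zero_set\<close>.\<close>

lemma sob_max:
  assumes "sob u g" "sob v k"
  shows "sob (\<lambda>x. max (u x) (v x)) (\<lambda>x. if v x < u x then g x else k x)"
proof -
  have "sob (\<lambda>x. v x + max 0 (u x - v x)) (\<lambda>x. k x + (if 0 < u x - v x then g x - k x else 0))"
    by (rule sob_add[OF assms(2) sob_pos[OF sob_diff[OF assms]]])
  moreover have "(\<lambda>x. v x + max 0 (u x - v x)) = (\<lambda>x. max (u x) (v x))"
    by (auto simp: fun_eq_iff max_def)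
  moreover have "(\<lambda>x. k x + (if 0 < u x - v x then g x - k x else 0)) = (\<lambda>x. if v x < u x then g x else k x)"
    by (auto simp: fun_eq_iff)
  ultimately show ?thesis by simp
qed

lemma sob_min:
  assumes "sob u g" "sob v k"
  shows "sob (\<lambda>x. min (u x) (v x)) (\<lambda>x. if v x < u x then k x else g x)"
proof -
  have "sob (\<lambda>x. u x - max 0 (u x - v x)) (\<lambda>x. g x - (if 0 < u x - v x then g x - k x else 0))"
    by (rule sob_diff[OF assms(1) sob_pos[OF sob_diff[OF assms]]])
  moreover have "(\<lambda>x. u x - max 0 (u x - v x)) = (\<lambda>x. min (u x) (v x))"
    by (auto simp: fun_eq_iff max_def min_def)
  moreover have "(\<lambda>x. g x - (if 0 < u x - v x then g x - k x else 0)) = (\<lambda>x. if v x < u x then k x else g x)"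
    by (auto simp: fun_eq_iff)
  ultimately show ?thesis by simp
qed

section \<open>Functions with zero boundary values\<close>

text \<open>The p-th power of the L^p norm. It satisfies the triangle inequality only up to the
  factor 2^p, but that suffices for errors that can be made arbitrarily small, and it avoids
  Minkowski's inequality and roots.\<close>

definition pint :: "('a \<Rightarrow> 'b::euclidean_space) \<Rightarrow> real" where
  "pint f = (LINT x|\<mu>. norm (f x) powr p)"

lemma pint_nonneg: "0 \<le> pint f"
  unfolding pint_def by (intro integral_nonneg_AE) auto

lemma pint_add_less:
  assumes "f \<in> Lp p \<Omega>" "g \<in> Lp p \<Omega>" "pint f < e / (2 * 2 powr p)" "pint g < e / (2 * 2 powr p)"
  shows "pint (\<lambda>x. f x + g x) < e"
proof -
  have "pint (\<lambda>x. f x + g x) \<le> 2 powr p * (pint f + pint g)"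
    unfolding pint_def using assms(1,2) by (intro integrable_powr_add p0) (auto simp: Lp_def)
  also have "\<dots> < 2 powr p * (e / (2 * 2 powr p) + e / (2 * 2 powr p))"
    using assms(3,4) by (intro mult_strict_left_mono add_strict_mono) auto
  finally show ?thesis by simp
qed

lemma pint_mono:
  assumes "f \<in> borel_measurable \<mu>" "g \<in> Lp p \<Omega>" "\<And>x. x \<in> \<Omega> \<Longrightarrow> norm (f x) \<le> norm (g x)"
  shows "pint f \<le> pint g"
  unfolding pint_def
proof (rule integral_mono_AE)
  note [measurable] = assms(1)
  have le: "norm (f x) powr p \<le> norm (g x) powr p" if "x \<in> \<Omega>" for x
    using assms(3)[OF that] p0 by (intro powr_mono2) auto
  show "integrable \<mu> (\<lambda>x. norm (f x) powr p)"
    by (rule Bochner_Integration.integrable_bound[OF Lp_powr[OF assms(2)]]) (use le in auto)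
  show "AE x in \<mu>. norm (f x) powr p \<le> norm (g x) powr p" using le by (intro AE_I2) simp
qed (rule Lp_powr[OF assms(2)])

lemma pint_cong_AE:
  assumes "f \<in> borel_measurable \<mu>" "AE x in \<mu>. f x = g x"
  shows "pint f = pint g"
proof -
  have "g \<in> borel_measurable \<mu>"
    using measurable_lebesgue_on_AE[OF _ assms] by simp
  note [measurable] = this assms(1)
  show ?thesis
    unfolding pint_def by (rule integral_cong_AE) (use assms(2) in \<open>auto elim!: eventually_mono\<close>)
qed

lemma pint_uminus: "pint (\<lambda>x. - f x) = pint f"
  by (simp add: pint_def)

lemma W1p_norm_eq:
  assumes "sob w k"
  shows "W1p_norm p \<Omega> w = pint w powr (1 / p) + pint k powr (1 / p)"
proof -
  have "pint (weak_grad \<Omega> w) = pint k"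
    using sob_weak_grad[OF assms] sob_weak_grad_sob[OF assms]
    by (intro pint_cong_AE) (auto dest: sobD(7))
  then show ?thesis by (simp add: W1p_norm_def Lp_norm_def pint_def)
qed

lemma W1p_norm_tendsto_0:
  assumes "\<And>n. sob (w n) (k n)" "(\<lambda>n. pint (w n)) \<longlonglongrightarrow> 0" "(\<lambda>n. pint (k n)) \<longlonglongrightarrow> 0"
  shows "(\<lambda>n. W1p_norm p \<Omega> (w n)) \<longlonglongrightarrow> 0"
proof -
  have "(\<lambda>n. pint (w n) powr (1 / p)) \<longlonglongrightarrow> 0" "(\<lambda>n. pint (k n) powr (1 / p)) \<longlonglongrightarrow> 0"
    using p0 by (auto intro!: tendsto_zero_powrI[where b="1 / p"] assms always_eventually pint_nonneg)
  from tendsto_add[OF this] show ?thesis by (simp add: W1p_norm_eq[OF assms(1)])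
qed

text \<open>Membership in \<open>W1p0\<close> expressed by an explicit gradient and by p-th powers;
  \<open>W1p0_iff\<close> is the translation.\<close>

definition sob0 :: "('a \<Rightarrow> real) \<Rightarrow> ('a \<Rightarrow> 'a) \<Rightarrow> bool" where
  "sob0 u g \<longleftrightarrow> sob u g \<and> (\<forall>e>0. \<exists>\<eta> \<eta>'. test \<eta> \<eta>' \<and>
     pint (\<lambda>x. u x - \<eta> x) < e \<and> pint (\<lambda>x. g x - \<eta>' x) < e)"

lemma C1c_sob: "test \<eta> \<eta>' \<Longrightarrow> sob \<eta> \<eta>'"
  by (rule sob_C1) (auto simp: C1c_with_gradient_def)

lemma W1p0_iff:
  assumes s: "sob u g"
  shows "u \<in> W1p0 p \<Omega> \<longleftrightarrow> sob0 u g"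
proof
  assume u: "u \<in> W1p0 p \<Omega>"
  show "sob0 u g"
    unfolding sob0_def
  proof (intro conjI s allI impI)
    fix e :: real assume e: "e > 0"
    then have "e powr (1 / p) > 0" by simp
    then obtain \<eta> where "\<eta> \<in> C1c \<Omega>" and lt: "W1p_norm p \<Omega> (\<lambda>x. u x - \<eta> x) < e powr (1 / p)"
      using u unfolding W1p0_def by blast
    then obtain \<eta>' where \<eta>: "test \<eta> \<eta>'" by (auto simp: C1c_def)
    have "pint (\<lambda>x. u x - \<eta> x) powr (1 / p) + pint (\<lambda>x. g x - \<eta>' x) powr (1 / p) < e powr (1 / p)"
      using lt W1p_norm_eq[OF sob_diff[OF s C1c_sob[OF \<eta>]]] by simp
    then have "pint (\<lambda>x. u x - \<eta> x) powr (1 / p) < e powr (1 / p)" "pint (\<lambda>x. g x - \<eta>' x) powr (1 / p) < e powr (1 / p)"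
      using powr_ge_zero[of "pint (\<lambda>x. u x - \<eta> x)" "1 / p"] powr_ge_zero[of "pint (\<lambda>x. g x - \<eta>' x)" "1 / p"]
      by linarith+
    then have "pint (\<lambda>x. u x - \<eta> x) < e" "pint (\<lambda>x. g x - \<eta>' x) < e"
      using p0 e by (metis less_eq_real_def linorder_not_less powr_mono2 zero_le_divide_1_iff)+
    then show "\<exists>\<eta> \<eta>'. test \<eta> \<eta>' \<and> pint (\<lambda>x. u x - \<eta> x) < e \<and> pint (\<lambda>x. g x - \<eta>' x) < e"
      using \<eta> by blast
  qed
next
  assume u: "sob0 u g"
  have "\<exists>\<eta>\<in>C1c \<Omega>. W1p_norm p \<Omega> (\<lambda>x. u x - \<eta> x) < e" if e: "e > 0" for e
  proof -
    have "(e / 2) powr p > 0" using e by simp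
    then obtain \<eta> \<eta>' where \<eta>: "test \<eta> \<eta>'"
      and lt: "pint (\<lambda>x. u x - \<eta> x) < (e / 2) powr p" "pint (\<lambda>x. g x - \<eta>' x) < (e / 2) powr p"
      using u unfolding sob0_def by blast
    have lt': "x powr (1 / p) < e / 2" if "x < (e / 2) powr p" "0 \<le> x" for x
    proof -
      have "x powr (1 / p) < ((e / 2) powr p) powr (1 / p)"
        using that p0 by (intro powr_less_mono2) auto
      also have "\<dots> = e / 2" using p0 e by (simp add: powr_powr)
      finally show ?thesis .
    qed
    have "W1p_norm p \<Omega> (\<lambda>x. u x - \<eta> x) < e"
      using W1p_norm_eq[OF sob_diff[OF s C1c_sob[OF \<eta>]]] lt'[OF lt(1) pint_nonneg] lt'[OF lt(2) pint_nonneg] by simp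
    then show ?thesis using \<eta> by (auto simp: C1c_def)
  qed
  then show "u \<in> W1p0 p \<Omega>" using s by (auto simp: W1p0_def W1p_iff)
qed

lemma sob0_sob: "sob0 u g \<Longrightarrow> sob u g" by (simp add: sob0_def)

text \<open>The class is a closure and hence closed: approximate by v, then v by a test function,
  with the factor 2^p paid in advance in e'.\<close>

lemma sob0_limit:
  assumes s: "sob u g"
    and lim: "\<And>e. e > 0 \<Longrightarrow> \<exists>v k. sob0 v k \<and> pint (\<lambda>x. u x - v x) < e \<and> pint (\<lambda>x. g x - k x) < e"
  shows "sob0 u g"
  unfolding sob0_def
proof (intro conjI s allI impI)
  fix e :: real assume e: "e > 0"
  define e' where "e' = e / (2 * 2 powr p)"
  have e': "e' > 0" using e by (simp add: e'_def)
  obtain v k where v: "sob0 v k" "pint (\<lambda>x. u x - v x) < e'" "pint (\<lambda>x. g x - k x) < e'"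
    using lim[OF e'] by blast
  obtain \<eta> \<eta>' where \<eta>: "test \<eta> \<eta>'" "pint (\<lambda>x. v x - \<eta> x) < e'" "pint (\<lambda>x. k x - \<eta>' x) < e'"
    using v(1) e' unfolding sob0_def by blast
  note d = sob_diff[OF s sob0_sob[OF v(1)]] sob_diff[OF sob0_sob[OF v(1)] C1c_sob[OF \<eta>(1)]]
  have "pint (\<lambda>x. u x - \<eta> x) < e" "pint (\<lambda>x. g x - \<eta>' x) < e"
    using pint_add_less[OF sobD(1)[OF d(1)] sobD(1)[OF d(2)]] pint_add_less[OF sobD(2)[OF d(1)] sobD(2)[OF d(2)]] v \<eta>
    by (simp_all add: e'_def)
  with \<eta>(1) show "\<exists>\<eta> \<eta>'. test \<eta> \<eta>' \<and> pint (\<lambda>x. u x - \<eta> x) < e \<and> pint (\<lambda>x. g x - \<eta>' x) < e"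
    by blast
qed

lemma C1c_uminus: "test \<eta> \<eta>' \<Longrightarrow> test (\<lambda>x. - \<eta> x) (\<lambda>x. - \<eta>' x)"
  unfolding C1c_with_gradient_def by (auto intro!: GDERIV_minus continuous_intros)

lemma C1c_add:
  assumes "test \<eta> \<eta>'" "test \<theta> \<theta>'"
  shows "test (\<lambda>x. \<eta> x + \<theta> x) (\<lambda>x. \<eta>' x + \<theta>' x)"
proof -
  obtain K where K: "compact K" "K \<subseteq> \<Omega>" "\<And>x. x \<notin> K \<Longrightarrow> \<eta> x = 0" using C1c_D[OF assms(1)] by metis
  obtain K' where K': "compact K'" "K' \<subseteq> \<Omega>" "\<And>x. x \<notin> K' \<Longrightarrow> \<theta> x = 0" using C1c_D[OF assms(2)] by metis
  show ?thesis
    by (rule C1cI[of _ _ "K \<union> K'"])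
      (use assms K K' in \<open>auto simp: C1c_with_gradient_def intro!: GDERIV_add continuous_intros\<close>)
qed

lemma sob0_uminus:
  assumes "sob0 u g"
  shows "sob0 (\<lambda>x. - u x) (\<lambda>x. - g x)"
  unfolding sob0_def
proof (intro conjI allI impI)
  fix e :: real assume "e > 0"
  then obtain \<eta> \<eta>' where \<eta>: "test \<eta> \<eta>'" "pint (\<lambda>x. u x - \<eta> x) < e" "pint (\<lambda>x. g x - \<eta>' x) < e"
    using assms unfolding sob0_def by blast
  have "pint (\<lambda>x. - u x - - \<eta> x) = pint (\<lambda>x. u x - \<eta> x)" "pint (\<lambda>x. - g x - - \<eta>' x) = pint (\<lambda>x. g x - \<eta>' x)"
    using pint_uminus[of "\<lambda>x. u x - \<eta> x"] pint_uminus[of "\<lambda>x. g x - \<eta>' x"] by simp_all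
  with \<eta> C1c_uminus[OF \<eta>(1)]
  show "\<exists>\<eta> \<eta>'. test \<eta> \<eta>' \<and> pint (\<lambda>x. - u x - \<eta> x) < e \<and> pint (\<lambda>x. - g x - \<eta>' x) < e"
    by metis
qed (rule sob_uminus[OF sob0_sob[OF assms]])

lemma sob0_add:
  assumes u: "sob0 u g" and v: "sob0 v k"
  shows "sob0 (\<lambda>x. u x + v x) (\<lambda>x. g x + k x)"
  unfolding sob0_def
proof (intro conjI allI impI)
  fix e :: real assume e: "e > 0"
  define e' where "e' = e / (2 * 2 powr p)"
  have e': "e' > 0" using e by (simp add: e'_def)
  obtain \<eta> \<eta>' where \<eta>: "test \<eta> \<eta>'" "pint (\<lambda>x. u x - \<eta> x) < e'" "pint (\<lambda>x. g x - \<eta>' x) < e'"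
    using u e' unfolding sob0_def by blast
  obtain \<theta> \<theta>' where \<theta>: "test \<theta> \<theta>'" "pint (\<lambda>x. v x - \<theta> x) < e'" "pint (\<lambda>x. k x - \<theta>' x) < e'"
    using v e' unfolding sob0_def by blast
  note d = sob_diff[OF sob0_sob[OF u] C1c_sob[OF \<eta>(1)]] sob_diff[OF sob0_sob[OF v] C1c_sob[OF \<theta>(1)]]
  have "pint (\<lambda>x. u x + v x - (\<eta> x + \<theta> x)) < e" "pint (\<lambda>x. g x + k x - (\<eta>' x + \<theta>' x)) < e"
    using pint_add_less[OF sobD(1)[OF d(1)] sobD(1)[OF d(2)]] pint_add_less[OF sobD(2)[OF d(1)] sobD(2)[OF d(2)]] \<eta> \<theta>
    by (simp_all add: e'_def add_diff_add)
  with C1c_add[OF \<eta>(1) \<theta>(1)]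
  show "\<exists>\<eta> \<eta>'. test \<eta> \<eta>' \<and> pint (\<lambda>x. u x + v x - \<eta> x) < e \<and> pint (\<lambda>x. g x + k x - \<eta>' x) < e"
    by blast
qed (rule sob_add[OF sob0_sob[OF u] sob0_sob[OF v]])

text \<open>Lets the convergence of mollifications on the whole space be used on \<Omega>.\<close>

lemma pint_ext_le:
  assumes h: "h \<in> Lp p \<Omega>" and k: "continuous_on UNIV k" "\<And>x. R < norm x \<Longrightarrow> k x = 0"
  shows "pint (\<lambda>x. h x - k x) \<le> (LINT x|lebesgue. norm (k x - zero_ext h x) powr p)"
proof -
  note H = Lp_ext[OF h]
  have [measurable]: "k \<in> borel_measurable lebesgue" "zero_ext h \<in> borel_measurable lebesgue"
    using continuous_measurable_lebesgue[OF k(1)] H(1) by auto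
  have i: "integrable lebesgue (\<lambda>x. norm (k x - zero_ext h x) powr p)"
    by (intro integrable_powr_diff p0 H(2) integrable_powr_continuous[OF p0(2) k]) measurable
  have "(\<lambda>x. h x - k x) \<in> Lp p \<Omega>" by (rule Lp_diff[OF h continuous_Lp[OF k(1)]])
  from Lp_ext(2)[OF this]
  have j: "integrable lebesgue (\<lambda>x. norm (zero_ext (\<lambda>x. h x - k x) x) powr p)" .
  have "pint (\<lambda>x. h x - k x) = (LINT x|lebesgue. norm (zero_ext (\<lambda>x. h x - k x) x) powr p)"
    unfolding pint_def by (rule integral_lebesgue_on_eq) (auto simp: zero_ext_def)
  also have "\<dots> \<le> (LINT x|lebesgue. norm (k x - zero_ext h x) powr p)"
    by (rule integral_mono[OF j i]) (auto simp: zero_ext_def norm_minus_commute)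
  finally show ?thesis .
qed

text \<open>For small \<epsilon> the mollification of the extension by zero is itself a test
  function, since its support is K enlarged by \<epsilon>, and its gradient is the mollified
  gradient at every point of the space.\<close>

lemma sob0_compact_support:
  assumes s: "sob f g" and K: "compact K" "K \<subseteq> \<Omega>" and f0: "AE x in \<mu>. x \<notin> K \<longrightarrow> f x = 0"
  shows "sob0 f g"
  unfolding sob0_def
proof (intro conjI s allI impI)
  fix e :: real assume e: "e > 0"
  define f1 where "f1 x = (if x \<in> K then f x else 0)" for x
  define g1 where "g1 x = (if x \<in> K then g x else 0)" for x
  have ff1: "AE x in \<mu>. f x = f1 x"
    using f0 by (rule eventually_mono) (auto simp: f1_def)
  \<comment> \<open>The weak gradient vanishes almost everywhere on the zero set of f, so it can be
    cut off at K along with f.\<close>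
  have gg1: "AE x in \<mu>. g x = g1 x"
    using sob_zero_set[OF s] f0 by eventually_elim (auto simp: g1_def)
  have s1: "sob f1 g1" by (rule sob_AE[OF s ff1 gg1])
  let ?F = "zero_ext f1" and ?G = "zero_ext g1"
  have F0: "?F x = 0" "?G x = 0" if "x \<notin> K" for x
    using that by (auto simp: zero_ext_def f1_def g1_def)
  obtain R1 where R1: "\<And>(f :: 'a \<Rightarrow> real) x. R1 < norm x \<Longrightarrow> zero_ext f x = 0" by (rule zero_ext_radius) blast
  obtain R2 where R2: "\<And>(f :: 'a \<Rightarrow> 'a) x. R2 < norm x \<Longrightarrow> zero_ext f x = 0" by (rule zero_ext_radius) blast
  note F = Lp_ext[OF sobD(1)[OF s1]] and G = Lp_ext[OF sobD(2)[OF s1]]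
  obtain r where r: "r > 0" "(\<Union>x\<in>K. cball x r) \<subseteq> \<Omega>"
    using compact_subset_open_imp_cball_epsilon_subset[OF K(1) open_\<Omega> K(2)] by metis
  obtain \<epsilon> \<rho> and \<rho>' :: "nat \<Rightarrow> 'a \<Rightarrow> 'a" where \<rho>: "\<And>n. mollifier (\<epsilon> n) (\<rho> n) (\<rho>' n)"
    and \<epsilon>: "\<epsilon> \<longlonglongrightarrow> 0"
    using mollifier_sequence by metis
  have LF: "(\<lambda>n. LINT x|lebesgue. norm (conv (\<rho> n) ?F x - ?F x) powr p) \<longlonglongrightarrow> 0"
    by (rule mollify_Lp_tendsto[OF p1 F(1) R1 F(2) \<rho> \<epsilon>])
  have LG: "(\<lambda>n. LINT x|lebesgue. norm (conv (\<rho> n) ?G x - ?G x) powr p) \<longlonglongrightarrow> 0"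
    by (rule mollify_Lp_tendsto[OF p1 G(1) R2 G(2) \<rho> \<epsilon>])
  have "\<forall>\<^sub>F n in sequentially. \<epsilon> n < r / 2 \<and> (LINT x|lebesgue. norm (conv (\<rho> n) ?F x - ?F x) powr p) < e
      \<and> (LINT x|lebesgue. norm (conv (\<rho> n) ?G x - ?G x) powr p) < e"
    using r(1) e by (intro eventually_conj order_tendstoD(2)[OF \<epsilon>] order_tendstoD(2)[OF LF] order_tendstoD(2)[OF LG]) auto
  then obtain n where n: "\<epsilon> n < r / 2" "(LINT x|lebesgue. norm (conv (\<rho> n) ?F x - ?F x) powr p) < e"
    "(LINT x|lebesgue. norm (conv (\<rho> n) ?G x - ?G x) powr p) < e"
    by (auto simp: eventually_sequentially)
  let ?cF = "conv (\<rho> n) ?F" and ?cG = "conv (\<rho> n) ?G"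
  \<comment> \<open>If the \<epsilon>-ball of x leaves \<Omega>, then x is farther than \<epsilon>
    from K: otherwise this ball would lie within 2 \<epsilon> < r of a point of K, hence in
    \<Omega>. Both sides are then 0. This is where \<epsilon> n < r / 2 is needed.\<close>
  have gr: "(LINT y|lebesgue. ?F y *\<^sub>R \<rho>' n (x - y)) = ?cG x" for x
  proof (cases "cball x (\<epsilon> n) \<subseteq> \<Omega>")
    case True
    then show ?thesis by (rule conv_weak_gradient[OF sobD(3)[OF s1] \<rho>])
  next
    case False
    have far: "\<epsilon> n < norm (x - y)" if "y \<in> K" for y
    proof (rule ccontr)
      assume "\<not> \<epsilon> n < norm (x - y)"
      then have "dist y x \<le> \<epsilon> n" by (simp add: dist_norm norm_minus_commute)
      have "cball x (\<epsilon> n) \<subseteq> cball y r"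
      proof
        fix z assume "z \<in> cball x (\<epsilon> n)"
        then show "z \<in> cball y r"
          using \<open>dist y x \<le> \<epsilon> n\<close> n(1) dist_triangle[of y z x] by simp
      qed
      with r(2) that False show False by blast
    qed
    have "?F y *\<^sub>R \<rho>' n (x - y) = 0" for y
    proof (cases "y \<in> K")
      case True
      then show ?thesis using mollifier_support_gradient[OF \<rho> far[OF True]] by simp
    qed (simp add: F0)
    moreover have "\<rho> n (x - y) *\<^sub>R ?G y = 0" for y
    proof (cases "y \<in> K")
      case True
      then show ?thesis using mollifier_D(6)[OF \<rho>[of n], of "x - y"] far[OF True] by simp
    qed (simp add: F0)
    ultimately have "(\<lambda>y. ?F y *\<^sub>R \<rho>' n (x - y)) = (\<lambda>_. 0)" "(\<lambda>y. \<rho> n (x - y) *\<^sub>R ?G y) = (\<lambda>_. 0)"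
      by (intro HOL.ext; simp)+
    then show ?thesis by (simp only: conv_def)
  qed
  have C: "C1c_with_gradient \<Omega> ?cF ?cG"
  proof (rule C1cI)
    show "GDERIV ?cF x :> ?cG x" for x
      using conv_GDERIV[OF mollifier_test[OF \<rho>[of n]] F(3), of x] by (simp add: gr)
    show "continuous_on UNIV ?cG" by (rule conv_continuous[OF mollifier_test[OF \<rho>] G(3)])
    define K' where "K' = {x + y |x y. x \<in> K \<and> y \<in> cball 0 (\<epsilon> n)}"
    show "compact K'" unfolding K'_def by (intro compact_sums K compact_cball)
    show "?cF x = 0" if x: "x \<notin> K'" for x
    proof -
      have "\<rho> n (x - y) *\<^sub>R ?F y = 0" for y
      proof (cases "y \<in> K")
        case True
        have "\<not> norm (x - y) \<le> \<epsilon> n"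
        proof
          assume "norm (x - y) \<le> \<epsilon> n"
          then have "x = y + (x - y)" "x - y \<in> cball 0 (\<epsilon> n)" by auto
          with True x show False unfolding K'_def by blast
        qed
        then show ?thesis using mollifier_D(6)[OF \<rho>[of n], of "x - y"] by simp
      qed (simp add: F0)
      then have "(\<lambda>y. \<rho> n (x - y) *\<^sub>R ?F y) = (\<lambda>_. 0)" by (simp add: fun_eq_iff)
      then show ?thesis by (simp add: conv_def)
    qed
    show "K' \<subseteq> \<Omega>"
    proof
      fix z assume "z \<in> K'"
      then obtain x y where "z = x + y" "x \<in> K" "norm y \<le> \<epsilon> n" unfolding K'_def by auto
      then have "z \<in> cball x r" using n(1) r(1) by (simp add: dist_norm)
      then show "z \<in> \<Omega>" using r(2) \<open>x \<in> K\<close> by blast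
    qed
  qed
  have "pint (\<lambda>x. f x - ?cF x) = pint (\<lambda>x. f1 x - ?cF x)"
    using ff1 sobD(6)[OF sob_diff[OF s C1c_sob[OF C]]]
    by (intro pint_cong_AE) (auto elim!: eventually_mono)
  also have "\<dots> \<le> (LINT x|lebesgue. norm (?cF x - ?F x) powr p)"
    by (rule pint_ext_le[OF sobD(1)[OF s1] conv_continuous[OF mollifier_test[OF \<rho>] F(3)] conv_support[OF \<rho> R1]])
  finally have 1: "pint (\<lambda>x. f x - ?cF x) < e" using n(2) by simp
  have "pint (\<lambda>x. g x - ?cG x) = pint (\<lambda>x. g1 x - ?cG x)"
    using gg1 sobD(7)[OF sob_diff[OF s C1c_sob[OF C]]]
    by (intro pint_cong_AE) (auto elim!: eventually_mono)
  also have "\<dots> \<le> (LINT x|lebesgue. norm (?cG x - ?G x) powr p)"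
    by (rule pint_ext_le[OF sobD(2)[OF s1] conv_continuous[OF mollifier_test[OF \<rho>] G(3)] conv_support[OF \<rho> R2]])
  finally have "pint (\<lambda>x. g x - ?cG x) < e" using n(3) by simp
  with 1 C show "\<exists>\<eta> \<eta>'. test \<eta> \<eta>' \<and> pint (\<lambda>x. f x - \<eta> x) < e \<and> pint (\<lambda>x. g x - \<eta>' x) < e"
    by blast
qed

text \<open>If w is a test function, (w - c)^+ vanishes off its support because c >= 0, so
  \<open>sob0_compact_support\<close> applies. In general w is approximated by test functions, and
  the positive parts converge together with their gradients.\<close>

lemma sob0_pos_diff:
  assumes w: "sob0 w w'" and c: "sob c c'" and c0: "AE x in \<mu>. 0 \<le> c x"
  shows "sob0 (\<lambda>x. max 0 (w x - c x)) (\<lambda>x. if 0 < w x - c x then w' x - c' x else 0)"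
proof (rule sob0_limit)
  note sw = sob0_sob[OF w]
  show "sob (\<lambda>x. max 0 (w x - c x)) (\<lambda>x. if 0 < w x - c x then w' x - c' x else 0)"
    by (rule sob_pos[OF sob_diff[OF sw c]])
  fix e :: real assume e: "e > 0"
  have "\<exists>\<eta> \<eta>'. test \<eta> \<eta>' \<and> pint (\<lambda>x. w x - \<eta> x) < 1 / real (Suc n) \<and> pint (\<lambda>x. w' x - \<eta>' x) < 1 / real (Suc n)" for n
    using w unfolding sob0_def by simp
  then obtain \<eta> \<eta>' where \<eta>: "\<And>n. test (\<eta> n) (\<eta>' n)"
    and lt: "\<And>n. pint (\<lambda>x. w x - \<eta> n x) < 1 / real (Suc n)" "\<And>n. pint (\<lambda>x. w' x - \<eta>' n x) < 1 / real (Suc n)"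
    by metis
  have lim0: "(\<lambda>n. 1 / real (Suc n)) \<longlonglongrightarrow> 0"
    using LIMSEQ_inverse_real_of_nat by (simp add: inverse_eq_divide)
  have l1: "(\<lambda>n. pint (\<lambda>x. w x - \<eta> n x)) \<longlonglongrightarrow> 0"
    by (rule squeeze_zero[OF pint_nonneg less_imp_le[OF lt(1)] lim0])
  have l2: "(\<lambda>n. pint (\<lambda>x. w' x - \<eta>' n x)) \<longlonglongrightarrow> 0"
    by (rule squeeze_zero[OF pint_nonneg less_imp_le[OF lt(2)] lim0])
  have sd: "sob (\<lambda>x. w x - \<eta> n x) (\<lambda>x. w' x - \<eta>' n x)" for n
    by (rule sob_diff[OF sw C1c_sob[OF \<eta>]])
  obtain \<sigma> where \<sigma>: "strict_mono \<sigma>" "AE x in \<mu>. (\<lambda>n. norm (w x - \<eta> (\<sigma> n) x) powr p) \<longlonglongrightarrow> 0"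
    using tendsto_L1_AE_subseq[of "\<mu>" "\<lambda>n x. norm (w x - \<eta> n x) powr p"]
      Lp_powr[OF sobD(1)[OF sd]] l1 by (auto simp: pint_def)
  define a where "a n x = (if 0 < \<eta> (\<sigma> n) x - c x then 1 else 0 :: real)" for n x
  define \<alpha> where "\<alpha> x = (if 0 < w x - c x then 1 else 0 :: real)" for x
  define v where "v n x = max 0 (\<eta> (\<sigma> n) x - c x)" for n x
  define v' where "v' n x = a n x *\<^sub>R (\<eta>' (\<sigma> n) x - c' x)" for n x
  have sec: "sob (\<lambda>x. \<eta> (\<sigma> n) x - c x) (\<lambda>x. \<eta>' (\<sigma> n) x - c' x)" for n
    by (rule sob_diff[OF C1c_sob[OF \<eta>] c])
  have swc: "sob (\<lambda>x. w x - c x) (\<lambda>x. w' x - c' x)" by (rule sob_diff[OF sw c])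
  have v'_eq: "v' n = (\<lambda>x. if 0 < \<eta> (\<sigma> n) x - c x then \<eta>' (\<sigma> n) x - c' x else 0)" for n
    by (auto simp: v'_def a_def fun_eq_iff)
  have sv: "sob (v n) (v' n)" for n
    using sob_pos[OF sec] unfolding v'_eq v_def .
  have v0: "sob0 (v n) (v' n)" for n
  proof -
    obtain K where K: "compact K" "K \<subseteq> \<Omega>" "\<And>x. x \<notin> K \<Longrightarrow> \<eta> (\<sigma> n) x = 0"
      using C1c_D[OF \<eta>] by metis
    show ?thesis
    proof (rule sob0_compact_support[OF sv K(1,2)])
      show "AE x in \<mu>. x \<notin> K \<longrightarrow> v n x = 0"
        using c0 by (rule eventually_mono) (auto simp: v_def K(3))
    qed
  qed
  note [measurable] = sobD(6,7)[OF sec] sobD(6,7)[OF swc]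
  have "(\<lambda>n. LINT x|\<mu>. norm (a n x *\<^sub>R (\<eta>' (\<sigma> n) x - c' x) - \<alpha> x *\<^sub>R (w' x - c' x)) powr p) \<longlonglongrightarrow> 0"
  proof (rule Lp_bounded_mult_tendsto[where C=1, OF p1])
    show "a n \<in> borel_measurable \<mu>" "\<alpha> \<in> borel_measurable \<mu>" for n
      unfolding a_def \<alpha>_def by measurable
    show "\<bar>a n x\<bar> \<le> 1" "\<bar>\<alpha> x\<bar> \<le> 1" for n x by (auto simp: a_def \<alpha>_def)
    show "integrable \<mu> (\<lambda>x. norm (\<eta>' (\<sigma> n) x - c' x) powr p)"
      "integrable \<mu> (\<lambda>x. norm (w' x - c' x) powr p)" for n
      using Lp_powr[OF sobD(2)[OF sec]] Lp_powr[OF sobD(2)[OF swc]] by auto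
    have "(\<lambda>n. pint (\<lambda>x. w' x - \<eta>' (\<sigma> n) x)) \<longlonglongrightarrow> 0"
      using LIMSEQ_subseq_LIMSEQ[OF l2 \<sigma>(1)] by (simp add: comp_def)
    then show "(\<lambda>n. LINT x|\<mu>. norm (\<eta>' (\<sigma> n) x - c' x - (w' x - c' x)) powr p) \<longlonglongrightarrow> 0"
      by (simp add: pint_def norm_minus_commute)
    \<comment> \<open>Indicators of {\<eta> > c} converge to that of {w > c} wherever w and c
      differ. Where they coincide w' - c' vanishes almost everywhere, and no convergence is
      required.\<close>
    show "AE x in \<mu>. w' x - c' x \<noteq> 0 \<longrightarrow> (\<lambda>n. a n x) \<longlonglongrightarrow> \<alpha> x"
      using \<sigma>(2) sob_zero_set[OF swc]
    proof eventually_elim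
      fix x assume l: "(\<lambda>n. norm (w x - \<eta> (\<sigma> n) x) powr p) \<longlonglongrightarrow> 0"
        and z: "w x - c x = 0 \<longrightarrow> w' x - c' x = 0"
      show "w' x - c' x \<noteq> 0 \<longrightarrow> (\<lambda>n. a n x) \<longlonglongrightarrow> \<alpha> x"
      proof
        assume "w' x - c' x \<noteq> 0"
        with z have ne: "w x - c x \<noteq> 0" by blast
        have "(\<lambda>n. (norm (w x - \<eta> (\<sigma> n) x) powr p) powr (1 / p)) \<longlonglongrightarrow> 0"
          using p0 by (intro tendsto_zero_powrI[where b="1 / p"] l) auto
        then have "(\<lambda>n. w x - \<eta> (\<sigma> n) x) \<longlonglongrightarrow> 0"
          using p0 by (simp add: powr_powr tendsto_rabs_zero_iff)
        from tendsto_diff[OF tendsto_const[of "w x"] this]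
        have "(\<lambda>n. \<eta> (\<sigma> n) x) \<longlonglongrightarrow> w x" by simp
        from tendsto_diff[OF this tendsto_const[of "c x"]]
        have lc: "(\<lambda>n. \<eta> (\<sigma> n) x - c x) \<longlonglongrightarrow> w x - c x" .
        show "(\<lambda>n. a n x) \<longlonglongrightarrow> \<alpha> x"
        proof (cases "0 < w x - c x")
          case True
          from order_tendstoD(1)[OF lc this] show ?thesis
            by (intro tendsto_eventually) (auto elim!: eventually_mono simp: a_def \<alpha>_def True[simplified])
        next
          case False
          with ne have "w x - c x < 0" by linarith
          from order_tendstoD(2)[OF lc this] show ?thesis
            using False by (intro tendsto_eventually) (auto elim!: eventually_mono simp: a_def \<alpha>_def)
        qed
      qed
    qed
  qed measurable
  then have L2: "(\<lambda>n. pint (\<lambda>x. (if 0 < w x - c x then w' x - c' x else 0) - v' n x)) \<longlonglongrightarrow> 0"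
  proof (rule Lim_transform_eventually, intro always_eventually allI)
    fix n
    have "\<alpha> x *\<^sub>R (w' x - c' x) = (if 0 < w x - c x then w' x - c' x else 0)" for x by (simp add: \<alpha>_def)
    then show "(LINT x|\<mu>. norm (a n x *\<^sub>R (\<eta>' (\<sigma> n) x - c' x) - \<alpha> x *\<^sub>R (w' x - c' x)) powr p) =
        pint (\<lambda>x. (if 0 < w x - c x then w' x - c' x else 0) - v' n x)"
      unfolding pint_def v'_def[symmetric] by (simp only: norm_minus_commute)
  qed
  have L1: "(\<lambda>n. pint (\<lambda>x. max 0 (w x - c x) - v n x)) \<longlonglongrightarrow> 0"
  proof (rule squeeze_zero[OF pint_nonneg])
    show "(\<lambda>n. pint (\<lambda>x. w x - \<eta> (\<sigma> n) x)) \<longlonglongrightarrow> 0"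
      using LIMSEQ_subseq_LIMSEQ[OF l1 \<sigma>(1)] by (simp add: comp_def)
    show "pint (\<lambda>x. max 0 (w x - c x) - v n x) \<le> pint (\<lambda>x. w x - \<eta> (\<sigma> n) x)" for n
    proof (rule pint_mono[OF _ sobD(1)[OF sd]])
      show "(\<lambda>x. max 0 (w x - c x) - v n x) \<in> borel_measurable \<mu>"
        unfolding v_def by measurable
    qed (auto simp: v_def max_def)
  qed
  have "\<forall>\<^sub>F n in sequentially. pint (\<lambda>x. max 0 (w x - c x) - v n x) < e \<and>
      pint (\<lambda>x. (if 0 < w x - c x then w' x - c' x else 0) - v' n x) < e"
    by (intro eventually_conj order_tendstoD(2)[OF L1 e] order_tendstoD(2)[OF L2 e])
  then obtain n where "pint (\<lambda>x. max 0 (w x - c x) - v n x) < e"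
      "pint (\<lambda>x. (if 0 < w x - c x then w' x - c' x else 0) - v' n x) < e"
    by (auto simp: eventually_sequentially)
  with v0 show "\<exists>v k. sob0 v k \<and> pint (\<lambda>x. max 0 (w x - c x) - v x) < e \<and>
      pint (\<lambda>x. (if 0 < w x - c x then w' x - c' x else 0) - k x) < e"
    by blast
qed

section \<open>Barriers\<close>

text \<open>At each point the gradient of a maximum is one of the given gradients, so no slope
  outside X appears. The range is carried through the induction to record this.\<close>

lemma sob_Max:
  assumes "finite A" "A \<noteq> {}" "\<And>a. a \<in> A \<Longrightarrow> \<exists>g. sob (f a) g \<and> range g \<subseteq> X"
  shows "\<exists>g. sob (\<lambda>x. Max ((\<lambda>a. f a x) ` A)) g \<and> range g \<subseteq> X"
  using assms
proof (induction A rule: finite_ne_induct)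
  case (insert a A)
  obtain g where g: "sob (f a) g" "range g \<subseteq> X" using insert.prems by blast
  obtain k where k: "sob (\<lambda>x. Max ((\<lambda>a. f a x) ` A)) k" "range k \<subseteq> X" using insert by blast
  have eq: "(\<lambda>x. Max ((\<lambda>a. f a x) ` insert a A)) = (\<lambda>x. max (f a x) (Max ((\<lambda>a. f a x) ` A)))"
    using insert.hyps by simp
  have "range (\<lambda>x. if Max ((\<lambda>a. f a x) ` A) < f a x then g x else k x) \<subseteq> X"
    using g(2) k(2) by auto
  with sob_max[OF g(1) k(1)] show ?case unfolding eq by blast
qed auto

lemma sob_Min:
  assumes "finite A" "A \<noteq> {}" "\<And>a. a \<in> A \<Longrightarrow> \<exists>g. sob (f a) g \<and> range g \<subseteq> X"
  shows "\<exists>g. sob (\<lambda>x. Min ((\<lambda>a. f a x) ` A)) g \<and> range g \<subseteq> X"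
  using assms
proof (induction A rule: finite_ne_induct)
  case (insert a A)
  obtain g where g: "sob (f a) g" "range g \<subseteq> X" using insert.prems by blast
  obtain k where k: "sob (\<lambda>x. Min ((\<lambda>a. f a x) ` A)) k" "range k \<subseteq> X" using insert by blast
  have eq: "(\<lambda>x. Min ((\<lambda>a. f a x) ` insert a A)) = (\<lambda>x. min (f a x) (Min ((\<lambda>a. f a x) ` A)))"
    using insert.hyps by simp
  have "range (\<lambda>x. if Min ((\<lambda>a. f a x) ` A) < f a x then k x else g x) \<subseteq> X"
    using g(2) k(2) by auto
  with sob_min[OF g(1) k(1)] show ?case unfolding eq by blast
qed auto

text \<open>The function is \<open>x \<mapsto> min\<^sub>z max\<^sub>j \<xi>\<^sub>j \<bullet> (x - z)\<close>, where \<open>z\<close> ranges over a fine finite net of \<open>\<Omega>\<close>;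
  it is nonnegative because \<open>0\<close> is a convex combination of the \<open>\<xi>\<^sub>j\<close>.\<close>

lemma sob_small_prescribed_gradients:
  assumes X: "finite X" "0 \<in> convex hull X" and \<delta>: "\<delta> > 0"
  obtains b g where "sob b g" "\<And>x. x \<in> \<Omega> \<Longrightarrow> 0 \<le> b x \<and> b x \<le> \<delta>" "range g \<subseteq> X"
proof -
  have Xne: "X \<noteq> {}" using X(2) by auto
  obtain B where B: "\<And>\<xi>. \<xi> \<in> X \<Longrightarrow> norm \<xi> \<le> B" "B > 0"
    using finite_imp_bounded[OF X(1)] by (auto simp: bounded_pos)
  \<comment> \<open>A point x within \<open>r\<close> of a net point z satisfies norm \<xi> * norm
    (x - z) <= B * r = \<delta> for every slope \<xi>.\<close>
  define r where "r = \<delta> / B"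
  have r: "r > 0" using \<delta> B by (simp add: r_def)
  have "compact (closure \<Omega>)" using bounded_\<Omega> by simp
  then obtain Z0 where Z0: "finite Z0" "closure \<Omega> \<subseteq> (\<Union>z\<in>Z0. ball z r)"
    using r unfolding compact_eq_totally_bounded by blast
  \<comment> \<open>The added point keeps the minimum over the net meaningful when \<Omega> is
    empty.\<close>
  define Z where "Z = insert 0 Z0"
  have Z: "finite Z" "Z \<noteq> {}" "\<Omega> \<subseteq> (\<Union>z\<in>Z. ball z r)"
    using Z0 closure_subset[of \<Omega>] by (auto simp: Z_def)
  define f where "f z x = Max ((\<lambda>\<xi>. \<xi> \<bullet> (x - z)) ` X)" for z x
  have f: "\<exists>g. sob (f z) g \<and> range g \<subseteq> X" for z
  proof -
    have "\<exists>g. sob (\<lambda>x. \<xi> \<bullet> (x - z)) g \<and> range g \<subseteq> X" if "\<xi> \<in> X" for \<xi>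
      using sob_affine[of \<xi> z] that by auto
    then show ?thesis unfolding f_def by (rule sob_Max[OF X(1) Xne])
  qed
  have "\<exists>g. sob (\<lambda>x. Min ((\<lambda>z. f z x) ` Z)) g \<and> range g \<subseteq> X"
    by (rule sob_Min[OF Z(1,2) f])
  then obtain g where g: "sob (\<lambda>x. Min ((\<lambda>z. f z x) ` Z)) g" "range g \<subseteq> X"
    by (elim exE conjE)
  have f0: "0 \<le> f z x" for z x
  proof (rule ccontr)
    assume "\<not> 0 \<le> f z x"
    then have neg: "f z x < 0" by simp
    have "\<xi> \<bullet> (x - z) < 0" if "\<xi> \<in> X" for \<xi>
    proof -
      have "\<xi> \<bullet> (x - z) \<le> f z x" unfolding f_def using X(1) that by (intro Max_ge) auto
      with neg show ?thesis by linarith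
    qed
    \<comment> \<open>A negative maximum puts all of X into an open half-space that does not contain
      0; its convexity contradicts 0 being in the hull.\<close>
    then have "X \<subseteq> {y. (x - z) \<bullet> y < 0}" by (auto simp: inner_commute)
    then have "convex hull X \<subseteq> {y. (x - z) \<bullet> y < 0}"
      by (rule hull_minimal) (rule convex_halfspace_lt)
    with X(2) show False by auto
  qed
  show ?thesis
  proof (rule that[OF g(1) _ g(2)])
    fix x assume "x \<in> \<Omega>"
    then obtain z where z: "z \<in> Z" "dist z x < r" using Z(3) by auto
    have "Min ((\<lambda>z. f z x) ` Z) \<le> f z x" using z Z by (intro Min_le) auto
    also have "f z x \<le> \<delta>"
    proof -
      have "\<xi> \<bullet> (x - z) \<le> \<delta>" if "\<xi> \<in> X" for \<xi>
      proof -
        have "\<xi> \<bullet> (x - z) \<le> norm \<xi> * norm (x - z)" by (rule norm_cauchy_schwarz)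
        also have "\<dots> \<le> B * r"
          using B(1)[OF that] B(2) z(2) by (intro mult_mono) (auto simp: dist_norm norm_minus_commute)
        finally show ?thesis using B(2) by (simp add: r_def)
      qed
      then show ?thesis using X(1) Xne by (simp add: f_def)
    qed
    finally show "0 \<le> Min ((\<lambda>z. f z x) ` Z) \<and> Min ((\<lambda>z. f z x) ` Z) \<le> \<delta>"
      using f0 Z(1,2) by simp
  qed
qed

section \<open>Modification on null sets, essential bounds and the existence of barriers\<close>

lemma sob0_cong_AE:
  assumes f: "sob0 f g" and k: "sob k m" and eq: "AE x in \<mu>. f x = k x"
  shows "sob0 k m"
proof -
  have "sob k g" by (rule sob_AE[OF sob0_sob[OF f] eq]) simp
  then have eq': "AE x in \<mu>. g x = m x" using sob_unique k by blast
  show ?thesis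
    unfolding sob0_def
  proof (intro conjI k allI impI)
    fix e :: real assume "e > 0"
    then obtain \<eta> \<eta>' where \<eta>: "test \<eta> \<eta>'" "pint (\<lambda>x. f x - \<eta> x) < e" "pint (\<lambda>x. g x - \<eta>' x) < e"
      using f unfolding sob0_def by blast
    note d = sob_diff[OF sob0_sob[OF f] C1c_sob[OF \<eta>(1)]]
    have "pint (\<lambda>x. f x - \<eta> x) = pint (\<lambda>x. k x - \<eta> x)"
      using eq by (intro pint_cong_AE sobD(6)[OF d]) (auto elim!: eventually_mono)
    moreover have "pint (\<lambda>x. g x - \<eta>' x) = pint (\<lambda>x. m x - \<eta>' x)"
      using eq' by (intro pint_cong_AE sobD(7)[OF d]) (auto elim!: eventually_mono)
    ultimately show "\<exists>\<eta> \<eta>'. test \<eta> \<eta>' \<and> pint (\<lambda>x. k x - \<eta> x) < e \<and> pint (\<lambda>x. m x - \<eta>' x) < e"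
      using \<eta> by auto
  qed
qed

lemma along_AE:
  assumes "sob u g"
  shows "AE x in \<mu>. along \<Omega> L u x = L x (u x) (g x)"
  using sob_weak_grad[OF assms] by (rule eventually_mono) (simp add: along_def)

text \<open>What has to be seen is that the two extended real bounds are finite. Both are at most C.
  A nonempty open set is not null, so some point satisfies all the almost everywhere inequalities at
  once, and its value bounds them from below.\<close>

lemma essential_bounds:
  assumes ne: "\<Omega> \<noteq> {}" and b: "b \<in> Linf \<Omega>"
  obtains \<alpha> \<beta> :: real where "ess_osc \<Omega> b = ereal (\<beta> - \<alpha>)" "AE x in \<mu>. \<alpha> \<le> b x \<and> b x \<le> \<beta>"
proof -
  have m: "b \<in> borel_measurable \<mu>" using b by (simp add: Linf_def)
  obtain C where C: "AE x in \<mu>. \<bar>b x\<bar> \<le> C" using b by (auto simp: Linf_def)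
  have m1: "(\<lambda>x. ereal (b x)) \<in> borel_measurable \<mu>" "(\<lambda>x. - ereal (b x)) \<in> borel_measurable \<mu>"
    using m by auto
  define S where "S = esssup \<mu> (\<lambda>x. ereal (b x))"
  define I where "I = esssup \<mu> (\<lambda>x. - ereal (b x))"
  have S: "AE x in \<mu>. ereal (b x) \<le> S" and I: "AE x in \<mu>. - ereal (b x) \<le> I"
    unfolding S_def I_def by (rule esssup_AE)+
  have S_le: "S \<le> ereal C"
    unfolding S_def by (rule esssup_I[OF m1(1)]) (use C in \<open>auto elim!: eventually_mono\<close>)
  have I_le: "I \<le> ereal C"
    unfolding I_def by (rule esssup_I[OF m1(2)]) (use C in \<open>auto elim!: eventually_mono\<close>)
  have "\<not> (AE x in \<mu>. False)"
  proof
    assume "AE x in \<mu>. False"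
    then have "AE x in lebesgue. x \<in> - \<Omega>" by (simp add: AE_\<Omega>)
    then have "- \<Omega> = UNIV"
      using open_\<Omega> mem_closed_if_AE_lebesgue[of "- \<Omega>"] by blast
    with ne show False by auto
  qed
  moreover have "AE x in \<mu>. False"
    if "\<nexists>x. ereal (b x) \<le> S \<and> - ereal (b x) \<le> I \<and> \<bar>b x\<bar> \<le> C"
    using S I C by eventually_elim (use that in blast)
  ultimately have "\<exists>x. ereal (b x) \<le> S \<and> - ereal (b x) \<le> I \<and> \<bar>b x\<bar> \<le> C"
    by blast
  then obtain x where x: "ereal (b x) \<le> S" "- ereal (b x) \<le> I" "\<bar>b x\<bar> \<le> C"
    by blast
  have "S \<noteq> \<infinity>" "S \<noteq> -\<infinity>" "I \<noteq> \<infinity>" "I \<noteq> -\<infinity>"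
    using x S_le I_le by auto
  then obtain \<beta> \<gamma> where S': "S = ereal \<beta>" and I': "I = ereal \<gamma>"
    by (meson ereal_cases)
  show ?thesis
  proof (rule that[of \<beta> "- \<gamma>"])
    show "ess_osc \<Omega> b = ereal (\<beta> - - \<gamma>)"
      unfolding ess_osc_def ess_inf_def S_def[symmetric] I_def[symmetric] S' I' by simp
    show "AE x in \<mu>. - \<gamma> \<le> b x \<and> b x \<le> \<beta>"
      using S I by eventually_elim (auto simp: S' I')
  qed
qed

text \<open>The common consequence of the two alternative assumptions: at level s there are an upper
  barrier s + b and a lower barrier s + b', both at bounded distance from s. The truncation takes
  the upper one at a level s and the lower one at another level -t.\<close>

definition barriers where
  "barriers L h q s \<longleftrightarrow> (\<exists>b g b' g' C. sob b g \<and> sob b' g' \<and>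
    (AE x in \<mu>. 0 \<le> b x \<and> b x \<le> C \<and> - C \<le> b' x \<and> b' x \<le> 0 \<and>
       Lbar p L x (s + b x) (g x) \<le> h s + q x \<and> Lbar p L x (s + b' x) (g' x) \<le> h s + q x))"

lemma barriers_exist:
  assumes "(\<forall>s. \<exists>(m::nat) (\<xi> :: nat \<Rightarrow> 'a) \<delta>.
            m \<ge> 1 \<and> 0 \<in> convex hull (\<xi> ` {1..m}) \<and> \<delta> > 0 \<and>
            (AE x in \<mu>. \<forall>t\<in>{s - \<delta>..s + \<delta>}.
               (\<Sum>j=1..m. Lbar p L x t (\<xi> j)) \<le> h s + q x))
       \<or> (\<exists>b \<in> W1p p \<Omega> \<inter> Linf \<Omega>.
            AE x in \<mu>. \<forall>s t. ereal \<bar>s - t\<bar> \<le> ess_osc \<Omega> b \<longrightarrow>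
               Lbar p L x t (weak_grad \<Omega> b x) \<le> h s + q x)"
  shows "barriers L h q s"
  using assms
proof
  assume "\<forall>s. \<exists>(m::nat) (\<xi> :: nat \<Rightarrow> 'a) \<delta>. m \<ge> 1 \<and> 0 \<in> convex hull (\<xi> ` {1..m}) \<and> \<delta> > 0 \<and>
            (AE x in \<mu>. \<forall>t\<in>{s - \<delta>..s + \<delta>}. (\<Sum>j=1..m. Lbar p L x t (\<xi> j)) \<le> h s + q x)"
  then obtain m :: nat and \<xi> :: "nat \<Rightarrow> 'a" and \<delta> where \<xi>: "0 \<in> convex hull (\<xi> ` {1..m})" and \<delta>: "\<delta> > 0"
    and ae: "AE x in \<mu>. \<forall>t\<in>{s - \<delta>..s + \<delta>}. (\<Sum>j=1..m. Lbar p L x t (\<xi> j)) \<le> h s + q x"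
    by blast
  obtain b g where b: "sob b g" "\<And>x. x \<in> \<Omega> \<Longrightarrow> 0 \<le> b x \<and> b x \<le> \<delta>" "range g \<subseteq> \<xi> ` {1..m}"
    using sob_small_prescribed_gradients[OF _ \<xi> \<delta>] by auto
  \<comment> \<open>The shift keeps the gradient and moves the values from [0, \<delta>] to
    [- \<delta>, 0], still in the window around s where assumption (1) gives its bound.\<close>
  have b': "sob (\<lambda>x. b x - \<delta>) g" using sob_diff[OF b(1) sob_const[of \<delta>]] by simp
  have "AE x in \<mu>. 0 \<le> b x \<and> b x \<le> \<delta> \<and> - \<delta> \<le> b x - \<delta> \<and> b x - \<delta> \<le> 0 \<and>
       Lbar p L x (s + b x) (g x) \<le> h s + q x \<and> Lbar p L x (s + (b x - \<delta>)) (g x) \<le> h s + q x"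
    (is "AE x in _. ?P x")
    using ae
  proof (rule AE_mp, intro AE_I2 impI)
    fix x assume "x \<in> space \<mu>"
      and le: "\<forall>t\<in>{s - \<delta>..s + \<delta>}. (\<Sum>j=1..m. Lbar p L x t (\<xi> j)) \<le> h s + q x"
    then have bx: "0 \<le> b x" "b x \<le> \<delta>" using b(2)[of x] by auto
    obtain j where j: "j \<in> {1..m}" "g x = \<xi> j" using b(3) by blast
    have "Lbar p L x t (g x) \<le> h s + q x" if "t \<in> {s - \<delta>..s + \<delta>}" for t
    proof -
      \<comment> \<open>The gradient takes one value \<xi> j at x, and as all summands are
        nonnegative the bound on the sum bounds this single term.\<close>
      have "Lbar p L x t (\<xi> j) \<le> (\<Sum>j=1..m. Lbar p L x t (\<xi> j))"
        using j(1) by (intro member_le_sum) (auto simp: Lbar_nonneg)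
      also have "\<dots> \<le> h s + q x" using le that by blast
      finally show ?thesis by (simp add: j(2))
    qed
    then show "?P x"
      using bx \<delta> by simp
  qed
  with b(1) b' show ?thesis unfolding barriers_def by blast
next
  assume "\<exists>b \<in> W1p p \<Omega> \<inter> Linf \<Omega>. AE x in \<mu>. \<forall>s t. ereal \<bar>s - t\<bar> \<le> ess_osc \<Omega> b \<longrightarrow>
               Lbar p L x t (weak_grad \<Omega> b x) \<le> h s + q x"
  then obtain b where b: "b \<in> W1p p \<Omega>" "b \<in> Linf \<Omega>"
    and ae: "AE x in \<mu>. \<forall>s t. ereal \<bar>s - t\<bar> \<le> ess_osc \<Omega> b \<longrightarrow> Lbar p L x t (weak_grad \<Omega> b x) \<le> h s + q x"
    by auto
  show ?thesis
  \<comment> \<open>Over the empty set the essential bounds are not finite; every almost everywhere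
    statement is vacuous there.\<close>
  proof (cases "\<Omega> = {}")
    case True
    have "AE x in \<mu>. P x" for P by (rule AE_I2) (simp add: True)
    then show ?thesis using sob_const[of 0] unfolding barriers_def by blast
  next
    case False
    obtain \<alpha> \<beta> where osc: "ess_osc \<Omega> b = ereal (\<beta> - \<alpha>)" and bd: "AE x in \<mu>. \<alpha> \<le> b x \<and> b x \<le> \<beta>"
      using essential_bounds[OF False b(2)] by metis
    have sb: "sob b (weak_grad \<Omega> b)" using b(1) sob_weak_grad_sob by (auto simp: W1p_iff)
    have s1: "sob (\<lambda>x. b x - \<alpha>) (weak_grad \<Omega> b)" using sob_diff[OF sb sob_const[of \<alpha>]] by simp
    have s2: "sob (\<lambda>x. b x - \<beta>) (weak_grad \<Omega> b)" using sob_diff[OF sb sob_const[of \<beta>]] by simp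
    have "AE x in \<mu>. 0 \<le> b x - \<alpha> \<and> b x - \<alpha> \<le> \<beta> - \<alpha> \<and> - (\<beta> - \<alpha>) \<le> b x - \<beta> \<and> b x - \<beta> \<le> 0 \<and>
       Lbar p L x (s + (b x - \<alpha>)) (weak_grad \<Omega> b x) \<le> h s + q x \<and> Lbar p L x (s + (b x - \<beta>)) (weak_grad \<Omega> b x) \<le> h s + q x"
      (is "AE x in _. ?P x")
      using bd ae
    proof eventually_elim
      fix x assume x: "\<alpha> \<le> b x \<and> b x \<le> \<beta>"
        and l: "\<forall>s t. ereal \<bar>s - t\<bar> \<le> ess_osc \<Omega> b \<longrightarrow> Lbar p L x t (weak_grad \<Omega> b x) \<le> h s + q x"
      \<comment> \<open>Subtracting the essential infimum or supremum moves the level by at most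
        \<beta> - \<alpha>, the essential oscillation allowed by assumption (2).\<close>
      have "\<bar>s - (s + (b x - \<alpha>))\<bar> \<le> \<beta> - \<alpha>" "\<bar>s - (s + (b x - \<beta>))\<bar> \<le> \<beta> - \<alpha>" using x by auto
      then show "?P x"
        using x l[unfolded osc ereal_less_eq(3)] by simp
    qed
    with s1 s2 show ?thesis unfolding barriers_def by blast
  qed
qed

section \<open>Truncation between two barriers and its error\<close>

definition "error L q u n = 2 / real (Suc n) + (LINT x|\<mu>. indicator {real n..} \<bar>u x\<bar> *
  (\<bar>q x\<bar> + \<bar>along \<Omega> L u x\<bar> + \<bar>u x\<bar> powr p + norm (weak_grad \<Omega> u x) powr p))"

text \<open>u and v differ only inside {|u| >= n}. On the cut regions the new integrand is at most
  h(s) + q or h(-t) + q, and everything lost with u is part of the integrable function F. The two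
  terms 1 / (n + 1) in \<open>error\<close> pay for the two levels, its integral for the tail of
  F.\<close>

lemma truncation:
  fixes n :: nat
  assumes L: "caratheodory \<Omega> L" and q: "integrable \<mu> q"
    and h: "h \<in> borel_measurable borel" "\<And>s. 0 \<le> h s"
    and bar: "\<And>s. barriers L h q s"
    and \<phi>: "AE x in \<mu>. \<bar>\<phi> x\<bar> \<le> M"
    and u: "u \<in> admissible p \<Omega> \<phi> L" and hu: "integrable \<mu> (\<lambda>x. h (u x))"
  obtains v g where "sob v g" "v \<in> admissible p \<Omega> \<phi> L \<inter> Linf \<Omega>"
    "pint (\<lambda>x. v x - u x) \<le> error L q u n"
    "pint (\<lambda>x. g x - weak_grad \<Omega> u x) \<le> 2 powr p * error L q u n"
    "(LINT x|\<mu>. \<bar>along \<Omega> L v x - along \<Omega> L u x\<bar>) \<le> error L q u n"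
proof -
  define gu where "gu = weak_grad \<Omega> u"
  have uW: "u \<in> W1p p \<Omega>" and u0: "(\<lambda>x. u x - \<phi> x) \<in> W1p0 p \<Omega>" and ui: "integrable \<mu> (along \<Omega> L u)"
    using u by (auto simp: admissible_def W1p_bdry_def)
  have su: "sob u gu" using uW sob_weak_grad_sob unfolding gu_def by (auto simp: W1p_iff)
  obtain w' where sw: "sob (\<lambda>x. u x - \<phi> x) w'" using u0 by (auto simp: W1p0_def W1p_iff)
  then have w0: "sob0 (\<lambda>x. u x - \<phi> x) w'" using u0 W1p0_iff by blast
  have s\<phi>: "sob \<phi> (\<lambda>x. gu x - w' x)" using sob_diff[OF su sw] by simp
  define F where "F x = \<bar>q x\<bar> + \<bar>along \<Omega> L u x\<bar> + \<bar>u x\<bar> powr p + norm (gu x) powr p" for x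
  have F0: "0 \<le> F x" for x by (simp add: F_def)
  have Fi: "integrable \<mu> F"
    unfolding F_def using q ui Lp_powr[OF sobD(1)[OF su]] Lp_powr[OF sobD(2)[OF su]] by simp
  note [measurable] = sobD(6,7)[OF su] h(1) borel_measurable_integrable[OF q] borel_measurable_integrable[OF Fi]
    borel_measurable_integrable[OF ui]
  \<comment> \<open>Levels above n place the cut regions inside {|u| >= n}; levels above M make the
    barriers enclose \<phi>. The further maximum with 1 keeps the lower barrier strictly below the
    upper one.\<close>
  define S where "S = max (real n) (M + 1)"
  have e: "0 < 1 / real (Suc n)" by simp
  obtain s where s: "max S 1 \<le> s" "h s * (LINT x|\<mu>. indicator {s..} (u x)) < 1 / real (Suc n)"
    by (rule exists_small_level[OF finite_measure_\<Omega> sobD(6)[OF su] h(2) hu e, of "max S 1"]) (rule that)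
  have hu': "integrable \<mu> (\<lambda>x. h (- (- u x)))" using hu by simp
  obtain t where t: "max S 1 \<le> t" "h (- t) * (LINT x|\<mu>. indicator {t..} (- u x)) < 1 / real (Suc n)"
    by (rule exists_small_level[OF finite_measure_\<Omega> sobD(6)[OF sob_uminus[OF su]], where h="\<lambda>s. h (- s)", OF h(2) hu' e, of "max S 1"])
      (rule that)
  obtain b g1 b0 g0 C where b: "sob b g1" and ae: "AE x in \<mu>. 0 \<le> b x \<and> b x \<le> C \<and> - C \<le> b0 x \<and> b0 x \<le> 0 \<and>
       Lbar p L x (s + b x) (g1 x) \<le> h s + q x \<and> Lbar p L x (s + b0 x) (g0 x) \<le> h s + q x"
    using bar[of s, unfolded barriers_def] by (elim exE conjE)
  have b_AE: "AE x in \<mu>. 0 \<le> b x \<and> b x \<le> C \<and> Lbar p L x (s + b x) (g1 x) \<le> h s + q x"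
    using ae by (rule eventually_mono) blast
  obtain b1 g3 b' g2 C' where b': "sob b' g2" and ae': "AE x in \<mu>. 0 \<le> b1 x \<and> b1 x \<le> C' \<and> - C' \<le> b' x \<and> b' x \<le> 0 \<and>
       Lbar p L x (- t + b1 x) (g3 x) \<le> h (- t) + q x \<and> Lbar p L x (- t + b' x) (g2 x) \<le> h (- t) + q x"
    using bar[of "- t", unfolded barriers_def] by (elim exE conjE)
  have b'_AE: "AE x in \<mu>. - C' \<le> b' x \<and> b' x \<le> 0 \<and> Lbar p L x (- t + b' x) (g2 x) \<le> h (- t) + q x"
    using ae' by (rule eventually_mono) blast
  define v where "v x = max (min (u x) (s + b x)) (- t + b' x)" for x
  define g where "g x = (if - t + b' x < min (u x) (s + b x) then (if s + b x < u x then g1 x else gu x) else g2 x)" for x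
  have ssb: "sob (\<lambda>x. s + b x) g1" using sob_add[OF sob_const[of s] b] by simp
  have stb: "sob (\<lambda>x. - t + b' x) g2" using sob_add[OF sob_const[of "- t"] b'] by simp
  have sv: "sob v g"
    using sob_max[OF sob_min[OF su ssb] stb] unfolding v_def g_def .
  note [measurable] = sobD(6,7)[OF sv]
  have s1: "1 \<le> s" "M \<le> s" "real n \<le> s" and t1: "1 \<le> t" "M \<le> t" "real n \<le> t"
    using s(1) t(1) by (auto simp: S_def)

  \<comment> \<open>With w = u - \<phi>, the function v - \<phi> equals w - (w - c1)^+ + (- w -
    c2)^+, where c1 and c2 are the distances from \<phi> to the upper and to the lower barrier. Both
    are nonnegative by the choice of the levels, so each term has zero boundary values.\<close>
  have v0: "sob0 (\<lambda>x. v x - \<phi> x) (\<lambda>x. g x - (gu x - w' x))"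
  proof (rule sob0_cong_AE)
    have c1: "sob (\<lambda>x. s + b x - \<phi> x) (\<lambda>x. g1 x - (gu x - w' x))" by (rule sob_diff[OF ssb s\<phi>])
    have c2: "sob (\<lambda>x. \<phi> x - (- t + b' x)) (\<lambda>x. gu x - w' x - g2 x)" by (rule sob_diff[OF s\<phi> stb])
    have "AE x in \<mu>. 0 \<le> s + b x - \<phi> x"
      using b_AE \<phi> by eventually_elim (use s1 in auto)
    note a1 = sob0_pos_diff[OF w0 c1 this]
    have "AE x in \<mu>. 0 \<le> \<phi> x - (- t + b' x)"
      using b'_AE \<phi> by eventually_elim (use t1 in auto)
    note a2 = sob0_pos_diff[OF sob0_uminus[OF w0] c2 this]
    show "sob0 (\<lambda>x. u x - \<phi> x + - max 0 (u x - \<phi> x - (s + b x - \<phi> x)) + max 0 (- (u x - \<phi> x) - (\<phi> x - (- t + b' x))))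
      (\<lambda>x. w' x + - (if 0 < u x - \<phi> x - (s + b x - \<phi> x) then w' x - (g1 x - (gu x - w' x)) else 0)
        + (if 0 < - (u x - \<phi> x) - (\<phi> x - (- t + b' x)) then - w' x - (gu x - w' x - g2 x) else 0))"
      by (rule sob0_add[OF sob0_add[OF w0 sob0_uminus[OF a1]] a2])
    show "sob (\<lambda>x. v x - \<phi> x) (\<lambda>x. g x - (gu x - w' x))" by (rule sob_diff[OF sv s\<phi>])
    show "AE x in \<mu>. u x - \<phi> x + - max 0 (u x - \<phi> x - (s + b x - \<phi> x)) + max 0 (- (u x - \<phi> x) - (\<phi> x - (- t + b' x))) = v x - \<phi> x"
      using b_AE b'_AE
    proof eventually_elim
      fix x assume "0 \<le> b x \<and> b x \<le> C \<and> Lbar p L x (s + b x) (g1 x) \<le> h s + q x"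
        and "- C' \<le> b' x \<and> b' x \<le> 0 \<and> Lbar p L x (- t + b' x) (g2 x) \<le> h (- t) + q x"
      then have "- t + b' x < s + b x" using s1 t1 by linarith
      then show "u x - \<phi> x + - max 0 (u x - \<phi> x - (s + b x - \<phi> x)) + max 0 (- (u x - \<phi> x) - (\<phi> x - (- t + b' x))) = v x - \<phi> x"
        by (auto simp: v_def max_def min_def)
    qed
  qed
  \<comment> \<open>One dominating function for the errors in v, in its gradient (up to 2^p) and in
    L: a constant on each superlevel set plus the tail of F.\<close>
  define T where "T x = h s * indicator {s..} (u x) + h (- t) * indicator {t..} (- u x) + indicator {real n..} \<bar>u x\<bar> * F x" for x
  have T0: "0 \<le> T x" for x using F0[of x] h(2) by (simp add: T_def)
  interpret finite_measure \<mu> by (rule finite_measure_\<Omega>)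
  have i1: "integrable \<mu> (\<lambda>x. indicator {s..} (u x) :: real)" "integrable \<mu> (\<lambda>x. indicator {t..} (- u x) :: real)"
    by (rule integrable_const_bound[of _ 1]; auto simp: indicator_def)+
  have i2: "integrable \<mu> (\<lambda>x. indicator {real n..} \<bar>u x\<bar> * F x)"
    by (rule Bochner_Integration.integrable_bound[OF Fi]) (auto simp: indicator_def)
  have Ti: "integrable \<mu> T" unfolding T_def using i1 i2 by simp
  define E where "E = error L q u n"
  have TE: "(LINT x|\<mu>. T x) \<le> E"
  proof -
    have "(LINT x|\<mu>. T x) = h s * (LINT x|\<mu>. indicator {s..} (u x)) + h (- t) * (LINT x|\<mu>. indicator {t..} (- u x))
       + (LINT x|\<mu>. indicator {real n..} \<bar>u x\<bar> * F x)"
      unfolding T_def using i1 i2 by simp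
    also have "\<dots> \<le> 1 / real (Suc n) + 1 / real (Suc n) + (LINT x|\<mu>. indicator {real n..} \<bar>u x\<bar> * F x)"
      using s(2) t(2) by (intro add_mono) auto
    finally show ?thesis by (simp add: E_def error_def F_def gu_def)
  qed
  have key: "AE x in \<mu>. \<bar>L x (v x) (g x) - along \<Omega> L u x\<bar> \<le> T x \<and> norm (v x - u x) powr p \<le> T x
      \<and> norm (g x - gu x) powr p \<le> 2 powr p * T x \<and> \<bar>v x\<bar> \<le> s + t + \<bar>C\<bar> + \<bar>C'\<bar>"
    using b_AE b'_AE along_AE[OF su]
  proof eventually_elim
    fix x assume bx: "0 \<le> b x \<and> b x \<le> C \<and> Lbar p L x (s + b x) (g1 x) \<le> h s + q x"
      and b'x: "- C' \<le> b' x \<and> b' x \<le> 0 \<and> Lbar p L x (- t + b' x) (g2 x) \<le> h (- t) + q x"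
      and ax: "along \<Omega> L u x = L x (u x) (gu x)"
    have lt: "- t + b' x < s + b x" using bx b'x s1 t1 by linarith
    have vb: "\<bar>v x\<bar> \<le> s + t + \<bar>C\<bar> + \<bar>C'\<bar>"
      using bx b'x s1 t1 by (auto simp: v_def max_def min_def)
    \<comment> \<open>\<open>F x - \<bar>q x\<bar>\<close> collects the terms of the old function.
      Since \<open>Lbar\<close> contains both |L| and the p-th power of the gradient, one inequality
      settles two of the errors; the |q| in F absorbs the q in the barrier bound.\<close>
    have gen: "\<bar>L x (v x) (g x) - along \<Omega> L u x\<bar> \<le> T x \<and> norm (g x - gu x) powr p \<le> 2 powr p * T x"
      if le: "Lbar p L x (v x) (g x) + F x - \<bar>q x\<bar> \<le> T x"
    proof
      have nn: "0 \<le> \<bar>u x\<bar> powr p" "0 \<le> norm (gu x) powr p" "0 \<le> norm (g x) powr p" by auto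
      show "\<bar>L x (v x) (g x) - along \<Omega> L u x\<bar> \<le> T x"
        using le nn unfolding Lbar_def F_def by linarith
      have "norm (g x) powr p + norm (gu x) powr p \<le> T x"
        using le nn unfolding Lbar_def F_def by linarith
      then have "2 powr p * (norm (g x) powr p + norm (- gu x) powr p) \<le> 2 powr p * T x"
        by (intro mult_left_mono) auto
      from order_trans[OF norm_add_powr_le[OF p0(1)] this]
      show "norm (g x - gu x) powr p \<le> 2 powr p * T x" by simp
    qed
    have vu: "norm (v x - u x) powr p \<le> T x" if "\<bar>v x - u x\<bar> \<le> \<bar>u x\<bar>" "F x \<le> T x"
    proof -
      have "norm (v x - u x) powr p \<le> \<bar>u x\<bar> powr p" using that p0 by (intro powr_mono2) auto
      also have "\<dots> \<le> F x" by (simp add: F_def)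
      finally show ?thesis using that by linarith
    qed
    \<comment> \<open>Equality with the lower barrier belongs to the second case, because
      \<open>g\<close> takes the value \<open>g2\<close> there; on the upper barrier
      \<open>g\<close> keeps the gradient of u.\<close>
    consider "s + b x < u x" | "u x \<le> - t + b' x" | "u x \<le> s + b x" "- t + b' x < u x" by linarith
    then show "\<bar>L x (v x) (g x) - along \<Omega> L u x\<bar> \<le> T x \<and> norm (v x - u x) powr p \<le> T x
      \<and> norm (g x - gu x) powr p \<le> 2 powr p * T x \<and> \<bar>v x\<bar> \<le> s + t + \<bar>C\<bar> + \<bar>C'\<bar>"
    proof cases
      case 1
      have vg: "v x = s + b x" "g x = g1 x" using 1 lt by (auto simp: v_def g_def max_def min_def)
      have "T x = h s + h (- t) * indicator {t..} (- u x) + F x" using 1 bx s1 by (simp add: T_def)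
      then have TF: "h s + F x \<le> T x" using h(2)[of "- t"] by simp
      have "Lbar p L x (v x) (g x) + F x - \<bar>q x\<bar> \<le> T x" using bx TF unfolding vg by linarith
      \<comment> \<open>Here 0 <= s + b x < u x: cutting moves u towards 0 without passing
        it.\<close>
      moreover have "\<bar>v x - u x\<bar> \<le> \<bar>u x\<bar>" using 1 bx s1 by (simp add: vg)
      moreover have "F x \<le> T x" using TF h(2)[of s] by linarith
      ultimately show ?thesis using gen vu vb by blast
    next
      case 2
      have vg: "v x = - t + b' x" "g x = g2 x" using 2 lt by (auto simp: v_def g_def max_def min_def)
      have "T x = h s * indicator {s..} (u x) + h (- t) + F x" using 2 b'x t1 by (simp add: T_def)
      then have TF: "h (- t) + F x \<le> T x" using h(2)[of s] by simp
      have "Lbar p L x (v x) (g x) + F x - \<bar>q x\<bar> \<le> T x" using b'x TF unfolding vg by linarith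
      moreover have "\<bar>v x - u x\<bar> \<le> \<bar>u x\<bar>" using 2 b'x t1 by (simp add: vg)
      moreover have "F x \<le> T x" using TF h(2)[of "- t"] by linarith
      ultimately show ?thesis using gen vu vb by blast
    next
      case 3
      have vg: "v x = u x" "g x = gu x" using 3 by (auto simp: v_def g_def max_def min_def)
      show ?thesis using T0[of x] vb p0 by (simp add: vg ax)
    qed
  qed
  have av: "AE x in \<mu>. \<bar>along \<Omega> L v x - along \<Omega> L u x\<bar> \<le> T x"
    using key along_AE[OF sv, of L] by eventually_elim simp
  have [measurable]: "along \<Omega> L v \<in> borel_measurable \<mu>"
    unfolding along_def[abs_def]
    by (rule caratheodory_measurable[OF L \<Omega>_sets sobD(6)[OF sv] sobD(7)[OF sob_weak_grad_sob[OF sv]]])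
  \<comment> \<open>Integrability of L along v is not known in advance; it follows from this
    difference and the integrability of L along u.\<close>
  have di: "integrable \<mu> (\<lambda>x. along \<Omega> L v x - along \<Omega> L u x)"
    by (rule Bochner_Integration.integrable_bound[OF Ti]) (use av T0 in auto)
  have vi: "integrable \<mu> (along \<Omega> L v)"
    using Bochner_Integration.integrable_add[OF di ui] by simp
  have vL: "v \<in> Linf \<Omega>"
    unfolding Linf_def using key by (auto elim!: eventually_mono)
  have "v \<in> admissible p \<Omega> \<phi> L"
    unfolding admissible_def W1p_bdry_def
    using vi sv v0 W1p0_iff[OF sob0_sob[OF v0]] by (auto simp: W1p_iff)
  then have 1: "v \<in> admissible p \<Omega> \<phi> L \<inter> Linf \<Omega>" using vL by blast
  have 2: "pint (\<lambda>x. v x - u x) \<le> E"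
  proof -
    have "pint (\<lambda>x. v x - u x) \<le> (LINT x|\<mu>. T x)"
      unfolding pint_def
      by (rule integral_mono_AE[OF Lp_powr[OF sobD(1)[OF sob_diff[OF sv su]]] Ti])
        (use key in \<open>auto elim!: eventually_mono\<close>)
    with TE show ?thesis by linarith
  qed
  have 3: "pint (\<lambda>x. g x - gu x) \<le> 2 powr p * E"
  proof -
    have "pint (\<lambda>x. g x - gu x) \<le> (LINT x|\<mu>. 2 powr p * T x)"
      unfolding pint_def
      by (rule integral_mono_AE[OF Lp_powr[OF sobD(2)[OF sob_diff[OF sv su]]] integrable_mult_right[OF Ti]])
        (use key in \<open>auto elim!: eventually_mono\<close>)
    also have "\<dots> \<le> 2 powr p * E" using TE by (simp add: mult_left_mono)
    finally show ?thesis .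
  qed
  have 4: "(LINT x|\<mu>. \<bar>along \<Omega> L v x - along \<Omega> L u x\<bar>) \<le> E"
    using integral_mono_AE[OF integrable_abs[OF di] Ti av] TE by linarith
  show ?thesis
    using that[OF sv 1] 2 3 4 unfolding E_def gu_def by blast
qed

end

theorem theorem1p2:
  fixes \<Omega> :: "'a::euclidean_space set"
    and p :: real
    and \<phi> :: "'a \<Rightarrow> real"
    and L :: "'a \<Rightarrow> real \<Rightarrow> 'a \<Rightarrow> real"
    and q :: "'a \<Rightarrow> real"
    and h :: "real \<Rightarrow> real"
  assumes "open \<Omega>" and "bounded \<Omega>"
    and "1 \<le> p" and "p \<le> real DIM('a)"
    and "\<phi> \<in> W1p p UNIV \<inter> Linf UNIV"
    and "caratheodory \<Omega> L"
    and "integrable (lebesgue_on \<Omega>) q"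
    and "h \<in> borel_measurable borel" and "\<And>s. h s \<ge> 0"
    and "(\<forall>s. \<exists>(m::nat) (\<xi> :: nat \<Rightarrow> 'a) \<delta>.
            m \<ge> 1 \<and> 0 \<in> convex hull (\<xi> ` {1..m}) \<and> \<delta> > 0 \<and>
            (AE x in lebesgue_on \<Omega>. \<forall>t\<in>{s - \<delta>..s + \<delta>}.
               (\<Sum>j=1..m. Lbar p L x t (\<xi> j)) \<le> h s + q x))
       \<or> (\<exists>b \<in> W1p p \<Omega> \<inter> Linf \<Omega>.
            AE x in lebesgue_on \<Omega>. \<forall>s t. ereal \<bar>s - t\<bar> \<le> ess_osc \<Omega> b \<longrightarrow>
               Lbar p L x t (weak_grad \<Omega> b x) \<le> h s + q x)"
  shows "\<forall>u \<in> admissible p \<Omega> \<phi> L.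
           integrable (lebesgue_on \<Omega>) (h \<circ> u) \<longrightarrow> Linf_regular_at p \<Omega> \<phi> L u"
proof (intro ballI impI)
  fix u assume u: "u \<in> admissible p \<Omega> \<phi> L" and hu: "integrable (lebesgue_on \<Omega>) (h \<circ> u)"
  interpret sobolev_domain \<Omega> p by unfold_locales (use assms(1-3) in auto)
  let ?M = "lebesgue_on \<Omega>"
  obtain M where "AE x in lebesgue_on UNIV. \<bar>\<phi> x\<bar> \<le> M"
    using assms(5) by (auto simp: Linf_def)
  then have \<phi>: "AE x in ?M. \<bar>\<phi> x\<bar> \<le> M"
    unfolding AE_\<Omega> lebesgue_on_UNIV_eq by (rule eventually_mono) simp
  have su: "sob u (weak_grad \<Omega> u)"
    using u sob_weak_grad_sob by (auto simp: admissible_def W1p_bdry_def W1p_iff)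
  define E where "E = error L q u"
  define Q where "Q n v g \<longleftrightarrow> sob v g \<and> v \<in> admissible p \<Omega> \<phi> L \<inter> Linf \<Omega> \<and> pint (\<lambda>x. v x - u x) \<le> E n \<and>
    pint (\<lambda>x. g x - weak_grad \<Omega> u x) \<le> 2 powr p * E n \<and> (LINT x|?M. \<bar>along \<Omega> L v x - along \<Omega> L u x\<bar>) \<le> E n"
    for n v g
  have "\<exists>v g. Q n v g" for n
  proof -
    have hu': "integrable ?M (\<lambda>x. h (u x))" using hu by (simp add: comp_def)
    obtain v g where "sob v g" "v \<in> admissible p \<Omega> \<phi> L \<inter> Linf \<Omega>" "pint (\<lambda>x. v x - u x) \<le> E n"
      "pint (\<lambda>x. g x - weak_grad \<Omega> u x) \<le> 2 powr p * E n"
      "(LINT x|?M. \<bar>along \<Omega> L v x - along \<Omega> L u x\<bar>) \<le> E n"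
      by (rule truncation[OF assms(6-9) barriers_exist[OF assms(10)] \<phi> u hu', of n, folded E_def]) (rule that)
    then have "Q n v g" unfolding Q_def by blast
    then show ?thesis by blast
  qed
  then obtain v g where "\<And>n. Q n (v n) (g n)" by metis
  then have v: "\<And>n. sob (v n) (g n)" "\<And>n. v n \<in> admissible p \<Omega> \<phi> L \<inter> Linf \<Omega>"
    "\<And>n. pint (\<lambda>x. v n x - u x) \<le> E n" "\<And>n. pint (\<lambda>x. g n x - weak_grad \<Omega> u x) \<le> 2 powr p * E n"
    "\<And>n. (LINT x|?M. \<bar>along \<Omega> L (v n) x - along \<Omega> L u x\<bar>) \<le> E n"
    unfolding Q_def by blast+
  have "integrable ?M (\<lambda>x. \<bar>q x\<bar> + \<bar>along \<Omega> L u x\<bar> + \<bar>u x\<bar> powr p + norm (weak_grad \<Omega> u x) powr p)"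
    using assms(7) u Lp_powr[OF sobD(1)[OF su]] Lp_powr[OF sobD(2)[OF su]] by (simp add: admissible_def)
  from integral_tail_tendsto_0[OF _ this, of "\<lambda>x. \<bar>u x\<bar>"] sobD(6)[OF su]
  have tail: "(\<lambda>n. LINT x|?M. indicator {real n..} \<bar>u x\<bar> *
        (\<bar>q x\<bar> + \<bar>along \<Omega> L u x\<bar> + \<bar>u x\<bar> powr p + norm (weak_grad \<Omega> u x) powr p)) \<longlonglongrightarrow> 0"
    by simp
  have "(\<lambda>n. 2 * inverse (real (Suc n))) \<longlonglongrightarrow> 0"
    by (rule tendsto_mult_right_zero[OF LIMSEQ_inverse_real_of_nat])
  from tendsto_add[OF this tail] have E: "E \<longlonglongrightarrow> 0"
    unfolding E_def error_def[abs_def] by (simp add: divide_inverse)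
  have E': "(\<lambda>n. 2 powr p * E n) \<longlonglongrightarrow> 0" by (rule tendsto_mult_right_zero[OF E])
  have "(\<lambda>n. pint (\<lambda>x. v n x - u x)) \<longlonglongrightarrow> 0"
    by (rule squeeze_zero[OF pint_nonneg v(3) E])
  moreover have "(\<lambda>n. pint (\<lambda>x. g n x - weak_grad \<Omega> u x)) \<longlonglongrightarrow> 0"
    by (rule squeeze_zero[OF pint_nonneg v(4) E'])
  ultimately have "(\<lambda>n. W1p_norm p \<Omega> (\<lambda>x. v n x - u x)) \<longlonglongrightarrow> 0"
    by (rule W1p_norm_tendsto_0[OF sob_diff[OF v(1) su]])
  moreover have "(\<lambda>n. LINT x|?M. \<bar>along \<Omega> L (v n) x - along \<Omega> L u x\<bar>) \<longlonglongrightarrow> 0"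
    by (rule squeeze_zero[OF _ v(5) E]) (intro integral_nonneg_AE AE_I2 abs_ge_zero)
  ultimately show "Linf_regular_at p \<Omega> \<phi> L u"
    unfolding Linf_regular_at_def using v(2) by blast
qed

end
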